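(* Let $(\beta^*,p^*,x^* )$ be the limit first-price pacing equilibrium $\mathrm{FPPE}(b,v,s)$ with revenue $\mathrm{REV}^*$, and for each $t$ let $\beta^\gamma$ and $\mathrm{REV}^\gamma$ be the pacing multiplier vector and revenue of the observed equilibrium $\widehat{\mathrm{FPPE}}(b,v,t^{-1},\gamma)$, where $\gamma=(\theta^1,\dots,\theta^t)$ consists of i.i.d. draws from $s$. Then, as $t\to\infty$, $\beta^\gamma\to\beta^*$ in probability and $\mathrm{REV}^\gamma\to\mathrm{REV}^*$ in probability. Furthermore, if (SMO) and (SCS) hold, then $$\sqrt t(\beta^\gamma-\beta^* )=t^{-1/2}\sum_{\tau=1}^t D_\beta(\theta^\tau)+o_p(1),\qquad \sqrt t(\mathrm{REV}^\gamma-\mathrm{REV}^* )=t^{-1/2}\sum_{\tau=1}^t D_{\mathrm{REV}}(\theta^\tau)+o_p(1).$$ Consequently, $\sqrt t(\beta^\gamma-\beta^* )$ and $\sqrt t(\mathrm{REV}^\gamma-\mathrm{REV}^* )$ are asymptotically normal (converge in distribution to possibly degenerate normals) with means zero and (co)variances $$\Sigma_\beta=\mathbb E[D_\beta(\theta)D_\beta(\theta)^\top]=(\mathcal H_B)^\dagger\,\mathrm{Var}(\mu^* )\,(\mathcal H_B)^\dagger,\qquad \sigma^2_{\mathrm{REV}}=\mathbb E[D_{\mathrm{REV}}(\theta)^2].$$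
   Context: Market. There are $n$ buyers with budgets $b=(b_1,\dots,b_n)$, $b_i>0$, and an item space $\Theta$ with integrating measure $d\theta$. $L^p$ (resp. $L^p_+$) denotes (nonnegative) $L^p$ functions on $\Theta$; functions agreeing outside a measure-zero set are identified; $\langle f,g\rangle=\int_\Theta fg\,d\theta$. Buyer $i$ has valuation $v_i\in L^1_+$, $v=(v_1,\dots,v_n)$, with $\bar v=\max_i\sup_\theta v_i(\theta)<\infty$. The supply is $s\in L^\infty_+$ with $\int_\Theta s\,d\theta=1$. Write $\mathbb E[g]=\int g(\theta)s(\theta)\,d\theta$, and $\mathrm{Var}(g)$ for the variance (covariance matrix if $g$ is vector-valued) under the density $s$. Limit FPPE. $\mathrm{FPPE}(b,v,s)$ is a tuple $(\beta,p,x_1,\dots,x_n)\in[0,1]^n\times L^1_+\times(L^\infty_+)^n$ such that: (i) for all $\theta$, $p(\theta)=\max_i\beta_iv_i(\theta)$, and $x_i(\theta)>0$ implies $\beta_iv_i(\theta)=\max_k\beta_kv_k(\theta)$; (ii) for all $i$, $\int x_i p s\,d\theta\le b_i$, and for all $\theta$, $\sum_i x_i(\theta)\le1$; (iii) for all $i$, $\int x_ips\,d\theta<b_i$ implies $\beta_i=1$, and for all $\theta$, $p(\theta)>0$ implies $\sum_ix_i(\theta)=1$. It is known that it exists and $\beta^*,p^*$ are unique; limit quantities carry a superscript $*$. Define $\mathrm{REV}^*=\int p^*s\,d\theta$, leftover budgets $\delta_i^*=b_i-\langle p^*,sx_i^*\rangle$, item utilities $\bar\mu_i^*=\langle v_i,sx_i^*\rangle$,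 and $\mu^*(\theta)=(x_1^*(\theta)v_1(\theta),\dots,x_n^*(\theta)v_n(\theta))$, so $\bar\mu^*=\mathbb E[\mu^*]$. (Under (SMO) below, $\mu^*$, $\bar\mu^*$, $\delta^*$ are uniquely determined.) Observed FPPE. For items $\gamma=(\theta^1,\dots,\theta^t)$ and per-item supply $\sigma>0$, $\widehat{\mathrm{FPPE}}(b,v,\sigma,\gamma)$ consists of $\beta\in[0,1]^n$, $p\in\mathbb R_+^t$, $x_i\in[0,1]^t$ satisfying: $p(\theta^\tau)=\max_i\beta_iv_i(\theta^\tau)$ and $x_i(\theta^\tau)>0$ implies $\beta_iv_i(\theta^\tau)=\max_k\beta_kv_k(\theta^\tau)$; $\sigma\sum_\tau x_i(\theta^\tau)p(\theta^\tau)\le b_i$ and $\sum_ix_i(\theta^\tau)\le1$; $\sigma\sum_\tau x_i(\theta^\tau)p(\theta^\tau)<b_i$ implies $\beta_i=1$, and $p(\theta^\tau)>0$ implies $\sum_ix_i(\theta^\tau)=1$. With $\sigma=1/t$, quantities carry a superscript $\gamma$; $\mathrm{REV}^\gamma=\frac1t\sum_{\tau=1}^tp^\gamma(\theta^\tau)$. Dual program. $H(\beta)=\mathbb E[\max_i\beta_iv_i(\theta)]-\sum_ib_i\log\beta_i$; it is known that $\beta^*$ is its unique minimizer over $B=(0,1]^n$ (and $\beta^\gamma$ minimizes over $B$ the same function with $\mathbb E$ replaced by the empirical average over $\gamma$). (SMO): the map $\beta\mapsto\mathbb E[\max_i\beta_iv_i(\theta)]$ is $C^2$ in a neighborhood of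 $\beta^*$. (SCS): $\beta_i^*=1$ implies $\delta_i^*>0$, for every $i$. Let $\mathcal H=\nabla^2H(\beta^* )$, $\mathcal P=\mathrm{diag}(\mathbf 1(\beta_i^*<1))$, $\mathcal H_B=\mathcal P\mathcal H\mathcal P$; $\dagger$ is the Moore–Penrose pseudo-inverse. Influence functions: $D_\beta(\theta)=-(\mathcal H_B)^\dagger(\mu^*(\theta)-\bar\mu^* )$ and $D_{\mathrm{REV}}(\theta)=p^*(\theta)-\mathrm{REV}^*+(\bar\mu^* )^\top D_\beta(\theta)$. *)

theory Defs
  imports "HOL-Probability.Probability"
begin

section \<open>The market and the first-price pacing equilibria\<close>

text \<open>
  Buyers are the elements of a finite type \<open>'n\<close>; the item space with its integrating measure is
  \<open>M\<close>.  Members of $L^p$ are represented by functions, so a pointwise requirement on an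
  $L^p$ object is read as holding almost everywhere.
\<close>

definition L1_plus :: "'t measure \<Rightarrow> ('t \<Rightarrow> real) \<Rightarrow> bool" where
  "L1_plus M f \<longleftrightarrow> integrable M f \<and> (AE \<theta> in M. 0 \<le> f \<theta>)"

definition Linf_plus :: "'t measure \<Rightarrow> ('t \<Rightarrow> real) \<Rightarrow> bool" where
  "Linf_plus M f \<longleftrightarrow>
     f \<in> borel_measurable M \<and> (AE \<theta> in M. 0 \<le> f \<theta>) \<and> (\<exists>C. AE \<theta> in M. f \<theta> \<le> C)"

text \<open>
  Valuations are evaluated at sampled items, so a representative is fixed that is nonnegative
  and bounded at every item.
\<close>

definition market ::
  "'t measure \<Rightarrow> real^'n \<Rightarrow> ('n \<Rightarrow> 't \<Rightarrow> real) \<Rightarrow> ('t \<Rightarrow> real) \<Rightarrow> bool" where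
  "market M b v s \<longleftrightarrow>
     (\<forall>i. 0 < b $ i) \<and>
     (\<forall>i. integrable M (v i) \<and> (\<forall>\<theta>\<in>space M. 0 \<le> v i \<theta>)) \<and>
     (\<exists>C. \<forall>i. \<forall>\<theta>\<in>space M. v i \<theta> \<le> C) \<and>
     Linf_plus M s \<and> (\<integral>\<theta>. s \<theta> \<partial>M) = 1"

definition top_bid :: "('n::finite \<Rightarrow> 't \<Rightarrow> real) \<Rightarrow> real^'n \<Rightarrow> 't \<Rightarrow> real" where
  "top_bid v \<beta> \<theta> = (MAX i. \<beta> $ i * v i \<theta>)"

definition limit_FPPE ::
  "'t measure \<Rightarrow> real^'n \<Rightarrow> ('n::finite \<Rightarrow> 't \<Rightarrow> real) \<Rightarrow> ('t \<Rightarrow> real) \<Rightarrow>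
   real^'n \<Rightarrow> ('t \<Rightarrow> real) \<Rightarrow> ('n \<Rightarrow> 't \<Rightarrow> real) \<Rightarrow> bool" where
  "limit_FPPE M b v s \<beta> p x \<longleftrightarrow>
     (\<forall>i. \<beta> $ i \<in> {0..1}) \<and> L1_plus M p \<and> (\<forall>i. Linf_plus M (x i)) \<and>
     (AE \<theta> in M. p \<theta> = top_bid v \<beta> \<theta>) \<and>
     (AE \<theta> in M. \<forall>i. x i \<theta> > 0 \<longrightarrow> \<beta> $ i * v i \<theta> = top_bid v \<beta> \<theta>) \<and>
     (\<forall>i. (\<integral>\<theta>. x i \<theta> * p \<theta> * s \<theta> \<partial>M) \<le> b $ i) \<and>
     (AE \<theta> in M. (\<Sum>i\<in>UNIV. x i \<theta>) \<le> 1) \<and>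
     (\<forall>i. (\<integral>\<theta>. x i \<theta> * p \<theta> * s \<theta> \<partial>M) < b $ i \<longrightarrow> \<beta> $ i = 1) \<and>
     (AE \<theta> in M. p \<theta> > 0 \<longrightarrow> (\<Sum>i\<in>UNIV. x i \<theta>) = 1)"

text \<open>
  The observed items are \<open>\<gamma> 0, \<dots>, \<gamma> (t - 1)\<close>; prices and allocations are indexed by position,
  so repeated items are kept apart.
\<close>

definition observed_FPPE ::
  "real^'n \<Rightarrow> ('n::finite \<Rightarrow> 't \<Rightarrow> real) \<Rightarrow> real \<Rightarrow> nat \<Rightarrow> (nat \<Rightarrow> 't) \<Rightarrow>
   real^'n \<Rightarrow> (nat \<Rightarrow> real) \<Rightarrow> ('n \<Rightarrow> nat \<Rightarrow> real) \<Rightarrow> bool" where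
  "observed_FPPE b v \<sigma> t \<gamma> \<beta> p x \<longleftrightarrow>
     (\<forall>i. \<beta> $ i \<in> {0..1}) \<and> (\<forall>\<tau><t. 0 \<le> p \<tau>) \<and> (\<forall>i. \<forall>\<tau><t. x i \<tau> \<in> {0..1}) \<and>
     (\<forall>\<tau><t. p \<tau> = top_bid v \<beta> (\<gamma> \<tau>)) \<and>
     (\<forall>\<tau><t. \<forall>i. x i \<tau> > 0 \<longrightarrow> \<beta> $ i * v i (\<gamma> \<tau>) = top_bid v \<beta> (\<gamma> \<tau>)) \<and>
     (\<forall>i. \<sigma> * (\<Sum>\<tau><t. x i \<tau> * p \<tau>) \<le> b $ i) \<and>
     (\<forall>\<tau><t. (\<Sum>i\<in>UNIV. x i \<tau>) \<le> 1) \<and>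
     (\<forall>i. \<sigma> * (\<Sum>\<tau><t. x i \<tau> * p \<tau>) < b $ i \<longrightarrow> \<beta> $ i = 1) \<and>
     (\<forall>\<tau><t. p \<tau> > 0 \<longrightarrow> (\<Sum>i\<in>UNIV. x i \<tau>) = 1)"

definition observed_REV :: "nat \<Rightarrow> (nat \<Rightarrow> real) \<Rightarrow> real" where
  "observed_REV t p = (1 / real t) * (\<Sum>\<tau><t. p \<tau>)"


section \<open>Limit quantities\<close>

text \<open>The expectation $\mathbb{E}[g]$ under the supply density \<open>s\<close>.\<close>

definition Es :: "'t measure \<Rightarrow> ('t \<Rightarrow> real) \<Rightarrow> ('t \<Rightarrow> real) \<Rightarrow> real" where
  "Es M s g = (\<integral>\<theta>. g \<theta> * s \<theta> \<partial>M)"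

definition Var_mat :: "'t measure \<Rightarrow> ('t \<Rightarrow> real) \<Rightarrow> ('t \<Rightarrow> real^'n) \<Rightarrow> real^'n^'n" where
  "Var_mat M s g =
     (\<chi> i j. Es M s (\<lambda>\<theta>. (g \<theta> $ i - Es M s (\<lambda>\<theta>'. g \<theta>' $ i)) * (g \<theta> $ j - Es M s (\<lambda>\<theta>'. g \<theta>' $ j))))"

definition REV :: "'t measure \<Rightarrow> ('t \<Rightarrow> real) \<Rightarrow> ('t \<Rightarrow> real) \<Rightarrow> real" where
  "REV M s p = (\<integral>\<theta>. p \<theta> * s \<theta> \<partial>M)"

definition leftover ::
  "'t measure \<Rightarrow> real^'n \<Rightarrow> ('t \<Rightarrow> real) \<Rightarrow> ('t \<Rightarrow> real) \<Rightarrow> ('n \<Rightarrow> 't \<Rightarrow> real) \<Rightarrow> 'n \<Rightarrow> real" where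
  "leftover M b s p x i = b $ i - (\<integral>\<theta>. p \<theta> * (s \<theta> * x i \<theta>) \<partial>M)"

definition mu :: "('n \<Rightarrow> 't \<Rightarrow> real) \<Rightarrow> ('n \<Rightarrow> 't \<Rightarrow> real) \<Rightarrow> 't \<Rightarrow> real^'n" where
  "mu v x \<theta> = (\<chi> i. x i \<theta> * v i \<theta>)"

definition mu_bar ::
  "'t measure \<Rightarrow> ('n \<Rightarrow> 't \<Rightarrow> real) \<Rightarrow> ('t \<Rightarrow> real) \<Rightarrow> ('n \<Rightarrow> 't \<Rightarrow> real) \<Rightarrow> real^'n" where
  "mu_bar M v s x = (\<chi> i. \<integral>\<theta>. v i \<theta> * (s \<theta> * x i \<theta>) \<partial>M)"

definition dual_H ::
  "'t measure \<Rightarrow> real^'n \<Rightarrow> ('n::finite \<Rightarrow> 't \<Rightarrow> real) \<Rightarrow> ('t \<Rightarrow> real) \<Rightarrow> real^'n \<Rightarrow> real" where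
  "dual_H M b v s \<beta> = Es M s (top_bid v \<beta>) - (\<Sum>i\<in>UNIV. b $ i * ln (\<beta> $ i))"


section \<open>Second-order calculus and the pseudo-inverse\<close>

definition C2_on :: "(real^'n) set \<Rightarrow> (real^'n \<Rightarrow> real) \<Rightarrow> bool" where
  "C2_on U f \<longleftrightarrow>
     (\<exists>(g :: real^'n \<Rightarrow> real^'n) (A :: real^'n \<Rightarrow> real^'n^'n).
        (\<forall>y\<in>U. GDERIV f y :> g y) \<and>
        (\<forall>y\<in>U. (g has_derivative (\<lambda>h. A y *v h)) (at y)) \<and>
        continuous_on U A)"

definition gradient :: "(real^'n \<Rightarrow> real) \<Rightarrow> real^'n \<Rightarrow> real^'n" where
  "gradient f y = (THE g. GDERIV f y :> g)"

definition hessian :: "(real^'n \<Rightarrow> real) \<Rightarrow> real^'n \<Rightarrow> real^'n^'n" where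
  "hessian f y = jacobian (gradient f) (at y)"

definition is_pseudo_inverse :: "real^'n^'n \<Rightarrow> real^'n^'n \<Rightarrow> bool" where
  "is_pseudo_inverse A X \<longleftrightarrow>
     A ** X ** A = A \<and> X ** A ** X = X \<and>
     transpose (A ** X) = A ** X \<and> transpose (X ** A) = X ** A"

definition pseudo_inverse :: "real^'n^'n \<Rightarrow> real^'n^'n" where
  "pseudo_inverse A = (THE X. is_pseudo_inverse A X)"


section \<open>Regularity conditions and influence functions\<close>

definition SMO ::
  "'t measure \<Rightarrow> ('n::finite \<Rightarrow> 't \<Rightarrow> real) \<Rightarrow> ('t \<Rightarrow> real) \<Rightarrow> real^'n \<Rightarrow> bool" where
  "SMO M v s \<beta> \<longleftrightarrow> (\<exists>U. open U \<and> \<beta> \<in> U \<and> C2_on U (\<lambda>\<beta>'. Es M s (top_bid v \<beta>')))"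

definition SCS ::
  "'t measure \<Rightarrow> real^'n \<Rightarrow> ('t \<Rightarrow> real) \<Rightarrow> real^'n \<Rightarrow> ('t \<Rightarrow> real) \<Rightarrow> ('n \<Rightarrow> 't \<Rightarrow> real) \<Rightarrow> bool" where
  "SCS M b s \<beta> p x \<longleftrightarrow> (\<forall>i. \<beta> $ i = 1 \<longrightarrow> leftover M b s p x i > 0)"

definition proj :: "real^'n \<Rightarrow> real^'n^'n" where
  "proj \<beta> = (\<chi> i j. if i = j \<and> \<beta> $ i < 1 then 1 else 0)"

definition H_B ::
  "'t measure \<Rightarrow> real^'n \<Rightarrow> ('n::finite \<Rightarrow> 't \<Rightarrow> real) \<Rightarrow> ('t \<Rightarrow> real) \<Rightarrow> real^'n \<Rightarrow> real^'n^'n" where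
  "H_B M b v s \<beta> = proj \<beta> ** hessian (dual_H M b v s) \<beta> ** proj \<beta>"

definition D_beta ::
  "'t measure \<Rightarrow> real^'n \<Rightarrow> ('n::finite \<Rightarrow> 't \<Rightarrow> real) \<Rightarrow> ('t \<Rightarrow> real) \<Rightarrow>
   real^'n \<Rightarrow> ('n \<Rightarrow> 't \<Rightarrow> real) \<Rightarrow> 't \<Rightarrow> real^'n" where
  "D_beta M b v s \<beta> x \<theta> =
     - (pseudo_inverse (H_B M b v s \<beta>) *v (mu v x \<theta> - mu_bar M v s x))"

definition D_REV ::
  "'t measure \<Rightarrow> real^'n \<Rightarrow> ('n::finite \<Rightarrow> 't \<Rightarrow> real) \<Rightarrow> ('t \<Rightarrow> real) \<Rightarrow>
   real^'n \<Rightarrow> ('t \<Rightarrow> real) \<Rightarrow> ('n \<Rightarrow> 't \<Rightarrow> real) \<Rightarrow> 't \<Rightarrow> real" where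
  "D_REV M b v s \<beta> p x \<theta> =
     p \<theta> - REV M s p + mu_bar M v s x \<bullet> D_beta M b v s \<beta> x \<theta>"

definition Sigma_beta ::
  "'t measure \<Rightarrow> real^'n \<Rightarrow> ('n::finite \<Rightarrow> 't \<Rightarrow> real) \<Rightarrow> ('t \<Rightarrow> real) \<Rightarrow>
   real^'n \<Rightarrow> ('n \<Rightarrow> 't \<Rightarrow> real) \<Rightarrow> real^'n^'n" where
  "Sigma_beta M b v s \<beta> x =
     (\<chi> i j. Es M s (\<lambda>\<theta>. D_beta M b v s \<beta> x \<theta> $ i * D_beta M b v s \<beta> x \<theta> $ j))"

definition sigma2_REV ::
  "'t measure \<Rightarrow> real^'n \<Rightarrow> ('n::finite \<Rightarrow> 't \<Rightarrow> real) \<Rightarrow> ('t \<Rightarrow> real) \<Rightarrow>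
   real^'n \<Rightarrow> ('t \<Rightarrow> real) \<Rightarrow> ('n \<Rightarrow> 't \<Rightarrow> real) \<Rightarrow> real" where
  "sigma2_REV M b v s \<beta> p x = Es M s (\<lambda>\<theta>. (D_REV M b v s \<beta> p x \<theta>)\<^sup>2)"


section \<open>Modes of convergence and normal laws\<close>

text \<open>
  Sequences are indexed by sample sizes \<open>t \<ge> 1\<close>; the term at \<open>0\<close> is irrelevant.  Measurability
  is part of both notions of convergence, because \<open>measure\<close> and the integral are \<open>0\<close> by
  convention outside their domains.
\<close>

definition tendsto_in_prob ::
  "'w measure \<Rightarrow> (nat \<Rightarrow> 'w \<Rightarrow> 'a::metric_space) \<Rightarrow> 'a \<Rightarrow> bool" where
  "tendsto_in_prob P X c \<longleftrightarrow>
     (\<forall>t\<ge>1. X t \<in> borel_measurable P) \<and>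
     (\<forall>\<epsilon>>0. (\<lambda>t. measure P {\<omega> \<in> space P. dist (X t \<omega>) c > \<epsilon>}) \<longlonglongrightarrow> 0)"

definition tendsto_in_law ::
  "'w measure \<Rightarrow> (nat \<Rightarrow> 'w \<Rightarrow> 'a::metric_space) \<Rightarrow> 'a measure \<Rightarrow> bool" where
  "tendsto_in_law P X N \<longleftrightarrow>
     (\<forall>t\<ge>1. X t \<in> borel_measurable P) \<and>
     (\<forall>f :: 'a \<Rightarrow> real. continuous_on UNIV f \<and> bounded (range f) \<longrightarrow>
        (\<lambda>t. \<integral>\<omega>. f (X t \<omega>) \<partial>P) \<longlonglongrightarrow> (\<integral>y. f y \<partial>N))"

text \<open>Normal laws are parametrised by the variance; variance \<open>0\<close> gives a point mass.\<close>

definition normal_law :: "real \<Rightarrow> real \<Rightarrow> real measure" where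
  "normal_law m V =
     (if V = 0 then return borel m else density lborel (normal_density m (sqrt V)))"

text \<open>
  \<open>N\<close> is the (possibly degenerate) multivariate normal law with mean \<open>m\<close> and covariance \<open>S\<close>:
  every linear functional has the corresponding univariate normal law.
\<close>

definition is_normal_law :: "(real^'n) measure \<Rightarrow> real^'n \<Rightarrow> real^'n^'n \<Rightarrow> bool" where
  "is_normal_law N m S \<longleftrightarrow>
     prob_space N \<and> sets N = sets borel \<and> transpose S = S \<and>
     (\<forall>a. distr N borel (\<lambda>y. a \<bullet> y) = normal_law (a \<bullet> m) (a \<bullet> (S *v a)))"

end

theory Submission
  imports Defs "HOL-Real_Asymp.Real_Asymp"
begin

text \<open>
  The observed multipliers minimise a random convex function over the unit box, but the proof works
  with first-order conditions only.  At an item, an equilibrium allocation defines a subgradient of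
  the top bid with respect to the multipliers (\<open>supports_subgradient\<close>), and the budget conditions
  say that the mean subgradient \<open>m\<close> satisfies \<open>m i = b i / \<beta> i\<close>, with \<open>m i \<le> b i\<close> allowed when
  \<open>\<beta> i = 1\<close> (\<open>kkt\<close>).  Subgradients of a convex function are monotone in \<open>\<beta>\<close>, whereas \<open>b / \<beta>\<close>
  is strongly decreasing.  Comparing the observed equilibrium with any other point therefore bounds
  the distance between the two by the residual of the first-order conditions at that point
  (\<open>kkt_distance\<close>).

  Comparison with \<open>\<beta>\<close> itself, using the limit allocation on the sampled items, gives a residual
  which is the fluctuation of the sample mean of \<open>mu\<close>.  Hence \<open>sqrt t (\<beta>g - \<beta>)\<close> is bounded in
  probability and both consistency claims follow (\<open>root_t_distance\<close>).

  For the expansion, the comparison point is \<open>\<beta> + u / sqrt t\<close> with \<open>u\<close> fixed and supported on the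
  coordinates with \<open>\<beta> i < 1\<close>.  Its residual, scaled by \<open>sqrt t\<close>, consists of a deterministic part
  tending to \<open>- H u\<close> by (SMO), and a fluctuation.  The latter equals that of \<open>mu\<close> up to
  \<open>o(1)\<close>, since differentiability of the expected top bid makes its subgradients continuous in
  mean square at \<open>\<beta>\<close> (\<open>xi_L2_convergence\<close>).  Strict slackness removes the coordinates with
  \<open>\<beta> i = 1\<close>.  So the distance from \<open>u\<close> to \<open>sqrt t (\<beta>g - \<beta>)\<close> is at most a constant times the
  distance from \<open>u\<close> to the normalised sum of the influence functions, plus \<open>o(1)\<close>
  (\<open>localised_distance\<close>).  Letting \<open>u\<close> run through a fine finite net makes the two random vectors
  agree (\<open>\<beta>g_expansion\<close>).  Revenue is squeezed between the subgradient bounds at \<open>\<beta>\<close> and at the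
  observed multipliers (\<open>REV_increment\<close>).

  Normality is obtained from the univariate central limit theorem through characteristic functions:
  every linear functional converges, the limit law is a linear image of independent standard
  normals (\<open>normal_law_exists\<close>), and a Weierstrass approximation by trigonometric polynomials
  passes to bounded continuous functions of the whole vector (\<open>tendsto_in_law_of_char\<close>).
\<close>


section \<open>Convergence in probability\<close>

text \<open>
  Allowing a measurable superset of the points where \<open>A t\<close> fails makes the notion stable under
  conjunction and consequence for arbitrary predicates, which is how the probabilistic arguments
  below are carried out.
\<close>

definition all_but :: "'w measure \<Rightarrow> real \<Rightarrow> (nat \<Rightarrow> 'w \<Rightarrow> bool) \<Rightarrow> bool" where
  "all_but P \<epsilon> A \<longleftrightarrow>
     (\<forall>\<^sub>F t in sequentially. \<exists>S\<in>sets P. measure P S < \<epsilon> \<and> (\<forall>\<omega>\<in>space P - S. A t \<omega>))"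

definition whp :: "'w measure \<Rightarrow> (nat \<Rightarrow> 'w \<Rightarrow> bool) \<Rightarrow> bool" where
  "whp P A \<longleftrightarrow> (\<forall>\<epsilon>>0. all_but P \<epsilon> A)"

lemma whpD: "whp P A \<Longrightarrow> 0 < \<epsilon> \<Longrightarrow> all_but P \<epsilon> A"
  by (simp add: whp_def)

lemma all_but_mono:
  assumes "all_but P \<epsilon> A"
    and "\<forall>\<^sub>F t in sequentially. \<forall>\<omega>\<in>space P. A t \<omega> \<longrightarrow> B t \<omega>"
  shows "all_but P \<epsilon> B"
  using assms unfolding all_but_def
  by (rule eventually_elim2) blast

lemma whp_mono:
  assumes "whp P A" and "\<forall>\<^sub>F t in sequentially. \<forall>\<omega>\<in>space P. A t \<omega> \<longrightarrow> B t \<omega>"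
  shows "whp P B"
  using assms all_but_mono unfolding whp_def by blast

context prob_space begin

lemma all_but_conj:
  assumes "all_but M \<epsilon> A" "all_but M \<delta> B"
  shows "all_but M (\<epsilon> + \<delta>) (\<lambda>t \<omega>. A t \<omega> \<and> B t \<omega>)"
  using assms unfolding all_but_def
proof (rule eventually_elim2)
  fix t
  assume "\<exists>S\<in>events. prob S < \<epsilon> \<and> (\<forall>\<omega>\<in>space M - S. A t \<omega>)"
    and "\<exists>S\<in>events. prob S < \<delta> \<and> (\<forall>\<omega>\<in>space M - S. B t \<omega>)"
  then obtain S T where S: "S \<in> events" "prob S < \<epsilon>" "\<forall>\<omega>\<in>space M - S. A t \<omega>"
    and T: "T \<in> events" "prob T < \<delta>" "\<forall>\<omega>\<in>space M - T. B t \<omega>" by blast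
  have "prob (S \<union> T) < \<epsilon> + \<delta>"
    using measure_Un_le[OF S(1) T(1)] S(2) T(2) by linarith
  then show "\<exists>S\<in>events. prob S < \<epsilon> + \<delta> \<and> (\<forall>\<omega>\<in>space M - S. A t \<omega> \<and> B t \<omega>)"
    using S T by (intro bexI[of _ "S \<union> T"]) auto
qed

lemma whp_conj:
  assumes "whp M A" "whp M B"
  shows "whp M (\<lambda>t \<omega>. A t \<omega> \<and> B t \<omega>)"
  unfolding whp_def
proof (intro allI impI)
  fix \<epsilon> :: real assume "0 < \<epsilon>"
  then have "all_but M (\<epsilon>/2 + \<epsilon>/2) (\<lambda>t \<omega>. A t \<omega> \<and> B t \<omega>)"
    by (intro all_but_conj whpD[OF assms(1)] whpD[OF assms(2)]) auto
  then show "all_but M \<epsilon> (\<lambda>t \<omega>. A t \<omega> \<and> B t \<omega>)" by simp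
qed

lemma whp_AE:
  assumes "AE \<omega> in M. A \<omega>"
  shows "whp M (\<lambda>t. A)"
proof -
  obtain N where N: "{\<omega>\<in>space M. \<not> A \<omega>} \<subseteq> N" "emeasure M N = 0" "N \<in> events"
    by (rule AE_E[OF assms])
  then show ?thesis unfolding whp_def all_but_def
    by (intro allI impI always_eventually bexI[of _ N]) (auto simp: measure_def)
qed

lemma whp_always:
  assumes "\<And>t \<omega>. \<omega> \<in> space M \<Longrightarrow> A t \<omega>"
  shows "whp M A"
  using assms unfolding whp_def all_but_def
  by (intro allI impI always_eventually bexI[of _ "{}"]) auto

lemma whp_Ball:
  assumes "finite I" "\<And>i. i \<in> I \<Longrightarrow> whp M (A i)"
  shows "whp M (\<lambda>t \<omega>. \<forall>i\<in>I. A i t \<omega>)"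
  using assms
proof (induction I rule: finite_induct)
  case empty
  then show ?case by (simp add: whp_always)
next
  case (insert i I)
  then show ?case
    using whp_conj[of "A i" "\<lambda>t \<omega>. \<forall>i\<in>I. A i t \<omega>"] by simp
qed

lemma whp_All: "(\<And>i::'i::finite. whp M (A i)) \<Longrightarrow> whp M (\<lambda>t \<omega>. \<forall>i. A i t \<omega>)"
  using whp_Ball[of UNIV A] by simp

lemma tendsto_in_prob_iff_whp:
  "tendsto_in_prob M X c \<longleftrightarrow>
     (\<forall>t\<ge>1. X t \<in> borel_measurable M) \<and> (\<forall>\<epsilon>>0. whp M (\<lambda>t \<omega>. dist (X t \<omega>) c \<le> \<epsilon>))"
    (is "?L \<longleftrightarrow> ?m \<and> ?R")
proof (cases ?m)
  case True
  then have meas: "X t \<in> borel_measurable M" if "t \<ge> 1" for t using that by blast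
  have ev: "{\<omega> \<in> space M. dist (X t \<omega>) c > \<epsilon>} \<in> events" if "t \<ge> 1" for t \<epsilon>
  proof -
    note [measurable] = meas[OF that]
    have "X t -` (- cball c \<epsilon>) \<inter> space M \<in> events" by measurable
    then show ?thesis by (simp add: vimage_def Int_def conj_commute dist_commute not_le)
  qed
  show ?thesis
  proof
    assume L: ?L
    have "whp M (\<lambda>t \<omega>. dist (X t \<omega>) c \<le> \<epsilon>)" if "0 < \<epsilon>" for \<epsilon>
      unfolding whp_def all_but_def
    proof (intro allI impI)
      fix d :: real assume "0 < d"
      have "(\<lambda>t. prob {\<omega> \<in> space M. dist (X t \<omega>) c > \<epsilon>}) \<longlonglongrightarrow> 0"
        using L that by (simp add: tendsto_in_prob_def)
      from order_tendstoD(2)[OF this \<open>0 < d\<close>] eventually_ge_at_top[of 1]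
      show "\<forall>\<^sub>F t in sequentially.
           \<exists>S\<in>events. prob S < d \<and> (\<forall>\<omega>\<in>space M - S. dist (X t \<omega>) c \<le> \<epsilon>)"
      proof (rule eventually_elim2)
        fix t :: nat assume "prob {\<omega> \<in> space M. dist (X t \<omega>) c > \<epsilon>} < d" "1 \<le> t"
        then show "\<exists>S\<in>events. prob S < d \<and> (\<forall>\<omega>\<in>space M - S. dist (X t \<omega>) c \<le> \<epsilon>)"
          using ev by (intro bexI[of _ "{\<omega> \<in> space M. dist (X t \<omega>) c > \<epsilon>}"]) auto
      qed
    qed
    then show "?m \<and> ?R" using True by blast
  next
    assume R: "?m \<and> ?R"
    have "(\<lambda>t. prob {\<omega> \<in> space M. dist (X t \<omega>) c > \<epsilon>}) \<longlonglongrightarrow> 0" if "0 < \<epsilon>" for \<epsilon>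
    proof (rule order_tendstoI)
      fix a :: real assume "a < 0"
      then show "\<forall>\<^sub>F t in sequentially. a < prob {\<omega> \<in> space M. dist (X t \<omega>) c > \<epsilon>}"
        by (intro always_eventually allI order_less_le_trans[OF _ measure_nonneg])
    next
      fix d :: real assume "0 < d"
      then have "all_but M d (\<lambda>t \<omega>. dist (X t \<omega>) c \<le> \<epsilon>)" using R that by (simp add: whp_def)
      then show "\<forall>\<^sub>F t in sequentially. prob {\<omega> \<in> space M. dist (X t \<omega>) c > \<epsilon>} < d"
        unfolding all_but_def
      proof (rule eventually_mono)
        fix t assume "\<exists>S\<in>events. prob S < d \<and> (\<forall>\<omega>\<in>space M - S. dist (X t \<omega>) c \<le> \<epsilon>)"
        then obtain S where S: "S \<in> events" "prob S < d" "\<forall>\<omega>\<in>space M - S. dist (X t \<omega>) c \<le> \<epsilon>"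
          by blast
        then have "{\<omega> \<in> space M. dist (X t \<omega>) c > \<epsilon>} \<subseteq> S" by force
        then show "prob {\<omega> \<in> space M. dist (X t \<omega>) c > \<epsilon>} < d"
          by (intro order_le_less_trans[OF finite_measure_mono[OF _ S(1)] S(2)])
      qed
    qed
    then show ?L using R by (simp add: tendsto_in_prob_def)
  qed
qed (auto simp: tendsto_in_prob_def)

lemma whp_dominated:
  fixes Y :: "nat \<Rightarrow> 'a \<Rightarrow> real"
  assumes "\<And>\<epsilon>. 0 < \<epsilon> \<Longrightarrow> whp M (\<lambda>t \<omega>. \<bar>Y t \<omega>\<bar> \<le> \<epsilon>)" "0 < \<epsilon>"
    and "whp M (\<lambda>t \<omega>. D t \<omega> \<le> c * \<bar>Y t \<omega>\<bar>)"
  shows "whp M (\<lambda>t \<omega>. D t \<omega> \<le> \<epsilon>)"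
proof -
  have "whp M (\<lambda>t \<omega>. D t \<omega> \<le> c * \<bar>Y t \<omega>\<bar> \<and> \<bar>Y t \<omega>\<bar> \<le> \<epsilon> / (\<bar>c\<bar> + 1))"
    using assms by (intro whp_conj) auto
  then show ?thesis
  proof (rule whp_mono, intro always_eventually allI ballI impI)
    fix t \<omega> assume *: "D t \<omega> \<le> c * \<bar>Y t \<omega>\<bar> \<and> \<bar>Y t \<omega>\<bar> \<le> \<epsilon> / (\<bar>c\<bar> + 1)"
    have "c * \<bar>Y t \<omega>\<bar> \<le> (\<bar>c\<bar> + 1) * \<bar>Y t \<omega>\<bar>" by (intro mult_right_mono) auto
    also have "\<dots> \<le> (\<bar>c\<bar> + 1) * (\<epsilon> / (\<bar>c\<bar> + 1))" using * by (intro mult_left_mono) auto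
    also have "\<dots> = \<epsilon>" by (simp add: divide_simps)
    finally show "D t \<omega> \<le> \<epsilon>" using * by linarith
  qed
qed

text \<open>
  Chebyshev's inequality for a whole sequence; every probabilistic estimate below is an instance
  of it, applied to centred sums whose second moments are bounded or tend to zero.
\<close>

lemma whp_chebyshev:
  fixes Y :: "nat \<Rightarrow> 'a \<Rightarrow> real"
  assumes "\<And>t. t \<ge> 1 \<Longrightarrow> Y t \<in> borel_measurable M"
    and "\<And>t. t \<ge> 1 \<Longrightarrow> integrable M (\<lambda>\<omega>. (Y t \<omega>)\<^sup>2)"
    and "\<And>t. t \<ge> 1 \<Longrightarrow> expectation (\<lambda>\<omega>. (Y t \<omega>)\<^sup>2) \<le> e t"
    and "\<forall>\<^sub>F t in sequentially. e t < \<delta> * \<epsilon>\<^sup>2" and "0 < \<epsilon>"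
  shows "all_but M \<delta> (\<lambda>t \<omega>. \<bar>Y t \<omega>\<bar> \<le> \<epsilon>)"
  unfolding all_but_def using assms(4) eventually_ge_at_top[of 1]
proof (rule eventually_elim2)
  fix t :: nat assume t: "e t < \<delta> * \<epsilon>\<^sup>2" "1 \<le> t"
  note [measurable] = assms(1)[OF t(2)]
  let ?S = "{\<omega> \<in> space M. \<epsilon>\<^sup>2 \<le> (Y t \<omega>)\<^sup>2}"
  have "prob ?S \<le> expectation (\<lambda>\<omega>. (Y t \<omega>)\<^sup>2) / \<epsilon>\<^sup>2"
    using assms(2)[OF t(2)] assms(5) by (intro integral_Markov_inequality_measure[where A="{}"]) auto
  also have "\<dots> \<le> e t / \<epsilon>\<^sup>2" using assms(3)[OF t(2)] by (intro divide_right_mono) auto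
  also have "\<dots> < \<delta>" using t(1) assms(5) by (simp add: divide_less_eq)
  finally have 1: "prob ?S < \<delta>" .
  show "\<exists>S\<in>events. prob S < \<delta> \<and> (\<forall>\<omega>\<in>space M - S. \<bar>Y t \<omega>\<bar> \<le> \<epsilon>)"
  proof (intro bexI[of _ ?S] conjI ballI 1)
    fix \<omega> assume "\<omega> \<in> space M - ?S"
    then have "(Y t \<omega>)\<^sup>2 < \<epsilon>\<^sup>2" by auto
    then show "\<bar>Y t \<omega>\<bar> \<le> \<epsilon>" using assms(5)
      by (metis abs_of_pos less_eq_real_def power2_abs power2_less_imp_less)
  qed measurable
qed

end

section \<open>Fluctuations of empirical means\<close>

locale iid_sample = P: prob_space P + Q: prob_space Q
  for P :: "'w measure" and Q :: "'t measure" and \<theta> :: "nat \<Rightarrow> 'w \<Rightarrow> 't" +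
  assumes indep: "P.indep_vars (\<lambda>_. Q) \<theta> UNIV"
    and law: "distr P Q (\<theta> \<tau>) = Q"
begin

definition emp :: "nat \<Rightarrow> ('t \<Rightarrow> real) \<Rightarrow> 'w \<Rightarrow> real" where
  "emp t g \<omega> = (1 / real t) * (\<Sum>\<tau><t. g (\<theta> \<tau> \<omega>))"

definition fluct :: "nat \<Rightarrow> ('t \<Rightarrow> real) \<Rightarrow> 'w \<Rightarrow> real" where
  "fluct t g \<omega> = (1 / sqrt (real t)) * (\<Sum>\<tau><t. g (\<theta> \<tau> \<omega>) - Q.expectation g)"

lemma sample_measurable [measurable]: "\<theta> \<tau> \<in> measurable P Q"
  using indep by (auto simp: P.indep_vars_def2)

lemma sample_AE: "AE y in Q. A y \<Longrightarrow> AE \<omega> in P. \<forall>\<tau>. A (\<theta> \<tau> \<omega>)"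
  unfolding AE_all_countable
proof
  fix \<tau> assume "AE y in Q. A y"
  with law[of \<tau>] have "AE y in distr P Q (\<theta> \<tau>). A y" by metis
  then show "AE \<omega> in P. A (\<theta> \<tau> \<omega>)" by (rule AE_distrD[OF sample_measurable])
qed

lemma sample_expectation:
  fixes g :: "'t \<Rightarrow> real"
  assumes "g \<in> borel_measurable Q"
  shows "P.expectation (\<lambda>\<omega>. g (\<theta> \<tau> \<omega>)) = Q.expectation g"
  using integral_distr[OF sample_measurable assms, of \<tau>] by (simp add: law)

lemma sample_integrable:
  fixes g :: "'t \<Rightarrow> real"
  assumes "integrable Q g"
  shows "integrable P (\<lambda>\<omega>. g (\<theta> \<tau> \<omega>))"
  using integrable_distr[OF sample_measurable, of \<tau> g] assms by (simp add: law)

lemma fluct_measurable [measurable (raw)]: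
  assumes [measurable]: "g \<in> borel_measurable Q"
  shows "fluct t g \<in> borel_measurable P"
  unfolding fluct_def[abs_def] by measurable

lemma emp_measurable [measurable (raw)]:
  assumes [measurable]: "g \<in> borel_measurable Q"
  shows "emp t g \<in> borel_measurable P"
  unfolding emp_def[abs_def] by measurable

lemma fluct_eq_emp: "t \<ge> 1 \<Longrightarrow> fluct t g \<omega> = sqrt (real t) * (emp t g \<omega> - Q.expectation g)"
proof -
  assume t: "t \<ge> 1"
  define r where "r = sqrt (real t)"
  have r: "r > 0" "real t = r * r" using t by (auto simp: r_def)
  show ?thesis
    unfolding fluct_def emp_def sum_subtractf using r
    by (simp add: r_def[symmetric] r(2) field_simps)
qed

text \<open>
  Independent centred summands are uncorrelated, so the second moment of their normalised sum is
  the variance of one summand, whatever the sample size.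
\<close>

lemma square_integrable_fluct:
  assumes [measurable]: "g \<in> borel_measurable Q" and sq: "integrable Q (\<lambda>y. (g y)\<^sup>2)"
  shows "integrable P (\<lambda>\<omega>. (fluct t g \<omega>)\<^sup>2)"
    and "P.expectation (\<lambda>\<omega>. (fluct t g \<omega>)\<^sup>2) \<le> Q.expectation (\<lambda>y. (g y)\<^sup>2)"
proof -
  have g: "integrable Q g" using Q.square_integrable_imp_integrable[OF assms(1) sq] .
  define Y where "Y \<tau> \<omega> = g (\<theta> \<tau> \<omega>) - Q.expectation g" for \<tau> \<omega>
  have gc: "integrable Q (\<lambda>y. (g y - Q.expectation g)\<^sup>2)"
    using g sq by (simp add: power2_diff)
  have iY: "integrable P (Y \<tau>)" for \<tau>
    unfolding Y_def using sample_integrable[OF g] by simp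
  have E0: "P.expectation (Y \<tau>) = 0" for \<tau>
    unfolding Y_def using sample_integrable[OF g] sample_expectation[OF assms(1)]
    by (simp add: P.prob_space)
  have i2: "integrable P (\<lambda>\<omega>. (Y \<tau> \<omega>)\<^sup>2)" for \<tau>
    unfolding Y_def by (rule sample_integrable[OF gc])
  have E2: "P.expectation (\<lambda>\<omega>. (Y \<tau> \<omega>)\<^sup>2) \<le> Q.expectation (\<lambda>y. (g y)\<^sup>2)" for \<tau>
  proof -
    have "P.expectation (\<lambda>\<omega>. (Y \<tau> \<omega>)\<^sup>2) = Q.variance g"
      unfolding Y_def by (rule sample_expectation) measurable
    then show ?thesis by (simp add: Q.variance_eq[OF g sq])
  qed
  have ind: "P.indep_vars (\<lambda>_. borel) Y UNIV"
    unfolding Y_def[abs_def] by (rule P.indep_vars_compose2[OF indep]) measurable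
  have pair: "integrable P (\<lambda>\<omega>. Y i \<omega> * Y j \<omega>) \<and>
      (i \<noteq> j \<longrightarrow> P.expectation (\<lambda>\<omega>. Y i \<omega> * Y j \<omega>) = 0)" for i j
  proof (cases "i = j")
    case True
    then show ?thesis using i2[of i] by (simp add: power2_eq_square)
  next
    case False
    have "P.indep_vars (\<lambda>_. borel) Y {i, j}"
      by (rule P.indep_vars_subset[OF ind]) simp
    then have "P.indep_var borel (Y i) borel (Y j)"
      using P.indep_vars_sum[of "{j}" i Y] False by simp
    from P.indep_var_lebesgue_integral[OF this iY iY] P.indep_var_integrable[OF this iY iY]
    show ?thesis by (simp add: E0)
  qed
  have eq: "(fluct t g \<omega>)\<^sup>2 = (1 / real t) * (\<Sum>i<t. \<Sum>j<t. Y i \<omega> * Y j \<omega>)" for \<omega>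
    unfolding fluct_def Y_def[symmetric]
    by (simp add: power_mult_distrib power_divide)
       (simp add: power2_eq_square sum_product)
  show "integrable P (\<lambda>\<omega>. (fluct t g \<omega>)\<^sup>2)"
    unfolding eq using pair by auto
  have "P.expectation (\<lambda>\<omega>. (fluct t g \<omega>)\<^sup>2)
      = (1 / real t) * (\<Sum>i<t. \<Sum>j<t. P.expectation (\<lambda>\<omega>. Y i \<omega> * Y j \<omega>))"
    unfolding eq using pair by simp
  also have "(\<Sum>i<t. \<Sum>j<t. P.expectation (\<lambda>\<omega>. Y i \<omega> * Y j \<omega>))
      = (\<Sum>i<t. \<Sum>j<t. if j = i then P.expectation (\<lambda>\<omega>. (Y i \<omega>)\<^sup>2) else 0)"
    using pair by (intro sum.cong refl) (auto simp: power2_eq_square)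
  also have "\<dots> = (\<Sum>i<t. P.expectation (\<lambda>\<omega>. (Y i \<omega>)\<^sup>2))"
    by (intro sum.cong refl) (simp add: sum.delta')
  also have "(1 / real t) * \<dots> \<le> (1 / real t) * (\<Sum>i<t. Q.expectation (\<lambda>y. (g y)\<^sup>2))"
    by (intro mult_left_mono sum_mono E2) auto
  also have "\<dots> \<le> Q.expectation (\<lambda>y. (g y)\<^sup>2)"
    by simp
  finally show "P.expectation (\<lambda>\<omega>. (fluct t g \<omega>)\<^sup>2) \<le> Q.expectation (\<lambda>y. (g y)\<^sup>2)" .
qed

text \<open>
  The integrand may change with the sample size: a sequence that vanishes in \<open>L\<^sup>2\<close> contributes
  nothing at the scale \<open>sqrt t\<close>.
\<close>

lemma fluct_vanishing:
  assumes "\<And>t. h t \<in> borel_measurable Q" "\<And>t. integrable Q (\<lambda>y. (h t y)\<^sup>2)"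
    and "(\<lambda>t. Q.expectation (\<lambda>y. (h t y)\<^sup>2)) \<longlonglongrightarrow> 0" "0 < \<epsilon>"
  shows "whp P (\<lambda>t \<omega>. \<bar>fluct t (h t) \<omega>\<bar> \<le> \<epsilon>)"
  unfolding whp_def
proof (intro allI impI P.whp_chebyshev[where e="\<lambda>t. Q.expectation (\<lambda>y. (h t y)\<^sup>2)"])
  fix \<delta> :: real assume "0 < \<delta>"
  then show "\<forall>\<^sub>F t in sequentially. Q.expectation (\<lambda>y. (h t y)\<^sup>2) < \<delta> * \<epsilon>\<^sup>2"
    using assms(3,4) by (intro order_tendstoD(2)) auto
qed (use assms square_integrable_fluct fluct_measurable in auto)

lemma fluct_tight:
  assumes "g \<in> borel_measurable Q" "integrable Q (\<lambda>y. (g y)\<^sup>2)" "0 < \<delta>"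
  shows "\<exists>K>0. all_but P \<delta> (\<lambda>t \<omega>. \<bar>fluct t g \<omega>\<bar> \<le> K)"
proof -
  define V where "V = Q.expectation (\<lambda>y. (g y)\<^sup>2)"
  have V: "0 \<le> V" by (simp add: V_def)
  define K where "K = sqrt ((V + 1) / \<delta>)"
  have K: "0 < K" "\<delta> * K\<^sup>2 = V + 1" using V assms(3) by (auto simp: K_def)
  have "all_but P \<delta> (\<lambda>t \<omega>. \<bar>fluct t g \<omega>\<bar> \<le> K)"
    using assms K
    by (intro P.whp_chebyshev[where e="\<lambda>_. V"])
       (auto simp: V_def intro: square_integrable_fluct)
  with K show ?thesis by blast
qed

lemma emp_whp:
  assumes "g \<in> borel_measurable Q" "integrable Q (\<lambda>y. (g y)\<^sup>2)" "0 < \<epsilon>"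
  shows "whp P (\<lambda>t \<omega>. \<bar>emp t g \<omega> - Q.expectation g\<bar> \<le> \<epsilon>)"
  unfolding whp_def
proof (intro allI impI)
  fix \<delta> :: real assume "0 < \<delta>"
  from fluct_tight[OF assms(1,2) this] obtain K where
    K: "0 < K" "all_but P \<delta> (\<lambda>t \<omega>. \<bar>fluct t g \<omega>\<bar> \<le> K)" by blast
  have "(\<lambda>t. K / sqrt (real t)) \<longlonglongrightarrow> 0" by real_asymp
  from order_tendstoD(2)[OF this assms(3)] eventually_ge_at_top[of 1]
  have "\<forall>\<^sub>F t in sequentially. K / sqrt (real t) \<le> \<epsilon> \<and> 1 \<le> t"
    by (rule eventually_elim2) auto
  then show "all_but P \<delta> (\<lambda>t \<omega>. \<bar>emp t g \<omega> - Q.expectation g\<bar> \<le> \<epsilon>)"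
  proof (intro all_but_mono[OF K(2)], elim eventually_mono, intro ballI impI)
    fix t \<omega> assume t: "K / sqrt (real t) \<le> \<epsilon> \<and> 1 \<le> t" and "\<bar>fluct t g \<omega>\<bar> \<le> K"
    then have "sqrt (real t) * \<bar>emp t g \<omega> - Q.expectation g\<bar> \<le> K"
      by (simp add: fluct_eq_emp abs_mult)
    then have "\<bar>emp t g \<omega> - Q.expectation g\<bar> \<le> K / sqrt (real t)"
      using t by (simp add: pos_le_divide_eq mult.commute)
    with t show "\<bar>emp t g \<omega> - Q.expectation g\<bar> \<le> \<epsilon>" by linarith
  qed
qed

end

section \<open>Pseudo-inverses and sums of squares\<close>

lemma pseudo_inverse_unique:
  assumes "is_pseudo_inverse A X" "is_pseudo_inverse A Y"
  shows "X = Y"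
proof -
  note X = assms(1)[unfolded is_pseudo_inverse_def] and Y = assms(2)[unfolded is_pseudo_inverse_def]
  have AXAY: "A ** X = A ** Y"
  proof -
    have "A ** X = transpose (A ** X)" using X by simp
    also have "\<dots> = transpose ((A ** Y) ** (A ** X))" using Y by (simp add: matrix_mul_assoc)
    also have "\<dots> = transpose (A ** X) ** transpose (A ** Y)" by (simp add: matrix_transpose_mul)
    also have "\<dots> = (A ** X) ** (A ** Y)" using X Y by simp
    also have "\<dots> = A ** Y" using X by (simp add: matrix_mul_assoc)
    finally show ?thesis .
  qed
  have XAYA: "X ** A = Y ** A"
  proof -
    have "X ** A = transpose (X ** A)" using X by simp
    also have "\<dots> = transpose ((X ** A) ** (Y ** A))"
      using Y by (metis matrix_mul_assoc)
    also have "\<dots> = transpose (Y ** A) ** transpose (X ** A)" by (simp add: matrix_transpose_mul)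
    also have "\<dots> = (Y ** A) ** (X ** A)" using X Y by simp
    also have "\<dots> = Y ** A" using X by (metis matrix_mul_assoc)
    finally show ?thesis .
  qed
  have "X = X ** A ** X" using X by simp
  also have "\<dots> = X ** (A ** Y)" using AXAY by (metis matrix_mul_assoc)
  also have "\<dots> = Y ** A ** Y" using XAYA by (simp add: matrix_mul_assoc)
  finally show ?thesis using Y by simp
qed

lemma pseudo_inverse_eqI: "is_pseudo_inverse A X \<Longrightarrow> pseudo_inverse A = X"
  unfolding pseudo_inverse_def using pseudo_inverse_unique by blast

lemma matrix_diff_ldistrib: "A ** (B - C) = A ** B - A ** (C :: real^'n^'m)"
  by (simp add: vec_eq_iff matrix_matrix_mult_def sum_subtractf right_diff_distrib)

lemma matrix_diff_rdistrib: "(A - B) ** C = A ** C - B ** (C :: real^'n^'m)"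
  by (simp add: vec_eq_iff matrix_matrix_mult_def sum_subtractf left_diff_distrib)

lemma matrix_add_rdistrib: "(A + B) ** C = A ** C + B ** (C :: real^'n^'m)"
  by (simp add: vec_eq_iff matrix_matrix_mult_def sum.distrib distrib_right)

lemma transpose_add: "transpose (A + B :: real^'n^'m) = transpose A + transpose B"
  by (simp add: vec_eq_iff transpose_def)

lemma proj_vec: "proj \<beta> *v y = (\<chi> i. if \<beta> $ i < 1 then y $ i else 0)"
proof -
  have "(\<Sum>j\<in>UNIV. (if i = j \<and> \<beta> $ i < 1 then 1 else 0) * y $ j) =
     (\<Sum>j\<in>UNIV. if i = j then (if \<beta> $ i < 1 then y $ i else 0) else 0)" for i
    by (rule sum.cong) auto
  then show ?thesis by (simp add: vec_eq_iff matrix_vector_mult_def proj_def sum.delta)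
qed

lemma proj_idem: "proj \<beta> ** proj \<beta> = proj \<beta>"
  by (simp add: matrix_eq proj_vec matrix_vector_mul_assoc[symmetric] vec_eq_iff)

lemma proj_transpose: "transpose (proj \<beta>) = proj \<beta>"
  by (auto simp: proj_def transpose_def vec_eq_iff)

text \<open>
  For an orthogonal projection \<open>R\<close> and positive definite \<open>H\<close>, the matrix
  \<open>K = R H R + (1 - R)\<close> is invertible and commutes with \<open>R\<close>; the pseudo-inverse of the
  compression \<open>R H R\<close> is \<open>R K\<^sup>-\<^sup>1\<close>.  So the pseudo-inverse really inverts \<open>H\<close> on the range of
  \<open>R\<close>, which is what the equations below say.
\<close>

lemma pseudo_inverse_compression:
  fixes H R :: "real^'n^'n"
  assumes pos: "\<And>h. h \<noteq> 0 \<Longrightarrow> 0 < h \<bullet> (H *v h)"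
    and R: "R ** R = R" "transpose R = R"
  defines "X \<equiv> pseudo_inverse (R ** H ** R)"
  shows "is_pseudo_inverse (R ** H ** R) X" "R ** H ** X = R" "R ** X = X"
    and "transpose H = H \<Longrightarrow> transpose X = X"
proof -
  define A where "A = R ** H ** R"
  define K where "K = A + (mat 1 - R)"
  have RA: "R ** A = A" "A ** R = A"
    unfolding A_def by (simp only: matrix_mul_assoc R) (simp only: matrix_mul_assoc[symmetric] R)
  have Rc: "R ** (mat 1 - R) = 0" "(mat 1 - R) ** R = 0"
    by (simp_all add: R matrix_diff_ldistrib matrix_diff_rdistrib)
  have RK: "R ** K = A" "K ** R = A"
    by (simp_all add: K_def matrix_add_ldistrib matrix_add_rdistrib RA Rc)
  have sym: "x \<bullet> (R *v y) = (R *v x) \<bullet> y" for x y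
    using R(2) by (metis dot_lmul_matrix transpose_matrix_vector)
  have "K *v h \<noteq> 0" if "h \<noteq> 0" for h
  proof
    assume "K *v h = 0"
    then have 0: "A *v h + h - R *v h = 0"
      by (simp add: K_def matrix_vector_mult_add_rdistrib matrix_vector_mult_diff_rdistrib
          flip: add_diff_eq)
    have "R *v (A *v h + h - R *v h) = A *v h"
      using RA(1) R(1) by (simp add: matrix_vector_right_distrib matrix_vector_mult_diff_distrib
          matrix_vector_mul_assoc)
    with 0 have Ah: "A *v h = 0" by simp
    then have hR: "h = R *v h" using 0 by simp
    have "h \<bullet> (A *v h) = (R *v h) \<bullet> (H *v (R *v h))"
      unfolding A_def by (simp add: matrix_vector_mul_assoc[symmetric] sym)
    then show False using Ah hR pos[OF that] by simp
  qed
  then have "inj ((*v) K)"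
    by (intro injI) (metis eq_iff_diff_eq_0 matrix_vector_mult_diff_distrib)
  then obtain J where JK: "J ** K = mat 1"
    using matrix_left_invertible_injective by blast
  then have KJ: "K ** J = mat 1" by (simp add: matrix_left_right_inverse)
  have RJ: "R ** J = J ** R"
  proof -
    have "R ** J = (J ** K) ** (R ** J)" by (simp add: JK)
    also have "\<dots> = J ** (K ** R) ** J" by (simp only: matrix_mul_assoc)
    also have "\<dots> = J ** (R ** K) ** J" by (simp only: RK)
    also have "\<dots> = J ** R ** (K ** J)" by (simp only: matrix_mul_assoc)
    finally show ?thesis by (simp add: KJ)
  qed
  define Y where "Y = R ** J"
  have AY: "A ** Y = R"
  proof -
    have "A ** Y = (A ** R) ** J" by (simp only: Y_def matrix_mul_assoc)
    also have "\<dots> = (R ** K) ** J" by (simp only: RA RK)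
    also have "\<dots> = R ** (K ** J)" by (simp only: matrix_mul_assoc)
    finally show ?thesis by (simp add: KJ)
  qed
  have YA: "Y ** A = R"
  proof -
    have "Y ** A = J ** (R ** A)" by (simp only: Y_def RJ matrix_mul_assoc)
    also have "\<dots> = J ** (K ** R)" by (simp only: RA RK)
    also have "\<dots> = (J ** K) ** R" by (simp only: matrix_mul_assoc)
    finally show ?thesis by (simp add: JK)
  qed
  have RY: "R ** Y = Y" "Y ** R = Y"
    unfolding Y_def by (simp only: matrix_mul_assoc R) (simp only: RJ matrix_mul_assoc[symmetric] R)
  have pi: "is_pseudo_inverse A Y"
    unfolding is_pseudo_inverse_def by (simp add: AY YA RA RY R)
  then have XY: "X = Y" unfolding X_def A_def by (rule pseudo_inverse_eqI)
  show "is_pseudo_inverse (R ** H ** R) X" using pi XY by (simp add: A_def)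
  show "R ** X = X" by (simp add: XY RY)
  show "R ** H ** X = R" 
  proof -
    have "R ** H ** X = R ** H ** (R ** Y)" by (simp only: XY RY)
    also have "\<dots> = A ** Y" by (simp only: A_def matrix_mul_assoc)
    finally show ?thesis by (simp only: AY)
  qed
  assume "transpose H = H"
  then have At: "transpose A = A" unfolding A_def
    by (simp add: matrix_transpose_mul R matrix_mul_assoc)
  have "is_pseudo_inverse A (transpose Y)"
  proof -
    have "A ** transpose Y = R" using matrix_transpose_mul[of Y A] by (simp add: YA At R)
    moreover have "transpose Y ** A = R" using matrix_transpose_mul[of A Y] by (simp add: AY At R)
    moreover have "R ** transpose Y = transpose Y" using matrix_transpose_mul[of Y R] by (simp add: RY R)
    ultimately show ?thesis unfolding is_pseudo_inverse_def by (simp add: RA R)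
  qed
  then show "transpose X = X" using XY pi pseudo_inverse_unique by blast
qed

text \<open>
  Completing the square, one coordinate at a time: subtracting the square of row \<open>i\<close>, divided by
  the diagonal entry \<open>d\<close>, leaves a positive semidefinite matrix whose row \<open>i\<close> is zero.  If
  \<open>d = 0\<close>, semidefiniteness forces the whole row to vanish already.
\<close>

lemma psd_sum_of_squares:
  fixes S :: "real^'n^'n"
  assumes "transpose S = S" "\<And>a. 0 \<le> a \<bullet> (S *v a)"
  shows "\<exists>w :: 'n \<Rightarrow> real^'n. \<forall>a. a \<bullet> (S *v a) = (\<Sum>k\<in>UNIV. (w k \<bullet> a)\<^sup>2)"
proof -
  have step: "\<exists>w :: 'n \<Rightarrow> real^'n. \<forall>a. a \<bullet> (S *v a) = (\<Sum>k\<in>I. (w k \<bullet> a)\<^sup>2)"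
    if "finite I" "transpose S = S" "\<And>a. 0 \<le> a \<bullet> (S *v a)" "\<And>i. i \<notin> I \<Longrightarrow> S $ i = 0"
    for I :: "'n set" and S :: "real^'n^'n"
    using that
  proof (induction I arbitrary: S rule: finite_induct)
    case empty
    then have "S = 0" by (simp add: vec_eq_iff)
    then show ?case by simp
  next
    case (insert i I)
    have S: "S $ j $ k = S $ k $ j" for j k
      using insert.prems(1) by (metis transpose_def vec_lambda_beta)
    define r where "r = S $ i"
    define d where "d = r $ i"
    have quad: "(a + c *\<^sub>R axis i 1) \<bullet> (S *v (a + c *\<^sub>R axis i 1))
        = a \<bullet> (S *v a) + 2 * c * (r \<bullet> a) + c\<^sup>2 * d" for a c
    proof -
      have 1: "S *v axis i 1 = r"
        by (simp add: vec_eq_iff matrix_vector_mult_basis column_def r_def S)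
      have 2: "a \<bullet> r = r \<bullet> a" by (rule inner_commute)
      have 3: "axis i 1 \<bullet> (S *v a) = r \<bullet> a"
        by (simp add: inner_axis' matrix_vector_mul_component r_def)
      have 4: "axis i 1 \<bullet> r = d" by (simp add: inner_axis' d_def)
      show ?thesis
        by (simp add: matrix_vector_right_distrib matrix_vector_mult_scaleR inner_add_left
            inner_add_right 1 2 3 4 power2_eq_square algebra_simps)
    qed
    have d0: "0 \<le> d" using insert.prems(2)[of "axis i 1"] quad[of 0 1] by simp
    define S' where "S' = (\<chi> j k. S $ j $ k - (if d = 0 then 0 else r $ j * r $ k / d))"
    have S'v: "S' *v a = S *v a - (if d = 0 then 0 else ((r \<bullet> a) / d) *\<^sub>R r)" for a
    proof -
      have "(\<Sum>k\<in>UNIV. (S $ j $ k - r $ j * r $ k / d) * a $ k)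
          = (\<Sum>k\<in>UNIV. S $ j $ k * a $ k) - (\<Sum>k\<in>UNIV. r $ k * a $ k) / d * r $ j" for j
        unfolding sum_divide_distrib sum_distrib_right sum_subtractf[symmetric]
        by (intro sum.cong refl) (simp add: algebra_simps)
      then show ?thesis
        by (simp add: vec_eq_iff S'_def matrix_vector_mult_def inner_vec_def)
    qed
    have S'q: "a \<bullet> (S' *v a) = a \<bullet> (S *v a) - (if d = 0 then 0 else (r \<bullet> a)\<^sup>2 / d)" for a
      by (simp add: S'v inner_diff_right inner_commute[of a r] power2_eq_square)
    have r0: "r \<bullet> a = 0" if "d = 0" for a
    proof (rule ccontr)
      assume n: "r \<bullet> a \<noteq> 0"
      define c where "c = - (a \<bullet> (S *v a) + 1) / (2 * (r \<bullet> a))"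
      have "2 * c * (r \<bullet> a) = - (a \<bullet> (S *v a) + 1)" using n by (simp add: c_def)
      then show False
        using insert.prems(2)[of "a + c *\<^sub>R axis i 1"] quad[of a c] that by simp
    qed
    have "\<exists>w :: 'n \<Rightarrow> real^'n. \<forall>a. a \<bullet> (S' *v a) = (\<Sum>k\<in>I. (w k \<bullet> a)\<^sup>2)"
    proof (rule insert.IH)
      show "transpose S' = S'"
        by (simp add: S'_def transpose_def vec_eq_iff S mult.commute)
      show "0 \<le> a \<bullet> (S' *v a)" for a
      proof (cases "d = 0")
        case False
        have "0 \<le> (a + (- (r \<bullet> a) / d) *\<^sub>R axis i 1) \<bullet> (S *v (a + (- (r \<bullet> a) / d) *\<^sub>R axis i 1))"
          by (rule insert.prems(2))
        also have "\<dots> = a \<bullet> (S *v a) - (r \<bullet> a)\<^sup>2 / d"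
          unfolding quad using False by (simp add: field_simps power2_eq_square)
        finally show ?thesis using False by (simp add: S'q)
      qed (use insert.prems(2) in \<open>simp add: S'q\<close>)
      fix j assume j: "j \<notin> I"
      show "S' $ j = 0"
      proof (cases "j = i")
        case True
        show ?thesis
        proof (cases "d = 0")
          case True
          have "r $ k = 0" for k using r0[OF True, of "axis k 1"] by (simp add: inner_axis)
          then show ?thesis using \<open>j = i\<close> True by (simp add: S'_def vec_eq_iff r_def)
        next
          case False
          then show ?thesis using \<open>j = i\<close> by (simp add: S'_def vec_eq_iff d_def r_def)
        qed
      next
        case False
        then have "S $ j = 0" using insert.prems(3) j by simp
        moreover from this have "r $ j = 0" unfolding r_def by (subst S) simp
        ultimately show ?thesis by (simp add: S'_def vec_eq_iff)
      qed
    qed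
    then obtain w where w: "\<And>a. a \<bullet> (S' *v a) = (\<Sum>k\<in>I. (w k \<bullet> a)\<^sup>2)" by blast
    define w' where "w' = w(i := (if d = 0 then 0 else (1 / sqrt d) *\<^sub>R r))"
    have "a \<bullet> (S *v a) = (\<Sum>k\<in>insert i I. (w' k \<bullet> a)\<^sup>2)" for a
    proof -
      have "(\<Sum>k\<in>I. (w' k \<bullet> a)\<^sup>2) = (\<Sum>k\<in>I. (w k \<bullet> a)\<^sup>2)"
        using insert.hyps by (intro sum.cong) (auto simp: w'_def)
      moreover have "(w' i \<bullet> a)\<^sup>2 = (if d = 0 then 0 else (r \<bullet> a)\<^sup>2 / d)"
        using d0 by (simp add: w'_def power_divide)
      ultimately show ?thesis using insert.hyps w[of a] S'q[of a] by simp
    qed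
    then show ?case by blast
  qed
  show ?thesis using step[of UNIV S] assms by simp
qed

section \<open>Gradients and second derivatives\<close>

lemma GDERIV_unique:
  assumes "GDERIV f y :> g" "GDERIV f y :> g'"
  shows "g = g'"
proof -
  have "(\<lambda>h. h \<bullet> g) = (\<lambda>h. h \<bullet> g')"
    using assms unfolding gderiv_def by (rule has_derivative_unique)
  then have "(g - g') \<bullet> g = (g - g') \<bullet> g'" by metis
  then have "(g - g') \<bullet> (g - g') = 0" by (simp add: inner_diff_right)
  then show ?thesis by simp
qed

text \<open>
  Subtracting the linear minorant leaves a function with a minimum at \<open>y\<close>, so its derivative
  there is zero.
\<close>

lemma subgradient_eq_gradient:
  fixes f :: "'a::real_inner \<Rightarrow> real"
  assumes "GDERIV f y :> g" "open U" "y \<in> U" "\<And>z. z \<in> U \<Longrightarrow> f y + m \<bullet> (z - y) \<le> f z"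
  shows "g = m"
proof -
  have "((\<lambda>z. f z - m \<bullet> z) has_derivative (\<lambda>h. h \<bullet> g - m \<bullet> h)) (at y)"
    using assms(1) unfolding gderiv_def by (auto intro!: derivative_eq_intros)
  then have "(\<lambda>h. h \<bullet> g - m \<bullet> h) = (\<lambda>h. 0)"
    using assms(2,3)
  proof (intro differential_zero_maxmin[of y U] disjI2 ballI)
    fix z assume "z \<in> U"
    then show "f y - m \<bullet> y \<le> f z - m \<bullet> z" using assms(4)[of z] by (simp add: inner_diff_right)
  qed
  then have "(g - m) \<bullet> g - m \<bullet> (g - m) = 0" by metis
  then have "(g - m) \<bullet> (g - m) = 0" by (simp add: inner_diff_right inner_diff_left inner_commute)
  then show ?thesis by simp
qed

text \<open>
  This is the form in which differentiability of the expected top bid controls ties between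
  bidders.
\<close>

lemma second_difference_vanishes:
  fixes f :: "'a::real_inner \<Rightarrow> real"
  assumes "GDERIV f y :> g"
  shows "((\<lambda>\<epsilon>. (f (y + \<epsilon> *\<^sub>R e) + f (y - \<epsilon> *\<^sub>R e) - 2 * f y) / \<epsilon>) \<longlongrightarrow> 0) (at_right 0)"
proof -
  have *: "((\<lambda>\<epsilon>. f (y + \<epsilon> *\<^sub>R e)) has_field_derivative (e \<bullet> g)) (at 0)" for e
  proof -
    have "(f has_derivative (\<lambda>h. h \<bullet> g)) (at (y + 0 *\<^sub>R e))" using assms by (simp add: gderiv_def)
    then have "((\<lambda>\<epsilon>. f (y + \<epsilon> *\<^sub>R e)) has_derivative (\<lambda>h. (h *\<^sub>R e) \<bullet> g)) (at 0)"
      by (rule has_derivative_compose[rotated]) (auto intro!: derivative_eq_intros)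
    then show ?thesis by (simp add: has_field_derivative_def mult.commute[of _ "e \<bullet> g"] mult_commute_abs)
  qed
  have "((\<lambda>\<epsilon>. f (y + \<epsilon> *\<^sub>R e) + f (y + \<epsilon> *\<^sub>R (-e)) - 2 * f y) has_field_derivative 0) (at 0)"
    using DERIV_diff[OF DERIV_add[OF *[of e] *[of "-e"]] DERIV_const[of "2 * f y"]] by simp
  then have "((\<lambda>\<epsilon>. (f (y + \<epsilon> *\<^sub>R e) + f (y - \<epsilon> *\<^sub>R e) - 2 * f y) / \<epsilon>) \<longlongrightarrow> 0) (at 0)"
    by (simp add: has_field_derivative_iff)
  then show ?thesis by (rule tendsto_mono[rotated]) (simp add: at_le)
qed

text \<open>
  The mixed second difference of \<open>f\<close> along \<open>p\<close> and \<open>q\<close>, divided by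
  \<open>t\<^sup>2\<close>, tends to \<open>p \<bullet> A q\<close> by the mean value theorem in the direction \<open>p\<close>; being symmetric
  in \<open>p\<close> and \<open>q\<close>, it also tends to \<open>q \<bullet> A p\<close>.
\<close>

lemma second_derivative_symmetric:
  fixes f :: "real^'n \<Rightarrow> real"
  assumes U: "open U" "y \<in> U" and g: "\<And>z. z \<in> U \<Longrightarrow> GDERIV f z :> g z"
    and A: "(g has_derivative (\<lambda>h. A *v h)) (at y)"
  shows "transpose A = A"
proof -
  define M where "M p q t = (f (y + t *\<^sub>R p + t *\<^sub>R q) - f (y + t *\<^sub>R p) - f (y + t *\<^sub>R q) + f y) / t\<^sup>2" for p q t
  have key: "(M p q \<longlongrightarrow> p \<bullet> (A *v q)) (at_right 0)" for p q
  proof (rule tendstoI)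
    fix e :: real assume e: "0 < e"
    (* chosen so that both error terms of the gradient, multiplied by p, stay below e t *)
    define e' where "e' = e / (2 * (norm p + 1) * (norm p + norm q + 1))"
    have e': "0 < e'" using e unfolding e'_def
      by (intro divide_pos_pos mult_pos_pos) (auto intro: add_nonneg_pos)
    from A obtain d where d: "0 < d" "\<And>z. norm (z - y) < d \<Longrightarrow>
        norm (g z - g y - A *v (z - y)) \<le> e' * norm (z - y)"
      using e' unfolding has_derivative_at_alt by blast
    from U obtain d2 where d2: "0 < d2" "ball y d2 \<subseteq> U" by (auto simp: open_contains_ball)
    define D where "D = min d d2 / (norm p + norm q + 1)"
    have N: "0 < norm p + norm q + 1" by (simp add: add_nonneg_pos)
    have D: "0 < D" unfolding D_def using d(1) d2(1) N by simp
    show "\<forall>\<^sub>F t in at_right 0. dist (M p q t) (p \<bullet> (A *v q)) < e"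
      using D
    proof (intro eventually_at_right[THEN iffD2, of 0 1, OF zero_less_one] exI[of _ D] conjI allI impI)
      fix t :: real assume t: "0 < t" "t < D"
      have near: "norm (s *\<^sub>R p + r *\<^sub>R q) \<le> t * (norm p + norm q)" if "\<bar>s\<bar> \<le> t" "\<bar>r\<bar> \<le> t" for s r
      proof -
        have "norm (s *\<^sub>R p + r *\<^sub>R q) \<le> \<bar>s\<bar> * norm p + \<bar>r\<bar> * norm q"
          using norm_triangle_ineq[of "s *\<^sub>R p" "r *\<^sub>R q"] by simp
        also have "\<dots> \<le> t * norm p + t * norm q" using that by (intro add_mono mult_right_mono) auto
        finally show ?thesis by (simp add: distrib_left)
      qed
      have small: "t * (norm p + norm q) < min d d2"
      proof -
        have "t * (norm p + norm q) \<le> t * (norm p + norm q + 1)" using t by simp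
        also have "\<dots> < D * (norm p + norm q + 1)" using t N by (intro mult_strict_right_mono) auto
        also have "\<dots> = min d d2" using N by (simp add: D_def)
        finally show ?thesis .
      qed
      have inU: "y + s *\<^sub>R p + r *\<^sub>R q \<in> U" if "\<bar>s\<bar> \<le> t" "\<bar>r\<bar> \<le> t" for s r
      proof -
        have "dist y (y + s *\<^sub>R p + r *\<^sub>R q) < d2"
        proof -
          have "dist y (y + s *\<^sub>R p + r *\<^sub>R q) = norm (s *\<^sub>R p + r *\<^sub>R q)"
            by (metis add.assoc add_diff_cancel_left' dist_commute dist_norm)
          then show ?thesis using near[OF that] small by simp
        qed
        then show ?thesis using d2(2) by auto
      qed
      define \<phi> where "\<phi> s = f (y + s *\<^sub>R p + t *\<^sub>R q) - f (y + s *\<^sub>R p)" for s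
      have der: "(\<phi> has_field_derivative (p \<bullet> (g (y + s *\<^sub>R p + t *\<^sub>R q) - g (y + s *\<^sub>R p)))) (at s)"
        if "0 \<le> s" "s \<le> t" for s
      proof -
        have "((\<lambda>s. f (y + s *\<^sub>R p + c)) has_field_derivative (p \<bullet> g (y + s *\<^sub>R p + c))) (at s)"
          if "y + s *\<^sub>R p + c \<in> U" for c
        proof -
          have "(f has_derivative (\<lambda>h. h \<bullet> g (y + s *\<^sub>R p + c))) (at (y + s *\<^sub>R p + c))"
            using g[OF that] by (simp add: gderiv_def)
          then have "((\<lambda>s. f (y + s *\<^sub>R p + c)) has_derivative (\<lambda>h. (h *\<^sub>R p) \<bullet> g (y + s *\<^sub>R p + c))) (at s)"
            by (rule has_derivative_compose[rotated]) (auto intro!: derivative_eq_intros)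
          then show ?thesis by (simp add: has_field_derivative_def mult_commute_abs)
        qed
        from DERIV_diff[OF this[of "t *\<^sub>R q"] this[of 0]] show ?thesis
          unfolding \<phi>_def using inU[of s t] inU[of s 0] that t by (simp add: inner_diff_right)
      qed
      have "\<exists>z>0. z < t \<and> \<phi> t - \<phi> 0 = (t - 0) * (p \<bullet> (g (y + z *\<^sub>R p + t *\<^sub>R q) - g (y + z *\<^sub>R p)))"
        by (rule MVT2[OF t(1) der])
      then obtain z where z: "0 < z" "z < t" "\<phi> t - \<phi> 0 = (t - 0) * (p \<bullet> (g (y + z *\<^sub>R p + t *\<^sub>R q) - g (y + z *\<^sub>R p)))"
        by (elim exE conjE) (rule that)
      define G where "G c = g (y + c) - g y - A *v c" for c
      have Gb: "norm (G (s *\<^sub>R p + r *\<^sub>R q)) \<le> e' * (t * (norm p + norm q))" if "\<bar>s\<bar> \<le> t" "\<bar>r\<bar> \<le> t" for s r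
      proof -
        have "norm (G (s *\<^sub>R p + r *\<^sub>R q)) \<le> e' * norm (s *\<^sub>R p + r *\<^sub>R q)"
          using d(2)[of "y + (s *\<^sub>R p + r *\<^sub>R q)"] near[OF that] small by (simp add: G_def)
        also have "\<dots> \<le> e' * (t * (norm p + norm q))" using near[OF that] e' by (intro mult_left_mono) auto
        finally show ?thesis .
      qed
      have eq: "g (y + z *\<^sub>R p + t *\<^sub>R q) - g (y + z *\<^sub>R p) =
          t *\<^sub>R (A *v q) + (G (z *\<^sub>R p + t *\<^sub>R q) - G (z *\<^sub>R p + 0 *\<^sub>R q))"
        by (simp add: G_def matrix_vector_right_distrib matrix_vector_mult_scaleR add.assoc)
      have "\<phi> t - \<phi> 0 = t\<^sup>2 * (p \<bullet> (A *v q)) + t * (p \<bullet> (G (z *\<^sub>R p + t *\<^sub>R q) - G (z *\<^sub>R p + 0 *\<^sub>R q)))"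
        unfolding z(3) eq by (simp add: inner_add_right distrib_left power2_eq_square)
      then have "(\<phi> t - \<phi> 0) / t\<^sup>2 - p \<bullet> (A *v q) = (p \<bullet> (G (z *\<^sub>R p + t *\<^sub>R q) - G (z *\<^sub>R p + 0 *\<^sub>R q))) / t"
        using t by (simp add: field_simps power2_eq_square)
      moreover have "\<bar>p \<bullet> (G (z *\<^sub>R p + t *\<^sub>R q) - G (z *\<^sub>R p + 0 *\<^sub>R q))\<bar> < e * t"
      proof -
        have "\<bar>p \<bullet> (G (z *\<^sub>R p + t *\<^sub>R q) - G (z *\<^sub>R p + 0 *\<^sub>R q))\<bar>
            \<le> norm p * norm (G (z *\<^sub>R p + t *\<^sub>R q) - G (z *\<^sub>R p + 0 *\<^sub>R q))"
          by (rule Cauchy_Schwarz_ineq2)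
        also have "\<dots> \<le> norm p * (2 * (e' * (t * (norm p + norm q))))"
          using Gb[of z t] Gb[of z 0] z t
            norm_triangle_ineq4[of "G (z *\<^sub>R p + t *\<^sub>R q)" "G (z *\<^sub>R p + 0 *\<^sub>R q)"]
          by (intro mult_left_mono) auto
        also have "\<dots> < (norm p + 1) * (2 * (e' * (t * (norm p + norm q + 1))))"
          using t e' by (intro mult_strict_mono' mult_strict_left_mono mult_nonneg_nonneg) auto
        also have "\<dots> = e * t"
          using N unfolding e'_def by (simp add: divide_simps add_nonneg_eq_0_iff)
        finally show ?thesis .
      qed
      ultimately have "\<bar>(\<phi> t - \<phi> 0) / t\<^sup>2 - p \<bullet> (A *v q)\<bar> < e"
        using t by (simp add: divide_less_eq)
      then show "dist (M p q t) (p \<bullet> (A *v q)) < e"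
        by (simp add: M_def \<phi>_def dist_real_def algebra_simps)
    qed
  qed
  have sym: "p \<bullet> (A *v q) = q \<bullet> (A *v p)" for p q
  proof (rule tendsto_unique[OF _ key])
    show "(M p q \<longlongrightarrow> q \<bullet> (A *v p)) (at_right 0)"
      using key[of q p] by (simp add: M_def[abs_def] algebra_simps)
  qed simp
  have "A $ i $ j = A $ j $ i" for i j
    using sym[of "axis i 1" "axis j 1"]
    by (simp add: inner_axis' matrix_vector_mult_basis column_def)
  then show ?thesis by (simp add: transpose_def vec_eq_iff)
qed

section \<open>Normal laws\<close>

lemma real_distribution_normal_law:
  assumes "0 \<le> V" shows "real_distribution (normal_law m V)"
proof (cases "V = 0")
  case True
  have "prob_space (return (borel :: real measure) m)" by (intro prob_space_return) simp
  with True show ?thesis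
    by (simp add: normal_law_def real_distribution_def real_distribution_axioms_def)
next
  case False
  then have "prob_space (density lborel (normal_density m (sqrt V)))"
    using assms by (intro prob_space_normal_density) auto
  with False show ?thesis
    by (simp add: normal_law_def real_distribution_def real_distribution_axioms_def)
qed

lemma char_normal_law:
  assumes "0 \<le> V" shows "char (normal_law 0 V) t = exp (complex_of_real (- (t\<^sup>2 * V) / 2))"
proof (cases "V = 0")
  case True
  then show ?thesis by (simp add: normal_law_def char_def integral_return)
next
  case False
  define \<sigma> where "\<sigma> = sqrt V"
  have \<sigma>: "0 < \<sigma>" "\<sigma>\<^sup>2 = V" using assms False by (auto simp: \<sigma>_def)
  interpret N: prob_space std_normal_distribution
    using real_dist_normal_dist by (simp add: real_distribution_def)
  have "distributed std_normal_distribution lborel (\<lambda>x. x) std_normal_density"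
    by (auto simp: distributed_def distr_id2)
  from N.normal_density_affine[OF this, of \<sigma> 0] \<sigma>
  have "distributed std_normal_distribution lborel (\<lambda>x. \<sigma> * x) (normal_density 0 \<sigma>)"
    by simp
  then have "distr std_normal_distribution lborel (\<lambda>x. \<sigma> * x) = density lborel (normal_density 0 \<sigma>)"
    by (simp add: distributed_def)
  moreover have "distr std_normal_distribution lborel (\<lambda>x. \<sigma> * x) = distr std_normal_distribution borel (\<lambda>x. \<sigma> * x)"
    by (rule distr_cong) auto
  ultimately have eq: "normal_law 0 V = distr std_normal_distribution borel (\<lambda>x. \<sigma> * x)"
    using False by (simp add: normal_law_def \<sigma>_def)
  have "char (normal_law 0 V) t = char std_normal_distribution (t * \<sigma>)"
    unfolding eq char_def by (subst integral_distr) (auto simp: mult.assoc)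
  also have "\<dots> = exp (complex_of_real (- (t\<^sup>2 * V) / 2))"
    by (simp add: char_std_normal_distribution \<sigma>(2)[symmetric] power_mult_distrib flip: exp_of_real)
  finally show ?thesis .
qed

text \<open>
  Writing the quadratic form of \<open>S\<close> as a sum of squares of linear forms \<open>w k\<close> gives the normal law
  as the law of \<open>\<Sum>k. \<omega> k w k\<close> for independent standard normal \<open>\<omega> k\<close>; this
  covers degenerate covariances.  The law of each linear functional is read off from its
  characteristic function, a product of Gaussian ones.
\<close>

lemma normal_law_exists:
  fixes S :: "real^'n^'n" and w :: "'n \<Rightarrow> real^'n"
  assumes sym: "transpose S = S"
    and w: "\<And>a. a \<bullet> (S *v a) = (\<Sum>k\<in>UNIV. (w k \<bullet> a)\<^sup>2)"
  shows "\<exists>N. is_normal_law N 0 S"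
proof -
  define B where "B = PiM (UNIV :: 'n set) (\<lambda>_. std_normal_distribution)"
  interpret product_prob_space "\<lambda>_ :: 'n. std_normal_distribution" UNIV
    using real_dist_normal_dist
    by (simp add: real_distribution_def product_prob_space_def product_prob_space_axioms_def
        product_sigma_finite_def prob_space_imp_sigma_finite)
  interpret B: prob_space B unfolding B_def by (rule prob_space_axioms)
  define Y where "Y \<omega> = (\<Sum>k\<in>UNIV. \<omega> k *\<^sub>R w k)" for \<omega> :: "'n \<Rightarrow> real"
  have coord [measurable]: "(\<lambda>\<omega>. \<omega> k) \<in> borel_measurable B" for k
    unfolding B_def using measurable_component_singleton[of k UNIV "\<lambda>_. std_normal_distribution"] by simp
  have Y [measurable]: "Y \<in> borel_measurable B" unfolding Y_def[abs_def] by measurable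
  have ind: "B.indep_vars (\<lambda>_. borel) (\<lambda>k \<omega>. \<omega> k) UNIV"
  proof -
    have "B.indep_vars (\<lambda>_. std_normal_distribution) (\<lambda>k \<omega>. \<omega> k) UNIV"
    proof (subst B.indep_vars_iff_distr_eq_PiM)
      have "distr B (PiM UNIV (\<lambda>_. std_normal_distribution)) (\<lambda>\<omega>. \<lambda>k\<in>UNIV. \<omega> k) = B"
        unfolding B_def by (simp add: distr_id2 restrict_def)
      moreover have "distr B std_normal_distribution (\<lambda>\<omega>. \<omega> k) = std_normal_distribution" for k
        unfolding B_def by (rule PiM_component) simp
      ultimately show "distr B (PiM UNIV (\<lambda>_. std_normal_distribution)) (\<lambda>\<omega>. \<lambda>k\<in>UNIV. \<omega> k)
          = PiM UNIV (\<lambda>k. distr B std_normal_distribution (\<lambda>\<omega>. \<omega> k))"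
        by (simp add: B_def)
    qed (auto)
    then show ?thesis by (simp add: B.indep_vars_def2)
  qed
  have dist: "distr B borel (\<lambda>\<omega>. \<omega> k) = std_normal_distribution" for k
  proof -
    have "distr B borel (\<lambda>\<omega>. \<omega> k) = distr B std_normal_distribution (\<lambda>\<omega>. \<omega> k)"
      by (rule distr_cong) auto
    also have "\<dots> = std_normal_distribution" unfolding B_def by (rule PiM_component) simp
    finally show ?thesis .
  qed
  have proj_law: "distr B borel (\<lambda>\<omega>. a \<bullet> Y \<omega>) = normal_law 0 (a \<bullet> (S *v a))" for a
  proof (rule Levy_uniqueness)
    have nn: "0 \<le> a \<bullet> (S *v a)" by (simp add: w sum_nonneg)
    show "real_distribution (distr B borel (\<lambda>\<omega>. a \<bullet> Y \<omega>))"
      by (rule B.real_distribution_distr) simp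
    show "real_distribution (normal_law 0 (a \<bullet> (S *v a)))"
      by (rule real_distribution_normal_law[OF nn])
    show "char (distr B borel (\<lambda>\<omega>. a \<bullet> Y \<omega>)) = char (normal_law 0 (a \<bullet> (S *v a)))"
    proof
      fix t :: real
      have "char (distr B borel (\<lambda>\<omega>. a \<bullet> Y \<omega>)) t
          = char (distr B borel (\<lambda>\<omega>. \<Sum>k\<in>UNIV. (w k \<bullet> a) * \<omega> k)) t"
        by (simp add: Y_def inner_sum_right inner_commute mult.commute)
      also have "\<dots> = (\<Prod>k\<in>UNIV. char (distr B borel (\<lambda>\<omega>. (w k \<bullet> a) * \<omega> k)) t)"
        by (rule B.char_distr_sum)
           (rule B.indep_vars_compose2[OF ind, where Y="\<lambda>k y. (w k \<bullet> a) * y"], simp)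
      also have "\<dots> = (\<Prod>k\<in>UNIV. exp (complex_of_real (- (t\<^sup>2 * (w k \<bullet> a)\<^sup>2) / 2)))"
      proof (rule prod.cong)
        fix k
        have "char (distr B borel (\<lambda>\<omega>. (w k \<bullet> a) * \<omega> k)) t
            = char (distr B borel (\<lambda>\<omega>. \<omega> k)) (t * (w k \<bullet> a))"
          by (simp add: char_def integral_distr mult.assoc)
        then show "char (distr B borel (\<lambda>\<omega>. (w k \<bullet> a) * \<omega> k)) t
            = exp (complex_of_real (- (t\<^sup>2 * (w k \<bullet> a)\<^sup>2) / 2))"
          by (simp add: dist char_std_normal_distribution power_mult_distrib flip: exp_of_real)
      qed simp
      also have "\<dots> = exp (complex_of_real (- (t\<^sup>2 * (a \<bullet> (S *v a))) / 2))"
        by (simp add: w exp_sum[symmetric] sum_distrib_left sum_divide_distrib sum_negf)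
      also have "\<dots> = char (normal_law 0 (a \<bullet> (S *v a))) t" by (simp add: char_normal_law[OF nn])
      finally show "char (distr B borel (\<lambda>\<omega>. a \<bullet> Y \<omega>)) t = char (normal_law 0 (a \<bullet> (S *v a))) t" .
    qed
  qed
  have "is_normal_law (distr B borel Y) 0 S"
    unfolding is_normal_law_def
    using sym proj_law by (auto simp: B.prob_space_distr distr_distr comp_def)
  then show ?thesis by blast
qed

section \<open>Convergence in law from characteristic functions\<close>

text \<open>
  Phases are included so that sines are covered and the product of two terms is again a sum of two
  terms of the same kind.
\<close>

inductive trig_polynomial :: "('a::real_inner \<Rightarrow> real) \<Rightarrow> bool" where
  wave: "trig_polynomial (\<lambda>y. c * cos (a \<bullet> y + \<phi>))"
| add: "trig_polynomial f \<Longrightarrow> trig_polynomial g \<Longrightarrow> trig_polynomial (\<lambda>y. f y + g y)"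

lemma trig_polynomial_mult:
  assumes "trig_polynomial f" "trig_polynomial g"
  shows "trig_polynomial (\<lambda>y. f y * g y)"
  using assms
proof (induction f)
  case (wave c a \<phi>)
  from wave(1) show ?case
  proof (induction g)
    case (wave d b \<psi>)
    have "(\<lambda>y. c * cos (a \<bullet> y + \<phi>) * (d * cos (b \<bullet> y + \<psi>))) =
        (\<lambda>y. (c * d / 2) * cos ((a - b) \<bullet> y + (\<phi> - \<psi>)) + (c * d / 2) * cos ((a + b) \<bullet> y + (\<phi> + \<psi>)))"
    proof
      fix y
      have "cos (a \<bullet> y + \<phi>) * cos (b \<bullet> y + \<psi>) =
          (cos ((a - b) \<bullet> y + (\<phi> - \<psi>)) + cos ((a + b) \<bullet> y + (\<phi> + \<psi>))) / 2"
        by (simp add: cos_times_cos inner_diff_left inner_add_left algebra_simps)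
      then show "c * cos (a \<bullet> y + \<phi>) * (d * cos (b \<bullet> y + \<psi>)) =
          (c * d / 2) * cos ((a - b) \<bullet> y + (\<phi> - \<psi>)) + (c * d / 2) * cos ((a + b) \<bullet> y + (\<phi> + \<psi>))"
        by (simp add: field_simps)
    qed
    then show ?case by (simp only:) (intro trig_polynomial.intros)
  next
    case (add f g)
    then show ?case by (simp only: distrib_left) (intro trig_polynomial.intros)
  qed
next
  case (add f h)
  then show ?case
    using trig_polynomial.add[of "\<lambda>y. f y * g y" "\<lambda>y. h y * g y"] by (simp add: distrib_right)
qed

lemma trig_polynomial_const: "trig_polynomial (\<lambda>y. c)"
  using trig_polynomial.wave[of c 0 0] by simp

lemma trig_polynomial_sum:
  assumes "finite I" "\<And>i. i \<in> I \<Longrightarrow> trig_polynomial (f i)"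
  shows "trig_polynomial (\<lambda>y. \<Sum>i\<in>I. f i y)"
  using assms
  by (induction I rule: finite_induct) (auto intro: trig_polynomial_const trig_polynomial.add)

text \<open>
  On a fixed ball \<open>L\<close> times this map is close to the identity once \<open>L\<close> is large, yet it takes
  values in a fixed cube and is periodic.  Composing it with a polynomial therefore gives a
  trigonometric polynomial that is controlled on the whole space.
\<close>

definition sine_box :: "real \<Rightarrow> real^'n \<Rightarrow> real^'n" where
  "sine_box L y = (\<chi> i. sin (y $ i / L))"

lemma trig_polynomial_sine_box:
  fixes q :: "real^'n \<Rightarrow> real"
  assumes "real_polynomial_function q"
  shows "trig_polynomial (\<lambda>y. q (sine_box L y))"
  using assms
proof (induction q)
  case (linear f)
  interpret bounded_linear f by fact
  have "f (sine_box L y) = (\<Sum>i\<in>UNIV. f (axis i 1) * cos ((axis i (1 / L)) \<bullet> y + - (pi / 2)))" for y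
  proof -
    have "sine_box L y = (\<Sum>i\<in>UNIV. sin (y $ i / L) *\<^sub>R axis i 1)"
      by (simp add: sine_box_def vec_eq_iff axis_def if_distrib[of "\<lambda>x. _ * x"] sum.delta cong: if_cong)
    then show ?thesis by (simp add: sum scale inner_axis' mult.commute cos_diff)
  qed
  then show ?case by (simp only:) (intro trig_polynomial_sum trig_polynomial.intros, simp)
next
  case (const c)
  then show ?case by (rule trig_polynomial_const)
qed (auto intro: trig_polynomial.add trig_polynomial_mult)

lemma sine_box_close:
  assumes "0 < K" "0 < d"
  shows "\<exists>L>0. \<forall>y :: real^'n. norm y \<le> K \<longrightarrow> norm (L *\<^sub>R sine_box L y - y) \<le> d"
proof -
  define L where "L = real CARD('n) * K\<^sup>2 / d + 1"
  have L: "0 < L" unfolding L_def using assms by (intro add_nonneg_pos divide_nonneg_pos) auto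
  have "norm (L *\<^sub>R sine_box L y - y) \<le> d" if "norm y \<le> K" for y :: "real^'n"
  proof -
    have c: "\<bar>L * sin (y $ i / L) - y $ i\<bar> \<le> K\<^sup>2 / L" for i
    proof -
      have yi: "\<bar>y $ i\<bar> \<le> K" using component_le_norm_cart[of y i] that by linarith
      have "\<bar>sin (y $ i / L) - y $ i / L\<bar> \<le> (y $ i / L)\<^sup>2"
        using Maclaurin_sin_bound[of "y $ i / L" 2] by (simp add: numeral_2_eq_2 sin_coeff_def)
      then have "L * \<bar>sin (y $ i / L) - y $ i / L\<bar> \<le> L * (y $ i / L)\<^sup>2" using L by simp
      also have "\<dots> = (y $ i)\<^sup>2 / L" using L by (simp add: power2_eq_square)
      also have "\<dots> \<le> K\<^sup>2 / L" using L yi assms(1) by (intro divide_right_mono power2_le_iff_abs_le[THEN iffD2]) auto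
      finally have "L * \<bar>sin (y $ i / L) - y $ i / L\<bar> \<le> K\<^sup>2 / L" .
      moreover have "L * sin (y $ i / L) - y $ i = L * (sin (y $ i / L) - y $ i / L)"
        using L by (simp add: right_diff_distrib)
      ultimately show ?thesis using L by (simp add: abs_mult)
    qed
    have "norm (L *\<^sub>R sine_box L y - y) \<le> (\<Sum>i\<in>UNIV. \<bar>(L *\<^sub>R sine_box L y - y) $ i\<bar>)"
      by (rule norm_le_l1_cart)
    also have "\<dots> \<le> (\<Sum>i\<in>(UNIV::'n set). K\<^sup>2 / L)"
      by (intro sum_mono) (use c in \<open>simp add: sine_box_def\<close>)
    also have "\<dots> \<le> d" using L assms by (simp add: L_def field_simps)
    finally show ?thesis .
  qed
  with L show ?thesis by blast
qed

definition tight :: "'w measure \<Rightarrow> (nat \<Rightarrow> 'w \<Rightarrow> 'a::real_normed_vector) \<Rightarrow> bool" where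
  "tight P X \<longleftrightarrow> (\<forall>\<epsilon>>0. \<exists>K>0. all_but P \<epsilon> (\<lambda>t \<omega>. norm (X t \<omega>) \<le> K))"

lemma trig_polynomial_continuous: "trig_polynomial f \<Longrightarrow> continuous_on UNIV f"
  by (induction f rule: trig_polynomial.induct) (auto intro!: continuous_intros)

lemma trig_polynomial_bounded: "trig_polynomial f \<Longrightarrow> \<exists>B. \<forall>y. \<bar>f y\<bar> \<le> B"
proof (induction f rule: trig_polynomial.induct)
  case (wave c a \<phi>)
  have "\<bar>c * cos (a \<bullet> y + \<phi>)\<bar> \<le> \<bar>c\<bar>" for y
    using mult_left_mono[OF abs_cos_le_one[of "a \<bullet> y + \<phi>"], of "\<bar>c\<bar>"] by (simp add: abs_mult)
  then show ?case by blast
next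
  case (add f g)
  then obtain B C where "\<forall>y. \<bar>f y\<bar> \<le> B" "\<forall>y. \<bar>g y\<bar> \<le> C" by blast
  then have "\<bar>f y + g y\<bar> \<le> B + C" for y
    using abs_triangle_ineq[of "f y" "g y"] by (smt (verit))
  then show ?case by blast
qed

lemma (in prob_space) expectation_close:
  fixes f g :: "'a \<Rightarrow> real"
  assumes "integrable M f" "integrable M g" "S \<in> events" "0 \<le> C"
    and "\<And>\<omega>. \<omega> \<in> space M - S \<Longrightarrow> \<bar>f \<omega> - g \<omega>\<bar> \<le> e"
    and "\<And>\<omega>. \<omega> \<in> space M \<Longrightarrow> \<bar>f \<omega> - g \<omega>\<bar> \<le> C" "0 \<le> e"
  shows "\<bar>expectation f - expectation g\<bar> \<le> e + C * prob S"
proof -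
  have "\<bar>expectation f - expectation g\<bar> = \<bar>expectation (\<lambda>\<omega>. f \<omega> - g \<omega>)\<bar>"
    using assms by simp
  also have "\<dots> \<le> expectation (\<lambda>\<omega>. \<bar>f \<omega> - g \<omega>\<bar>)" by (rule integral_abs_bound)
  also have "\<dots> \<le> expectation (\<lambda>\<omega>. e + C * indicator S \<omega>)"
  proof (rule integral_mono)
    show "integrable M (\<lambda>\<omega>. e + C * indicator S \<omega>)" using assms(3) by (simp add: emeasure_eq_measure)
    fix \<omega> assume "\<omega> \<in> space M"
    then show "\<bar>f \<omega> - g \<omega>\<bar> \<le> e + C * indicator S \<omega>"
      using assms(4-) by (cases "\<omega> \<in> S") (force simp: indicator_def)+
  qed (use assms in auto)
  also have "\<dots> = e + C * prob S"
    using assms(3) by (simp add: emeasure_eq_measure prob_space)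
  finally show ?thesis .
qed

text \<open>
  The multivariate continuity theorem, for a known limit law.  Given a bounded continuous \<open>f\<close>,
  approximate \<open>z \<mapsto> f (L z)\<close> on the cube by a polynomial \<open>q\<close> (Weierstrass) and put
  \<open>T y = q (sine_box L y)\<close>.  This is a trigonometric polynomial, so its expectations converge; it
  is bounded by about \<open>sup f\<close> everywhere and close to \<open>f\<close> on a large ball, and tightness takes
  care of the complement of the ball.
\<close>

lemma (in prob_space) tendsto_in_law_of_char:
  fixes X :: "nat \<Rightarrow> 'a \<Rightarrow> real^'n"
  assumes X: "\<And>t. t \<ge> 1 \<Longrightarrow> X t \<in> borel_measurable M"
    and N: "prob_space N" "sets N = sets borel"
    and tight: "tight M X"
    and cos: "\<And>a. (\<lambda>t. expectation (\<lambda>\<omega>. cos (a \<bullet> X t \<omega>))) \<longlonglongrightarrow> (\<integral>y. cos (a \<bullet> y) \<partial>N)"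
    and sin: "\<And>a. (\<lambda>t. expectation (\<lambda>\<omega>. sin (a \<bullet> X t \<omega>))) \<longlonglongrightarrow> (\<integral>y. sin (a \<bullet> y) \<partial>N)"
  shows "tendsto_in_law M X N"
  unfolding tendsto_in_law_def
proof (intro conjI allI impI, use X in blast)
  fix f :: "real^'n \<Rightarrow> real" assume f: "continuous_on UNIV f \<and> bounded (range f)"
  interpret N: prob_space N by fact
  have spN: "space N = UNIV" using sets_eq_imp_space_eq[OF N(2)] by simp
  have intP: "integrable M (\<lambda>\<omega>. g (X t \<omega>))" if "t \<ge> 1" "continuous_on UNIV g" "\<forall>y. \<bar>g y\<bar> \<le> B"
    for g :: "real^'n \<Rightarrow> real" and B t
    using that(3) measurable_compose[OF X[OF that(1)] borel_measurable_continuous_onI[OF that(2)]]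
    by (intro integrable_const_bound[of _ B] AE_I2) simp_all
  have intN: "integrable N g" if "continuous_on UNIV g" "\<forall>y. \<bar>g y\<bar> \<le> B"
    for g :: "real^'n \<Rightarrow> real" and B
  proof (intro N.integrable_const_bound[of _ B] AE_I2)
    show "g \<in> borel_measurable N"
      using borel_measurable_continuous_onI[OF that(1)] measurable_cong_sets[OF N(2) refl, of borel] by metis
  qed (use that in simp)
  have trig: "(\<lambda>t. expectation (\<lambda>\<omega>. g (X t \<omega>))) \<longlonglongrightarrow> N.expectation g"
    if "trig_polynomial g" for g :: "real^'n \<Rightarrow> real"
    using that
  proof (induction g rule: trig_polynomial.induct)
    case (wave c a \<phi>)
    have eq: "c * cos (a \<bullet> y + \<phi>) = c * cos \<phi> * cos (a \<bullet> y) - c * sin \<phi> * sin (a \<bullet> y)" for y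
      by (simp add: cos_add algebra_simps)
    have csN: "integrable N (\<lambda>y. cos (a \<bullet> y))" "integrable N (\<lambda>y. sin (a \<bullet> y))"
      by (intro intN[of _ 1] continuous_intros allI; simp)+
    have csP: "integrable M (\<lambda>\<omega>. cos (a \<bullet> X t \<omega>))" "integrable M (\<lambda>\<omega>. sin (a \<bullet> X t \<omega>))" if "t \<ge> 1" for t
      by (intro intP[OF that, of _ 1] continuous_intros allI; simp)+
    have "(\<lambda>t. c * cos \<phi> * expectation (\<lambda>\<omega>. cos (a \<bullet> X t \<omega>)) - c * sin \<phi> * expectation (\<lambda>\<omega>. sin (a \<bullet> X t \<omega>)))
        \<longlonglongrightarrow> c * cos \<phi> * N.expectation (\<lambda>y. cos (a \<bullet> y)) - c * sin \<phi> * N.expectation (\<lambda>y. sin (a \<bullet> y))"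
      by (intro tendsto_intros assms)
    moreover have "\<forall>\<^sub>F t in sequentially.
        c * cos \<phi> * expectation (\<lambda>\<omega>. cos (a \<bullet> X t \<omega>)) - c * sin \<phi> * expectation (\<lambda>\<omega>. sin (a \<bullet> X t \<omega>))
        = expectation (\<lambda>\<omega>. c * cos (a \<bullet> X t \<omega> + \<phi>))"
      using eventually_ge_at_top[of 1]
      by eventually_elim (use csP in \<open>simp add: eq\<close>)
    ultimately show ?case
      using Lim_transform_eventually csN by (simp add: eq)
  next
    case (add g h)
    from add.hyps obtain B C where BC: "\<forall>y. \<bar>g y\<bar> \<le> B" "\<forall>y. \<bar>h y\<bar> \<le> C"
      using trig_polynomial_bounded by metis
    note ch = add.hyps[THEN trig_polynomial_continuous]
    have "N.expectation (\<lambda>y. g y + h y) = N.expectation g + N.expectation h"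
      using intN[OF ch(1) BC(1)] intN[OF ch(2) BC(2)] by simp
    moreover have "\<forall>\<^sub>F t in sequentially. expectation (\<lambda>\<omega>. g (X t \<omega>)) + expectation (\<lambda>\<omega>. h (X t \<omega>))
        = expectation (\<lambda>\<omega>. g (X t \<omega>) + h (X t \<omega>))"
      using eventually_ge_at_top[of 1]
      by eventually_elim (use intP[OF _ ch(1) BC(1)] intP[OF _ ch(2) BC(2)] in simp)
    ultimately show ?case
      using Lim_transform_eventually[OF tendsto_add[OF add.IH]] by simp
  qed
  obtain B where B: "0 < B" "\<forall>y. \<bar>f y\<bar> \<le> B"
    using f by (auto simp: bounded_pos)
  show "(\<lambda>t. expectation (\<lambda>\<omega>. f (X t \<omega>))) \<longlonglongrightarrow> N.expectation f"
  proof (rule tendstoI)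
    fix \<epsilon> :: real assume \<epsilon>: "0 < \<epsilon>"
    (* C will bound the error of the approximation everywhere, so that an exceptional set of
       probability \<delta> costs at most \<epsilon> / 8 *)
    define C where "C = 2 * B + \<epsilon> / 16"
    have C': "0 \<le> C" "0 < C" using B \<epsilon> by (auto simp: C_def)
    define \<delta> where "\<delta> = \<epsilon> / (8 * C)"
    have \<delta>: "0 < \<delta>" and C\<delta>: "C * \<delta> = \<epsilon> / 8" using \<epsilon> C' by (auto simp: \<delta>_def)
    from tight \<delta> obtain K1 where K1: "0 < K1" "all_but M \<delta> (\<lambda>t \<omega>. norm (X t \<omega>) \<le> K1)"
      by (auto simp: tight_def)
    obtain K2 where K2: "0 < K2" "N.prob {y. \<not> norm y \<le> K2} < \<delta>"
    proof -
      have "(\<lambda>k. N.prob {y. norm y > real k}) \<longlonglongrightarrow> N.prob (\<Inter>k. {y. norm y > real k})"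
        by (rule N.finite_Lim_measure_decseq) (auto simp: N(2) decseq_def)
      moreover have "(\<Inter>k. {y :: real^'n. norm y > real k}) = {}"
      proof -
        have "\<exists>k. \<not> norm y > real k" for y :: "real^'n"
          using real_arch_simple[of "norm y"] by (simp add: not_less)
        then show ?thesis by blast
      qed
      ultimately have "(\<lambda>k. N.prob {y. norm y > real k}) \<longlonglongrightarrow> 0" by simp
      from eventually_happens'[OF sequentially_bot
          eventually_conj[OF order_tendstoD(2)[OF this \<delta>] eventually_gt_at_top[of 0]]]
      obtain k where "N.prob {y. norm y > real k} < \<delta>" "0 < k"
        by blast
      then show thesis using that[of "real k"] by (simp add: not_le)
    qed
    define K where "K = max K1 K2"
    have K: "0 < K" using K1 by (simp add: K_def)
    have "uniformly_continuous_on (cball 0 (K + 1)) f"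
      using f by (intro compact_uniformly_continuous) (auto intro: continuous_on_subset)
    then obtain d where d: "0 < d" "\<And>y z. y \<in> cball 0 (K+1) \<Longrightarrow> z \<in> cball 0 (K+1) \<Longrightarrow>
        dist z y < d \<Longrightarrow> dist (f z) (f y) < \<epsilon> / 16"
      unfolding uniformly_continuous_on_def using \<epsilon> by (auto elim!: allE[of _ "\<epsilon> / 16"])
    obtain L where L: "0 < L" "\<And>y :: real^'n. norm y \<le> K \<Longrightarrow> norm (L *\<^sub>R sine_box L y - y) \<le> min 1 (d/2)"
      using sine_box_close[OF K, of "min 1 (d/2)"] d(1) by auto
    have "continuous_on (cbox (vec (-1)) (vec 1 :: real^'n)) (\<lambda>z. f (L *\<^sub>R z))"
      by (rule continuous_on_compose2[OF conjunct1[OF f]]) (auto intro!: continuous_intros)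
    then obtain q where q: "real_polynomial_function q"
      "\<And>z. z \<in> cbox (vec (-1)) (vec 1 :: real^'n) \<Longrightarrow> \<bar>f (L *\<^sub>R z) - q z\<bar> < \<epsilon> / 16"
      by (rule Stone_Weierstrass_real_polynomial_function[OF compact_cbox, where e="\<epsilon> / 16"])
         (use \<epsilon> in simp, rule that)
    define T where "T y = q (sine_box L y)" for y
    have T: "trig_polynomial T" unfolding T_def using trig_polynomial_sine_box[OF q(1)] .
    have inbox: "sine_box L y \<in> cbox (vec (-1)) (vec 1 :: real^'n)" for y
      by (simp add: mem_box_cart sine_box_def)
    have glob: "\<bar>f (L *\<^sub>R sine_box L y) - T y\<bar> < \<epsilon> / 16" for y
      unfolding T_def by (rule q(2)[OF inbox])
    have far0: "\<bar>f y - T y\<bar> \<le> 2 * B + \<epsilon> / 16" for y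
      using glob[of y] B(2)[rule_format, of y] B(2)[rule_format, of "L *\<^sub>R sine_box L y"] by linarith
    have far: "\<bar>f y - T y\<bar> \<le> C" for y using far0 by (simp add: C_def)
    have near: "\<bar>f y - T y\<bar> \<le> \<epsilon> / 8" if y: "norm y \<le> K" for y
    proof -
      have l: "norm (L *\<^sub>R sine_box L y - y) \<le> 1" "norm (L *\<^sub>R sine_box L y - y) \<le> d/2"
        using L(2)[OF y] by auto
      have "norm (L *\<^sub>R sine_box L y) \<le> K + 1"
        using norm_triangle_sub[of "L *\<^sub>R sine_box L y" y] l y by linarith
      then have "dist (f (L *\<^sub>R sine_box L y)) (f y) < \<epsilon> / 16"
        using l y d(1) by (intro d(2)) (auto simp: dist_norm)
      then show ?thesis using glob[of y] unfolding dist_real_def by linarith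
    qed
    obtain BT where BT: "\<forall>y. \<bar>T y\<bar> \<le> BT" using trig_polynomial_bounded[OF T] by blast
    note cT = trig_polynomial_continuous[OF T]
    have fN: "\<bar>N.expectation f - N.expectation T\<bar> \<le> \<epsilon> / 8 + C * N.prob {y. \<not> norm y \<le> K2}"
      by (rule N.expectation_close)
         (use intN[of f B] intN[OF cT BT] f B near far \<epsilon> C'(1) in
           \<open>simp_all add: K_def N(2) spN less_eq_real_def[of 0] not_le\<close>)
    have "\<forall>\<^sub>F t in sequentially. \<bar>expectation (\<lambda>\<omega>. f (X t \<omega>)) - expectation (\<lambda>\<omega>. T (X t \<omega>))\<bar> \<le> \<epsilon> / 8 + C * \<delta>"
      using K1(2)[unfolded all_but_def] eventually_ge_at_top[of 1]
    proof eventually_elim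
      case (elim t)
      then obtain S where S: "S \<in> events" "prob S < \<delta>" "\<forall>\<omega>\<in>space M - S. norm (X t \<omega>) \<le> K1" by blast
      have "\<bar>expectation (\<lambda>\<omega>. f (X t \<omega>)) - expectation (\<lambda>\<omega>. T (X t \<omega>))\<bar> \<le> \<epsilon> / 8 + C * prob S"
      proof (rule expectation_close[OF _ _ S(1) C'(1)])
        show "\<bar>f (X t \<omega>) - T (X t \<omega>)\<bar> \<le> \<epsilon> / 8" if "\<omega> \<in> space M - S" for \<omega>
          using S(3) that by (intro near) (auto simp: K_def le_max_iff_disj)
      qed (use intP[OF elim(2), of f B] intP[OF elim(2) cT BT] f B far \<epsilon> in simp_all)
      also have "\<dots> \<le> \<epsilon> / 8 + C * \<delta>" using S(2) C' by (intro add_left_mono mult_left_mono) auto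
      finally show ?case .
    qed
    moreover have "\<forall>\<^sub>F t in sequentially. \<bar>expectation (\<lambda>\<omega>. T (X t \<omega>)) - N.expectation T\<bar> < \<epsilon> / 8"
      using tendstoD[OF trig[OF T], of "\<epsilon> / 8"] \<epsilon> by (simp add: dist_real_def)
    ultimately show "\<forall>\<^sub>F t in sequentially. dist (expectation (\<lambda>\<omega>. f (X t \<omega>))) (N.expectation f) < \<epsilon>"
    proof eventually_elim
      case (elim t)
      have "C * N.prob {y. \<not> norm y \<le> K2} \<le> C * \<delta>" using K2 C' by (intro mult_left_mono) auto
      then show ?case using elim fN \<epsilon> C\<delta> unfolding dist_real_def by linarith
    qed
  qed
qed

section \<open>Central limit theorems with vanishing remainder\<close>

lemma sin_cos_lipschitz:
  fixes x y :: real
  shows "\<bar>sin x - sin y\<bar> \<le> \<bar>x - y\<bar>" "\<bar>cos x - cos y\<bar> \<le> \<bar>x - y\<bar>"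
proof -
  have d: "\<bar>h x - h y\<bar> \<le> 1 * \<bar>x - y\<bar>"
    if "\<And>z. (h has_field_derivative h' z) (at z)" "\<And>z. \<bar>h' z\<bar> \<le> 1" for h h' :: "real \<Rightarrow> real"
    using field_differentiable_bound[of UNIV h h' 1 x y] that by (auto simp: norm_minus_commute)
  show "\<bar>sin x - sin y\<bar> \<le> \<bar>x - y\<bar>" using d[of sin cos] by (auto intro!: derivative_eq_intros)
  show "\<bar>cos x - cos y\<bar> \<le> \<bar>x - y\<bar>" using d[of cos "\<lambda>z. - sin z"] by (auto intro!: derivative_eq_intros)
qed

lemma (in prob_space) expectation_diff_vanishes:
  fixes X Y :: "nat \<Rightarrow> 'a \<Rightarrow> real" and h :: "real \<Rightarrow> real"
  assumes XY: "\<And>t. t \<ge> 1 \<Longrightarrow> X t \<in> borel_measurable M" "\<And>t. t \<ge> 1 \<Longrightarrow> Y t \<in> borel_measurable M"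
    and close: "\<And>\<epsilon>. 0 < \<epsilon> \<Longrightarrow> whp M (\<lambda>t \<omega>. \<bar>X t \<omega> - Y t \<omega>\<bar> \<le> \<epsilon>)"
    and h: "\<And>x y. \<bar>h x - h y\<bar> \<le> \<bar>x - y\<bar>" "\<And>x. \<bar>h x\<bar> \<le> 1" "h \<in> borel_measurable borel"
  shows "(\<lambda>t. expectation (\<lambda>\<omega>. h (X t \<omega>)) - expectation (\<lambda>\<omega>. h (Y t \<omega>))) \<longlonglongrightarrow> 0"
proof (rule tendstoI)
  fix \<epsilon> :: real assume \<epsilon>: "0 < \<epsilon>"
  then have "all_but M (\<epsilon>/4) (\<lambda>t \<omega>. \<bar>X t \<omega> - Y t \<omega>\<bar> \<le> \<epsilon>/4)"
    using close[of "\<epsilon>/4"] by (intro whpD) auto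
  then show "\<forall>\<^sub>F t in sequentially. dist (expectation (\<lambda>\<omega>. h (X t \<omega>)) - expectation (\<lambda>\<omega>. h (Y t \<omega>))) 0 < \<epsilon>"
    unfolding all_but_def using eventually_ge_at_top[of 1]
  proof eventually_elim
    case (elim t)
    then obtain S where S: "S \<in> events" "prob S < \<epsilon>/4" "\<forall>\<omega>\<in>space M - S. \<bar>X t \<omega> - Y t \<omega>\<bar> \<le> \<epsilon>/4"
      by blast
    have i: "integrable M (\<lambda>\<omega>. h (Z \<omega>))" if "Z \<in> borel_measurable M" for Z
      using measurable_compose[OF that h(3)] h(2) by (intro integrable_const_bound[of _ 1]) auto
    have "\<bar>expectation (\<lambda>\<omega>. h (X t \<omega>)) - expectation (\<lambda>\<omega>. h (Y t \<omega>))\<bar> \<le> \<epsilon>/4 + 2 * prob S"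
    proof (rule expectation_close[OF i[OF XY(1)[OF elim(2)]] i[OF XY(2)[OF elim(2)]] S(1)])
      fix \<omega> assume "\<omega> \<in> space M - S"
      then show "\<bar>h (X t \<omega>) - h (Y t \<omega>)\<bar> \<le> \<epsilon>/4" using S(3) h(1)[of "X t \<omega>" "Y t \<omega>"] by force
    next
      fix \<omega>
      show "\<bar>h (X t \<omega>) - h (Y t \<omega>)\<bar> \<le> 2" using h(2)[of "X t \<omega>"] h(2)[of "Y t \<omega>"] by linarith
    qed (use \<epsilon> in auto)
    then show ?case using S(2) by (simp add: dist_real_def)
  qed
qed

context iid_sample begin

text \<open>
  For positive variance this is the univariate central limit theorem; with zero variance the sum
  vanishes almost surely.
\<close>

lemma fluct_char_limit:
  assumes g [measurable]: "g \<in> borel_measurable Q" and sq: "integrable Q (\<lambda>y. (g y)\<^sup>2)"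
  shows "(\<lambda>t. char (distr P borel (fluct t g)) u)
    \<longlonglongrightarrow> exp (complex_of_real (- (u\<^sup>2 * Q.variance g) / 2))"
proof -
  define V where "V = Q.variance g"
  have ig: "integrable Q g" using Q.square_integrable_imp_integrable[OF g sq] .
  have isq: "integrable Q (\<lambda>y. (g y - Q.expectation g)\<^sup>2)"
    using ig sq by (simp add: power2_diff)
  have V0: "0 \<le> V" by (simp add: V_def)
  show ?thesis
  proof (cases "V = 0")
    case True
    then have "AE y in Q. (g y - Q.expectation g)\<^sup>2 = 0"
      unfolding V_def using isq by (subst (asm) integral_nonneg_eq_0_iff_AE) auto
    then have "AE y in Q. g y - Q.expectation g = 0" by simp
    from sample_AE[OF this] have ae: "AE \<omega> in P. fluct t g \<omega> = 0" for t
      by eventually_elim (simp add: fluct_def)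
    have "char (distr P borel (fluct t g)) u = 1" for t
    proof -
      have "(CLINT \<omega>|P. iexp (u * fluct t g \<omega>)) = (CLINT \<omega>|P. 1)"
        by (rule integral_cong_AE) (use ae[of t] in auto)
      then show ?thesis by (simp add: char_def integral_distr P.prob_space)
    qed
    then show ?thesis using True by (simp add: V_def P.prob_space)
  next
    case False
    define \<sigma> where "\<sigma> = sqrt V"
    have \<sigma>: "0 < \<sigma>" "\<sigma>\<^sup>2 = V" using V0 False by (auto simp: \<sigma>_def)
    define X where "X \<tau> \<omega> = g (\<theta> \<tau> \<omega>) - Q.expectation g" for \<tau> \<omega>
    have EX: "P.expectation (X \<tau>) = 0" for \<tau>
      unfolding X_def using sample_integrable[OF ig] sample_expectation[OF g] by (simp add: P.prob_space)
    have "weak_conv_m (\<lambda>n. distr P borel (\<lambda>\<omega>. (\<Sum>i<n. X i \<omega>) / sqrt (n * \<sigma>\<^sup>2))) std_normal_distribution"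
    proof (rule P.central_limit_theorem_zero_mean[OF _ EX \<sigma>(1)])
      show "P.indep_vars (\<lambda>i. borel) X UNIV"
        unfolding X_def[abs_def] by (rule P.indep_vars_compose2[OF indep]) measurable
      show "integrable P (\<lambda>\<omega>. (X n \<omega>)\<^sup>2)" for n
        unfolding X_def by (rule sample_integrable[OF isq])
      show "P.variance (X n) = \<sigma>\<^sup>2" for n
        unfolding EX \<sigma>(2) V_def X_def by (simp add: sample_expectation[of "\<lambda>y. (g y - Q.expectation g)\<^sup>2"])
      have "distr P borel (X n) = distr (distr P Q (\<theta> n)) borel (\<lambda>y. g y - Q.expectation g)" for n
        by (simp add: distr_distr comp_def X_def[abs_def])
      then show "distr P borel (X n) = distr Q borel (\<lambda>y. g y - Q.expectation g)" for n
        by (simp add: law)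
    qed
    then have "(\<lambda>n. char (distr P borel (\<lambda>\<omega>. (\<Sum>i<n. X i \<omega>) / sqrt (n * \<sigma>\<^sup>2))) (u * \<sigma>))
        \<longlonglongrightarrow> char std_normal_distribution (u * \<sigma>)"
      by (intro levy_continuity1 P.real_distribution_distr real_dist_normal_dist) (simp_all add: X_def)
    also have "char std_normal_distribution (u * \<sigma>) = exp (complex_of_real (- (u\<^sup>2 * V) / 2))"
      by (simp add: char_std_normal_distribution power_mult_distrib \<sigma>(2)[symmetric] flip: exp_of_real)
    finally have lim: "(\<lambda>n. char (distr P borel (\<lambda>\<omega>. (\<Sum>i<n. X i \<omega>) / sqrt (n * \<sigma>\<^sup>2))) (u * \<sigma>))
        \<longlonglongrightarrow> exp (complex_of_real (- (u\<^sup>2 * V) / 2))" .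
    have eqc: "char (distr P borel (\<lambda>\<omega>. (\<Sum>i<n. X i \<omega>) / sqrt (n * \<sigma>\<^sup>2))) (u * \<sigma>)
        = char (distr P borel (fluct n g)) u" for n
    proof -
      have "u * \<sigma> * ((\<Sum>i<n. X i \<omega>) / sqrt (n * \<sigma>\<^sup>2)) = u * fluct n g \<omega>" for \<omega>
        using \<sigma>(1) by (simp add: X_def fluct_def real_sqrt_mult)
      then have eq: "u * \<sigma> * ((\<Sum>i<n. X i \<omega>) / sqrt (n * \<sigma>\<^sup>2)) = u * fluct n g \<omega>" for \<omega> .
      have [measurable]: "X i \<in> borel_measurable P" for i by (simp add: X_def[abs_def])
      have "char (distr P borel (\<lambda>\<omega>. (\<Sum>i<n. X i \<omega>) / sqrt (n * \<sigma>\<^sup>2))) (u * \<sigma>)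
          = (CLINT \<omega>|P. iexp (u * \<sigma> * ((\<Sum>i<n. X i \<omega>) / sqrt (n * \<sigma>\<^sup>2))))"
        unfolding char_def by (rule integral_distr) measurable
      also have "\<dots> = (CLINT \<omega>|P. iexp (u * fluct n g \<omega>))" by (simp only: eq)
      also have "\<dots> = char (distr P borel (fluct n g)) u"
        unfolding char_def by (rule integral_distr[symmetric]) measurable
      finally show ?thesis .
    qed
    show ?thesis using lim unfolding eqc V_def .
  qed
qed

lemma fluct_trig_limit:
  assumes g [measurable]: "g \<in> borel_measurable Q" and sq: "integrable Q (\<lambda>y. (g y)\<^sup>2)"
    and X: "\<And>t. t \<ge> 1 \<Longrightarrow> X t \<in> borel_measurable P"
    and close: "\<And>\<epsilon>. 0 < \<epsilon> \<Longrightarrow> whp P (\<lambda>t \<omega>. \<bar>X t \<omega> - fluct t g \<omega>\<bar> \<le> \<epsilon>)"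
  shows "(\<lambda>t. P.expectation (\<lambda>\<omega>. cos (X t \<omega>))) \<longlonglongrightarrow> exp (- Q.variance g / 2)"
    and "(\<lambda>t. P.expectation (\<lambda>\<omega>. sin (X t \<omega>))) \<longlonglongrightarrow> 0"
proof -
  have int: "complex_integrable P (\<lambda>\<omega>. iexp (fluct t g \<omega>))" for t
    by (intro P.integrable_iexp) auto
  have ch: "char (distr P borel (fluct t g)) 1 = (CLINT \<omega>|P. iexp (fluct t g \<omega>))" for t
    by (simp add: char_def integral_distr)
  have Re: "Re (char (distr P borel (fluct t g)) 1) = P.expectation (\<lambda>\<omega>. cos (fluct t g \<omega>))"
    and Im: "Im (char (distr P borel (fluct t g)) 1) = P.expectation (\<lambda>\<omega>. sin (fluct t g \<omega>))" for t
    unfolding ch using int[of t] by (simp_all add: integral_Re[symmetric] integral_Im[symmetric] Re_exp Im_exp)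
  have lim: "(\<lambda>t. char (distr P borel (fluct t g)) 1) \<longlonglongrightarrow> complex_of_real (exp (- Q.variance g / 2))"
    using fluct_char_limit[OF g sq, of 1] by (simp add: exp_of_real del: of_real_minus of_real_divide)
  have c: "(\<lambda>t. P.expectation (\<lambda>\<omega>. cos (fluct t g \<omega>))) \<longlonglongrightarrow> exp (- Q.variance g / 2)"
    using tendsto_Re[OF lim] by (simp add: Re del: of_real_exp)
  have s: "(\<lambda>t. P.expectation (\<lambda>\<omega>. sin (fluct t g \<omega>))) \<longlonglongrightarrow> 0"
    using tendsto_Im[OF lim] by (simp add: Im del: of_real_exp)
  show "(\<lambda>t. P.expectation (\<lambda>\<omega>. cos (X t \<omega>))) \<longlonglongrightarrow> exp (- Q.variance g / 2)"
    using tendsto_add[OF P.expectation_diff_vanishes[OF X _ close, of cos] c] sin_cos_lipschitz by simp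
  show "(\<lambda>t. P.expectation (\<lambda>\<omega>. sin (X t \<omega>))) \<longlonglongrightarrow> 0"
    using tendsto_add[OF P.expectation_diff_vanishes[OF X _ close, of sin] s] sin_cos_lipschitz by simp
qed

lemma fluct_cmult: "fluct t (\<lambda>y. c * g y) \<omega> = c * fluct t g \<omega>"
  by (simp add: fluct_def sum_distrib_left right_diff_distrib[symmetric] mult.left_commute)

text \<open>
  A remainder that vanishes in probability does not change the limit of the characteristic
  function, because sine and cosine are bounded and Lipschitz (Slutsky's lemma).
\<close>

theorem asymptotically_normal_real:
  assumes g [measurable]: "g \<in> borel_measurable Q" and sq: "integrable Q (\<lambda>y. (g y)\<^sup>2)"
    and X: "\<And>t. X t \<in> borel_measurable P"
    and close: "\<And>\<epsilon>. 0 < \<epsilon> \<Longrightarrow> whp P (\<lambda>t \<omega>. \<bar>X t \<omega> - fluct t g \<omega>\<bar> \<le> \<epsilon>)"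
  shows "weak_conv_m (\<lambda>t. distr P borel (X t)) (normal_law 0 (Q.variance g))"
proof (rule levy_continuity)
  have V0: "0 \<le> Q.variance g" by simp
  show "real_distribution (distr P borel (X t))" for t by (rule P.real_distribution_distr[OF X])
  show "real_distribution (normal_law 0 (Q.variance g))" by (rule real_distribution_normal_law) simp
  fix u :: real
  have clu: "whp P (\<lambda>t \<omega>. \<bar>u * X t \<omega> - fluct t (\<lambda>y. u * g y) \<omega>\<bar> \<le> \<epsilon>)" if "0 < \<epsilon>" for \<epsilon>
    by (rule P.whp_dominated[OF close that, where c="\<bar>u\<bar>"])
       (simp_all add: fluct_cmult right_diff_distrib[symmetric] abs_mult P.whp_always)
  have var: "Q.variance (\<lambda>y. u * g y) = u\<^sup>2 * Q.variance g"
    by (simp add: right_diff_distrib[symmetric] power_mult_distrib)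
  have squ: "integrable Q (\<lambda>y. (u * g y)\<^sup>2)" using sq by (simp add: power_mult_distrib)
  note X [measurable]
  note L = fluct_trig_limit[OF _ squ _ clu, unfolded var, simplified]
  have "char (distr P borel (X t)) u
      = complex_of_real (P.expectation (\<lambda>\<omega>. cos (u * X t \<omega>))) + \<i> * complex_of_real (P.expectation (\<lambda>\<omega>. sin (u * X t \<omega>)))" for t
  proof -
    have "complex_integrable P (\<lambda>\<omega>. iexp (u * X t \<omega>))" by (intro P.integrable_iexp) auto
    then show ?thesis
      by (simp add: char_def integral_distr complex_eq_iff integral_Re[symmetric] integral_Im[symmetric] Re_exp Im_exp)
  qed
  moreover have "(\<lambda>t. complex_of_real (P.expectation (\<lambda>\<omega>. cos (u * X t \<omega>))) + \<i> * complex_of_real (P.expectation (\<lambda>\<omega>. sin (u * X t \<omega>))))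
      \<longlonglongrightarrow> complex_of_real (exp (- (u\<^sup>2 * Q.variance g) / 2)) + \<i> * complex_of_real 0"
    by (intro tendsto_intros fluct_trig_limit[OF _ squ _ clu, unfolded var]) auto
  ultimately show "(\<lambda>t. char (distr P borel (X t)) u) \<longlonglongrightarrow> char (normal_law 0 (Q.variance g)) u"
    by (simp add: char_normal_law[OF V0] del: of_real_exp) (simp add: exp_of_real[symmetric])
qed

definition fluct_vec :: "nat \<Rightarrow> ('t \<Rightarrow> real^'n) \<Rightarrow> 'w \<Rightarrow> real^'n" where
  "fluct_vec t D \<omega> = (\<chi> i. fluct t (\<lambda>y. D y $ i) \<omega>)"

lemma fluct_vec_tight:
  fixes D :: "'t \<Rightarrow> real^'n"
  assumes D: "\<And>i. (\<lambda>y. D y $ i) \<in> borel_measurable Q" "\<And>i. integrable Q (\<lambda>y. (D y $ i)\<^sup>2)"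
  shows "tight P (\<lambda>t. fluct_vec t D)"
  unfolding tight_def
proof (intro allI impI)
  fix \<epsilon> :: real assume \<epsilon>: "0 < \<epsilon>"
  define V where "V = (\<Sum>i\<in>UNIV. Q.expectation (\<lambda>y. (D y $ i)\<^sup>2))"
  have V: "0 \<le> V" by (simp add: V_def sum_nonneg)
  define K where "K = sqrt ((V + 1) / \<epsilon>)"
  have K: "0 < K" "\<epsilon> * K\<^sup>2 = V + 1" using V \<epsilon> by (auto simp: K_def)
  have sq: "(norm (fluct_vec t D \<omega>))\<^sup>2 = (\<Sum>i\<in>UNIV. (fluct t (\<lambda>y. D y $ i) \<omega>)\<^sup>2)" for t \<omega>
    unfolding power2_norm_eq_inner by (simp add: inner_vec_def fluct_vec_def power2_eq_square)
  have norm: "norm (fluct_vec t D \<omega>) = sqrt (\<Sum>i\<in>UNIV. (fluct t (\<lambda>y. D y $ i) \<omega>)\<^sup>2)" for t \<omega>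
    by (simp add: sq[symmetric])
  have "all_but P \<epsilon> (\<lambda>t \<omega>. \<bar>norm (fluct_vec t D \<omega>)\<bar> \<le> K)"
  proof (rule P.whp_chebyshev[where e="\<lambda>_. V"])
    fix t :: nat
    show "(\<lambda>\<omega>. norm (fluct_vec t D \<omega>)) \<in> borel_measurable P"
      unfolding norm using D(1) by simp
    show "integrable P (\<lambda>\<omega>. (norm (fluct_vec t D \<omega>))\<^sup>2)"
      unfolding sq using square_integrable_fluct(1)[OF D] by simp
    show "P.expectation (\<lambda>\<omega>. (norm (fluct_vec t D \<omega>))\<^sup>2) \<le> V"
      unfolding sq V_def using square_integrable_fluct[OF D] by (simp add: sum_mono)
  qed (use K in auto)
  with K show "\<exists>K>0. all_but P \<epsilon> (\<lambda>t \<omega>. norm (fluct_vec t D \<omega>) \<le> K)" by auto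
qed

text \<open>
  All linear functionals of \<open>X\<close> obey the univariate theorem, and their limits are those of the
  normal law with covariance \<open>S\<close>.  Together with tightness this determines the limit law of \<open>X\<close>.
\<close>

theorem asymptotically_normal_vec:
  fixes D :: "'t \<Rightarrow> real^'n" and X :: "nat \<Rightarrow> 'w \<Rightarrow> real^'n"
  assumes D [measurable]: "\<And>i. (\<lambda>y. D y $ i) \<in> borel_measurable Q"
    and sq: "\<And>i. integrable Q (\<lambda>y. (D y $ i)\<^sup>2)"
    and mean: "\<And>i. Q.expectation (\<lambda>y. D y $ i) = 0"
    and X: "\<And>t. t \<ge> 1 \<Longrightarrow> X t \<in> borel_measurable P"
    and close: "\<And>\<epsilon>. 0 < \<epsilon> \<Longrightarrow> whp P (\<lambda>t \<omega>. norm (X t \<omega> - fluct_vec t D \<omega>) \<le> \<epsilon>)"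
    and S: "S = (\<chi> i j. Q.expectation (\<lambda>y. D y $ i * D y $ j))"
  shows "\<exists>N. is_normal_law N 0 S \<and> tendsto_in_law P X N"
proof -
  have prod: "integrable Q (\<lambda>y. D y $ i * D y $ j)" for i j
  proof (rule Bochner_Integration.integrable_bound)
    show "integrable Q (\<lambda>y. (D y $ i)\<^sup>2 + (D y $ j)\<^sup>2)" using sq by simp
    show "AE y in Q. norm (D y $ i * D y $ j) \<le> norm ((D y $ i)\<^sup>2 + (D y $ j)\<^sup>2)"
    proof (intro AE_I2)
      fix y
      have "2 * \<bar>D y $ i * D y $ j\<bar> \<le> (D y $ i)\<^sup>2 + (D y $ j)\<^sup>2"
        using sum_squares_bound[of "\<bar>D y $ i\<bar>" "\<bar>D y $ j\<bar>"] by (simp add: abs_mult mult.assoc)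
      then show "norm (D y $ i * D y $ j) \<le> norm ((D y $ i)\<^sup>2 + (D y $ j)\<^sup>2)" by simp
    qed
  qed measurable
  have int: "integrable Q (\<lambda>y. D y $ i)" for i
    using Q.square_integrable_imp_integrable[OF D sq] .
  have sqa: "(a \<bullet> D y)\<^sup>2 = (\<Sum>i\<in>UNIV. \<Sum>j\<in>UNIV. a $ i * a $ j * (D y $ i * D y $ j))" for a y
    by (simp add: inner_vec_def power2_eq_square sum_product mult.commute mult.left_commute)
  have isqa: "integrable Q (\<lambda>y. (a \<bullet> D y)\<^sup>2)" for a unfolding sqa using prod by simp
  have ma [measurable]: "(\<lambda>y. a \<bullet> D y) \<in> borel_measurable Q" for a
    by (simp add: inner_vec_def)
  have Ea: "Q.expectation (\<lambda>y. a \<bullet> D y) = 0" for a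
    using int by (simp add: inner_vec_def mean)
  have quad: "a \<bullet> (S *v a) = Q.variance (\<lambda>y. a \<bullet> D y)" for a
  proof -
    have "Q.variance (\<lambda>y. a \<bullet> D y) = (\<Sum>i\<in>UNIV. \<Sum>j\<in>UNIV. a $ i * a $ j * Q.expectation (\<lambda>y. D y $ i * D y $ j))"
      unfolding Ea diff_zero sqa using prod by simp
    moreover have "a \<bullet> (S *v a) = (\<Sum>i\<in>UNIV. \<Sum>j\<in>UNIV. a $ i * a $ j * Q.expectation (\<lambda>y. D y $ i * D y $ j))"
      by (simp add: S inner_vec_def matrix_vector_mult_def sum_distrib_left mult_ac)
    ultimately show ?thesis by (simp only:)
  qed
  have symS: "transpose S = S" by (simp add: S transpose_def vec_eq_iff mult.commute)
  obtain N where N: "is_normal_law N 0 S"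
  proof -
    have "\<exists>w :: 'n \<Rightarrow> real^'n. \<forall>a. a \<bullet> (S *v a) = (\<Sum>k\<in>UNIV. (w k \<bullet> a)\<^sup>2)"
      by (rule psd_sum_of_squares[OF symS]) (simp add: quad)
    then obtain w :: "'n \<Rightarrow> real^'n" where "\<And>a. a \<bullet> (S *v a) = (\<Sum>k\<in>UNIV. (w k \<bullet> a)\<^sup>2)"
      by blast
    from normal_law_exists[OF symS this] show thesis using that by blast
  qed
  interpret N: prob_space N using N by (simp add: is_normal_law_def)
  have setsN: "sets N = sets borel" using N by (simp add: is_normal_law_def)
  have mN: "(\<lambda>y. a \<bullet> y) \<in> borel_measurable N" for a :: "real^'n"
    by (subst measurable_cong_sets[OF setsN refl]) measurable
  have charN: "(CLINT y|N. iexp (a \<bullet> y)) = complex_of_real (exp (- Q.variance (\<lambda>y. a \<bullet> D y) / 2))" for a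
  proof -
    have "(CLINT y|N. iexp (a \<bullet> y)) = char (distr N borel (\<lambda>y. a \<bullet> y)) 1"
      unfolding char_def using mN by (subst integral_distr) auto
    also have "\<dots> = exp (complex_of_real (- (1\<^sup>2 * Q.variance (\<lambda>y. a \<bullet> D y)) / 2))"
      using N by (simp only: is_normal_law_def inner_zero_right quad)
        (rule char_normal_law, simp)
    finally show ?thesis by (simp only: exp_of_real) simp
  qed
  have intN: "complex_integrable N (\<lambda>y. iexp (a \<bullet> y))" for a :: "real^'n"
    using mN by (intro N.integrable_iexp) auto
  have cosN: "N.expectation (\<lambda>y. cos (a \<bullet> y)) = exp (- Q.variance (\<lambda>y. a \<bullet> D y) / 2)"
    and sinN: "N.expectation (\<lambda>y. sin (a \<bullet> y)) = 0" for a
    using arg_cong[OF charN[of a], of Re] arg_cong[OF charN[of a], of Im] intN[of a]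
    by (simp_all add: integral_Re[symmetric] integral_Im[symmetric] Re_exp Im_exp del: of_real_exp)
  have fl: "a \<bullet> fluct_vec t D \<omega> = fluct t (\<lambda>y. a \<bullet> D y) \<omega>" for a t \<omega>
    unfolding fluct_vec_def fluct_def Ea mean diff_zero
    by (simp add: inner_vec_def sum_distrib_left sum_divide_distrib) (rule sum.swap)
  have cla: "whp P (\<lambda>t \<omega>. \<bar>a \<bullet> X t \<omega> - fluct t (\<lambda>y. a \<bullet> D y) \<omega>\<bar> \<le> \<epsilon>)" if "0 < \<epsilon>" for a \<epsilon>
  proof (rule P.whp_dominated[where Y="\<lambda>t \<omega>. norm (X t \<omega> - fluct_vec t D \<omega>)", OF _ that, where c="norm a"])
    show "whp P (\<lambda>t \<omega>. \<bar>a \<bullet> X t \<omega> - fluct t (\<lambda>y. a \<bullet> D y) \<omega>\<bar> \<le> norm a * \<bar>norm (X t \<omega> - fluct_vec t D \<omega>)\<bar>)"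
      unfolding fl[symmetric] inner_diff_right[symmetric]
      by (rule P.whp_always) (simp add: Cauchy_Schwarz_ineq2)
  qed (use close in simp)
  have Xa: "(\<lambda>\<omega>. a \<bullet> X t \<omega>) \<in> borel_measurable P" if "t \<ge> 1" for a t
    using X[OF that] by simp
  have tightX: "tight P X"
    unfolding tight_def
  proof (intro allI impI)
    fix \<epsilon> :: real assume \<epsilon>: "0 < \<epsilon>"
    then obtain K where K: "0 < K" "all_but P (\<epsilon>/2) (\<lambda>t \<omega>. norm (fluct_vec t D \<omega>) \<le> K)"
      using fluct_vec_tight[OF D sq] unfolding tight_def by (meson half_gt_zero)
    have "all_but P (\<epsilon>/2 + \<epsilon>/2) (\<lambda>t \<omega>. norm (fluct_vec t D \<omega>) \<le> K \<and> norm (X t \<omega> - fluct_vec t D \<omega>) \<le> 1)"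
      using \<epsilon> by (intro P.all_but_conj K whpD close) auto
    then have "all_but P \<epsilon> (\<lambda>t \<omega>. norm (X t \<omega>) \<le> K + 1)"
    proof (simp, elim all_but_mono, intro always_eventually allI ballI impI)
      fix t \<omega> assume "norm (fluct_vec t D \<omega>) \<le> K \<and> norm (X t \<omega> - fluct_vec t D \<omega>) \<le> 1"
      then show "norm (X t \<omega>) \<le> K + 1" using norm_triangle_sub[of "X t \<omega>" "fluct_vec t D \<omega>"] by linarith
    qed
    with K show "\<exists>K>0. all_but P \<epsilon> (\<lambda>t \<omega>. norm (X t \<omega>) \<le> K)" by (intro exI[of _ "K+1"]) auto
  qed
  have "tendsto_in_law P X N"
  proof (rule P.tendsto_in_law_of_char[OF X N.prob_space_axioms setsN tightX])
    fix a
    show "(\<lambda>t. P.expectation (\<lambda>\<omega>. cos (a \<bullet> X t \<omega>))) \<longlonglongrightarrow> N.expectation (\<lambda>y. cos (a \<bullet> y))"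
      unfolding cosN by (rule fluct_trig_limit[OF ma isqa Xa cla])
    show "(\<lambda>t. P.expectation (\<lambda>\<omega>. sin (a \<bullet> X t \<omega>))) \<longlonglongrightarrow> N.expectation (\<lambda>y. sin (a \<bullet> y))"
      unfolding sinN by (rule fluct_trig_limit[OF ma isqa Xa cla])
  qed
  with N show ?thesis by blast
qed

end

section \<open>Top bids, subgradients and equilibrium conditions\<close>

lemma bid_le_top_bid: "\<beta> $ i * v i \<theta> \<le> top_bid v \<beta> \<theta>"
  unfolding top_bid_def by (rule Max_ge) auto

lemma top_bid_le_iff: "top_bid v \<beta> \<theta> \<le> c \<longleftrightarrow> (\<forall>i. \<beta> $ i * v i \<theta> \<le> c)"
  unfolding top_bid_def by (subst Max_le_iff) auto

lemma top_bid_attained: "\<exists>i. \<beta> $ i * v i \<theta> = top_bid v \<beta> \<theta>"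
proof -
  have "Max (range (\<lambda>i. \<beta> $ i * v i \<theta>)) \<in> range (\<lambda>i. \<beta> $ i * v i \<theta>)"
    by (rule Max_in) auto
  then show ?thesis unfolding top_bid_def by force
qed

lemma top_bid_nonneg: "0 \<le> \<beta> $ i \<Longrightarrow> 0 \<le> v i \<theta> \<Longrightarrow> 0 \<le> top_bid v \<beta> \<theta>"
  using bid_le_top_bid[of \<beta> i v \<theta>] by (meson mult_nonneg_nonneg order_trans)

lemma top_bid_lipschitz:
  assumes "\<And>i. 0 \<le> v i \<theta>" "\<And>i. v i \<theta> \<le> C"
  shows "\<bar>top_bid v z \<theta> - top_bid v y \<theta>\<bar> \<le> C * norm (z - y)"
proof -
  have le: "top_bid v z \<theta> \<le> top_bid v y \<theta> + C * norm (z - y)" for z y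
    unfolding top_bid_le_iff
  proof
    fix i
    have "\<bar>(z - y) $ i\<bar> * v i \<theta> \<le> norm (z - y) * C"
      using assms component_le_norm_cart[of "z - y" i] by (intro mult_mono) auto
    moreover have "(z - y) $ i * v i \<theta> \<le> \<bar>(z - y) $ i\<bar> * v i \<theta>"
      using assms by (intro mult_right_mono) auto
    ultimately have "z $ i * v i \<theta> \<le> y $ i * v i \<theta> + C * norm (z - y)"
      by (simp add: algebra_simps)
    then show "z $ i * v i \<theta> \<le> top_bid v y \<theta> + C * norm (z - y)"
      using bid_le_top_bid[of y i v \<theta>] by linarith
  qed
  show ?thesis using le[of z y] le[of y z] by (simp add: norm_minus_commute abs_le_iff)
qed

text \<open>
  An allocation \<open>w\<close> of one item that the equilibrium conditions allow at multipliers \<open>\<beta>\<close>.  The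
  vector with entries \<open>w i * v i \<theta>\<close> is then a subgradient of the top bid with respect to the
  multipliers; this is the only way in which allocations enter the asymptotics.
\<close>

definition supports ::
  "('n::finite \<Rightarrow> 't \<Rightarrow> real) \<Rightarrow> real^'n \<Rightarrow> 't \<Rightarrow> ('n \<Rightarrow> real) \<Rightarrow> bool" where
  "supports v \<beta> \<theta> w \<longleftrightarrow> (\<forall>i. 0 \<le> w i) \<and> (\<Sum>i\<in>UNIV. w i) \<le> 1 \<and>
     (\<forall>i. w i > 0 \<longrightarrow> \<beta> $ i * v i \<theta> = top_bid v \<beta> \<theta>) \<and>
     (top_bid v \<beta> \<theta> > 0 \<longrightarrow> (\<Sum>i\<in>UNIV. w i) = 1)"

lemma supports_subgradient:
  assumes w: "supports v \<beta> \<theta> w" and v: "\<And>i. 0 \<le> v i \<theta>"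
    and \<beta>: "\<And>i. 0 \<le> \<beta> $ i" and z: "\<And>i. 0 \<le> z $ i"
  shows "top_bid v \<beta> \<theta> + (\<chi> i. w i * v i \<theta>) \<bullet> (z - \<beta>) \<le> top_bid v z \<theta>"
proof -
  note W = w[unfolded supports_def]
  have t0: "0 \<le> top_bid v \<beta> \<theta>" "0 \<le> top_bid v z \<theta>"
    (* any buyer will do *)
    using top_bid_nonneg[where v=v and \<theta>=\<theta>, OF \<beta>[of undefined] v] top_bid_nonneg[where v=v and \<theta>=\<theta>, OF z[of undefined] v] by auto
  have "(\<Sum>i\<in>UNIV. w i * (z $ i * v i \<theta>)) \<le> (\<Sum>i\<in>UNIV. w i * top_bid v z \<theta>)"
    using W by (intro sum_mono mult_left_mono bid_le_top_bid) auto
  also have "\<dots> = (\<Sum>i\<in>UNIV. w i) * top_bid v z \<theta>" by (simp add: sum_distrib_right)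
  also have "\<dots> \<le> 1 * top_bid v z \<theta>" using W t0 by (intro mult_right_mono) auto
  finally have 1: "(\<Sum>i\<in>UNIV. w i * (z $ i * v i \<theta>)) \<le> top_bid v z \<theta>" by simp
  have "(\<Sum>i\<in>UNIV. w i * (\<beta> $ i * v i \<theta>)) = (\<Sum>i\<in>UNIV. w i * top_bid v \<beta> \<theta>)"
    using W by (intro sum.cong refl) (metis mult_eq_0_iff order_le_less)
  also have "\<dots> = (\<Sum>i\<in>UNIV. w i) * top_bid v \<beta> \<theta>" by (simp add: sum_distrib_right)
  also have "\<dots> = top_bid v \<beta> \<theta>" using W t0 by (cases "top_bid v \<beta> \<theta> = 0") auto
  finally have 2: "(\<Sum>i\<in>UNIV. w i * (\<beta> $ i * v i \<theta>)) = top_bid v \<beta> \<theta>" .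
  have "(\<chi> i. w i * v i \<theta>) \<bullet> (z - \<beta>)
      = (\<Sum>i\<in>UNIV. w i * (z $ i * v i \<theta>)) - (\<Sum>i\<in>UNIV. w i * (\<beta> $ i * v i \<theta>))"
    unfolding sum_subtractf[symmetric] by (simp add: inner_vec_def algebra_simps)
  then show ?thesis using 1 2 by linarith
qed

lemma supports_weight_le: "supports v \<beta> \<theta> w \<Longrightarrow> w i \<le> 1"
  unfolding supports_def using member_le_sum[of i UNIV w] by fastforce

text \<open>
  Sharing the item equally among the highest bidders is a measurable choice of such an allocation
  at arbitrary multipliers.
\<close>

definition argmax_share :: "('n::finite \<Rightarrow> 't \<Rightarrow> real) \<Rightarrow> real^'n \<Rightarrow> 't \<Rightarrow> 'n \<Rightarrow> real" where
  "argmax_share v \<beta> \<theta> i =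
     (if \<beta> $ i * v i \<theta> = top_bid v \<beta> \<theta> then 1 else 0) /
     (\<Sum>j\<in>UNIV. if \<beta> $ j * v j \<theta> = top_bid v \<beta> \<theta> then 1 else 0)"

lemma supports_argmax_share: "supports v \<beta> \<theta> (argmax_share v \<beta> \<theta>)"
proof -
  let ?I = "\<lambda>j. if \<beta> $ j * v j \<theta> = top_bid v \<beta> \<theta> then 1 else 0 :: real"
  obtain k where "\<beta> $ k * v k \<theta> = top_bid v \<beta> \<theta>" using top_bid_attained[of \<beta> v \<theta>] by auto
  then have "?I k = 1" by simp
  moreover have "?I k \<le> (\<Sum>j\<in>UNIV. ?I j)" by (rule member_le_sum) auto
  ultimately have pos: "0 < (\<Sum>j\<in>UNIV. ?I j)" by linarith
  then have "(\<Sum>i\<in>UNIV. argmax_share v \<beta> \<theta> i) = 1"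
    unfolding argmax_share_def sum_divide_distrib[symmetric] by simp
  moreover have "0 \<le> argmax_share v \<beta> \<theta> i" for i
    unfolding argmax_share_def using pos by (intro divide_nonneg_pos) auto
  ultimately show ?thesis
    unfolding supports_def by (auto simp: argmax_share_def split: if_splits)
qed

text \<open>
  Subgradients \<open>\<xi>\<close> at a nearby point and \<open>\<mu>\<close> at \<open>\<beta>\<close> differ at most by the second difference
  of \<open>F\<close> at \<open>\<beta>\<close>: bound the \<open>i\<close>-th entry of one from above by a forward and of the other
  from below by a backward step of length \<open>\<epsilon>\<close>, and move the base point by Lipschitz continuity.
  Averaged over items, differentiability of the expected top bid makes the right-hand side small
  compared with \<open>\<epsilon>\<close>, although individual items may have ties.
\<close>

lemma subgradient_deviation:
  fixes F :: "real^'n \<Rightarrow> real"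
  assumes \<xi>: "\<And>z. (\<forall>i. 0 \<le> z $ i) \<Longrightarrow> F y + \<xi> \<bullet> (z - y) \<le> F z"
    and \<mu>: "\<And>z. (\<forall>i. 0 \<le> z $ i) \<Longrightarrow> F \<beta> + \<mu> \<bullet> (z - \<beta>) \<le> F z"
    and lip: "\<And>z z'. \<bar>F z - F z'\<bar> \<le> C * norm (z - z')"
    and \<epsilon>: "0 < \<epsilon>" "\<And>i. \<epsilon> \<le> y $ i" "\<And>i. \<epsilon> \<le> \<beta> $ i"
  shows "\<bar>\<xi> $ i - \<mu> $ i\<bar> * \<epsilon>
    \<le> F (\<beta> + \<epsilon> *\<^sub>R axis i 1) + F (\<beta> - \<epsilon> *\<^sub>R axis i 1) - 2 * F \<beta> + 2 * C * norm (y - \<beta>)"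
proof -
  have nn: "0 \<le> (u + \<epsilon> *\<^sub>R axis i 1) $ j \<and> 0 \<le> (u - \<epsilon> *\<^sub>R axis i 1) $ j"
    if "\<And>i. \<epsilon> \<le> u $ i" for u j
    using that[of j] \<epsilon>(1) by (auto simp: axis_def)
  have a: "\<xi> $ i * \<epsilon> \<le> F (y + \<epsilon> *\<^sub>R axis i 1) - F y" "- (\<xi> $ i * \<epsilon>) \<le> F (y - \<epsilon> *\<^sub>R axis i 1) - F y"
    using \<xi>[of "y + \<epsilon> *\<^sub>R axis i 1"] \<xi>[of "y - \<epsilon> *\<^sub>R axis i 1"] nn[OF \<epsilon>(2)]
    by (auto simp: inner_axis mult.commute)
  have b: "\<mu> $ i * \<epsilon> \<le> F (\<beta> + \<epsilon> *\<^sub>R axis i 1) - F \<beta>" "- (\<mu> $ i * \<epsilon>) \<le> F (\<beta> - \<epsilon> *\<^sub>R axis i 1) - F \<beta>"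
    using \<mu>[of "\<beta> + \<epsilon> *\<^sub>R axis i 1"] \<mu>[of "\<beta> - \<epsilon> *\<^sub>R axis i 1"] nn[OF \<epsilon>(3)]
    by (auto simp: inner_axis mult.commute)
  have c: "\<bar>F (y + e) - F (\<beta> + e)\<bar> \<le> C * norm (y - \<beta>)" for e
    using lip[of "y + e" "\<beta> + e"] by simp
  have "\<bar>\<xi> $ i - \<mu> $ i\<bar> * \<epsilon> = \<bar>\<xi> $ i * \<epsilon> - \<mu> $ i * \<epsilon>\<bar>"
    using \<epsilon>(1) by (simp add: abs_mult left_diff_distrib[symmetric])
  then show ?thesis
    using a b c[of 0] c[of "\<epsilon> *\<^sub>R axis i 1"] c[of "- \<epsilon> *\<^sub>R axis i 1"] by (simp add: abs_le_iff)
qed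

text \<open>
  The budget conditions, in terms of the item utilities \<open>m\<close>: these are the first-order conditions
  for minimising \<open>F - (\<Sum>i. b i ln \<beta> i)\<close> over the box, when \<open>m\<close> is a subgradient of \<open>F\<close> at
  \<open>\<beta>\<close>.
\<close>

definition kkt :: "real^'n \<Rightarrow> real^'n \<Rightarrow> real^'n \<Rightarrow> bool" where
  "kkt b \<beta> m \<longleftrightarrow> (\<forall>i. 0 < \<beta> $ i \<and> \<beta> $ i \<le> 1 \<and> m $ i \<le> b $ i / \<beta> $ i \<and>
     (\<beta> $ i < 1 \<longrightarrow> m $ i = b $ i / \<beta> $ i))"

lemma kkt_of_spend:
  assumes "\<And>i. 0 < b $ i" "\<And>i. 0 \<le> \<beta> $ i \<and> \<beta> $ i \<le> 1"
    and "\<And>i. \<beta> $ i * m $ i \<le> b $ i" "\<And>i. \<beta> $ i * m $ i < b $ i \<Longrightarrow> \<beta> $ i = 1"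
  shows "kkt b \<beta> m"
  unfolding kkt_def
proof
  fix i
  have "\<beta> $ i \<noteq> 0" using assms(4)[of i] assms(1)[of i] by auto
  then have pos: "0 < \<beta> $ i" using assms(2)[of i] by simp
  then show "0 < \<beta> $ i \<and> \<beta> $ i \<le> 1 \<and> m $ i \<le> b $ i / \<beta> $ i \<and> (\<beta> $ i < 1 \<longrightarrow> m $ i = b $ i / \<beta> $ i)"
    using assms(2-4)[of i]
  proof (intro conjI impI)
    assume "\<beta> $ i < 1"
    then have "b $ i \<le> \<beta> $ i * m $ i" using assms(4)[of i] by linarith
    then show "m $ i = b $ i / \<beta> $ i" using assms(3)[of i] pos by (simp add: field_simps)
  qed (auto simp: field_simps)
qed

lemma reciprocal_strongly_decreasing:
  fixes y z c :: real
  assumes "0 < y" "y \<le> 1" "0 < z" "z \<le> 1" "0 \<le> c"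
  shows "(c / y - c / z) * (y - z) \<le> - c * (y - z)\<^sup>2"
proof -
  have "(c / y - c / z) * (y - z) = - (c * (y - z)\<^sup>2) / (y * z)"
    using assms by (simp add: field_simps power2_eq_square)
  also have "\<dots> \<le> - (c * (y - z)\<^sup>2) / 1"
    using assms mult_le_one[of y z] by (simp add: pos_le_divide_eq mult_left_le)
  finally show ?thesis by simp
qed

text \<open>
  The marginal value \<open>b / \<beta>\<close> is strongly decreasing in \<open>\<beta>\<close> on the unit interval, and the
  slackness in the conditions has the favourable sign at the upper end.  The comparison point
  \<open>\<beta>\<^sub>0\<close> is arbitrary: \<open>r\<close> collects its residuals in the first-order conditions, and may be
  taken zero in a coordinate at its bound whose item utility does not exceed the budget.
\<close>

lemma kkt_strongly_monotone:
  assumes k: "kkt b \<beta>\<^sub>1 m\<^sub>1" and c: "\<And>i. c \<le> b $ i" "0 < c"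
    and \<beta>0: "\<And>i. 0 < \<beta>\<^sub>0 $ i \<and> \<beta>\<^sub>0 $ i \<le> 1"
    and r: "\<And>i. r $ i = b $ i / \<beta>\<^sub>0 $ i - m\<^sub>0 $ i \<or> \<beta>\<^sub>0 $ i = 1 \<and> m\<^sub>0 $ i \<le> b $ i \<and> r $ i = 0"
  shows "(m\<^sub>1 - m\<^sub>0) \<bullet> (\<beta>\<^sub>1 - \<beta>\<^sub>0) \<le> r \<bullet> (\<beta>\<^sub>1 - \<beta>\<^sub>0) - c * (norm (\<beta>\<^sub>1 - \<beta>\<^sub>0))\<^sup>2"
proof -
  have "(m\<^sub>1 $ i - m\<^sub>0 $ i) * (\<beta>\<^sub>1 $ i - \<beta>\<^sub>0 $ i) \<le>
      r $ i * (\<beta>\<^sub>1 $ i - \<beta>\<^sub>0 $ i) - c * (\<beta>\<^sub>1 $ i - \<beta>\<^sub>0 $ i)\<^sup>2" for i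
  proof -
    define d where "d = \<beta>\<^sub>1 $ i - \<beta>\<^sub>0 $ i"
    have \<beta>1: "0 < \<beta>\<^sub>1 $ i" "\<beta>\<^sub>1 $ i \<le> 1" "m\<^sub>1 $ i \<le> b $ i / \<beta>\<^sub>1 $ i"
      "\<beta>\<^sub>1 $ i < 1 \<Longrightarrow> m\<^sub>1 $ i = b $ i / \<beta>\<^sub>1 $ i" using k unfolding kkt_def by auto
    have "(b $ i / \<beta>\<^sub>1 $ i - b $ i / \<beta>\<^sub>0 $ i) * d \<le> - b $ i * d\<^sup>2"
      unfolding d_def using \<beta>1 \<beta>0[of i] c(1)[of i] c(2) by (intro reciprocal_strongly_decreasing) auto
    also have "\<dots> \<le> - c * d\<^sup>2" using c(1)[of i] by (intro mult_right_mono) auto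
    finally have A: "(b $ i / \<beta>\<^sub>1 $ i - b $ i / \<beta>\<^sub>0 $ i) * d \<le> - c * d\<^sup>2" .
    have B: "(m\<^sub>1 $ i - b $ i / \<beta>\<^sub>1 $ i) * d \<le> 0"
    proof (cases "\<beta>\<^sub>1 $ i < 1")
      case False
      then have "0 \<le> d" using \<beta>1 \<beta>0[of i] by (simp add: d_def)
      then show ?thesis using \<beta>1 by (intro mult_nonpos_nonneg) auto
    qed (use \<beta>1 in simp)
    have R: "(b $ i / \<beta>\<^sub>0 $ i - m\<^sub>0 $ i) * d \<le> r $ i * d"
      using r[of i]
    proof
      assume 1: "\<beta>\<^sub>0 $ i = 1 \<and> m\<^sub>0 $ i \<le> b $ i \<and> r $ i = 0"
      then have "d \<le> 0" using \<beta>1 by (simp add: d_def)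
      then show ?thesis using 1 by (auto intro: mult_nonneg_nonpos)
    qed simp
    show ?thesis using A B R unfolding d_def[symmetric] by (simp add: left_diff_distrib)
  qed
  then have "(\<Sum>i\<in>UNIV. (m\<^sub>1 $ i - m\<^sub>0 $ i) * (\<beta>\<^sub>1 $ i - \<beta>\<^sub>0 $ i)) \<le>
      (\<Sum>i\<in>UNIV. r $ i * (\<beta>\<^sub>1 $ i - \<beta>\<^sub>0 $ i) - c * (\<beta>\<^sub>1 $ i - \<beta>\<^sub>0 $ i)\<^sup>2)"
    by (intro sum_mono)
  then show ?thesis
    unfolding power2_norm_eq_inner
    by (simp add: inner_vec_def sum_subtractf sum_distrib_left power2_eq_square)
qed

lemma norm_le_of_quadratic_bound:
  fixes h r :: "'a::real_inner"
  assumes "c * (norm h)\<^sup>2 \<le> r \<bullet> h" "0 < c"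
  shows "norm h \<le> norm r / c"
proof -
  have "(c * norm h) * norm h \<le> norm r * norm h"
    using assms(1) norm_cauchy_schwarz[of r h] by (simp add: power2_eq_square mult.assoc)
  then have "c * norm h \<le> norm r"
    by (cases "norm h = 0") (auto dest: mult_right_le_imp_le)
  then show ?thesis using assms(2) by (simp add: field_simps)
qed

text \<open>
  The distance between two points is bounded by residuals alone: monotonicity of the subgradients
  and strong monotonicity of the budget conditions pull in opposite directions.
\<close>

lemma kkt_distance:
  assumes k: "kkt b \<beta>\<^sub>1 m\<^sub>1" and c: "\<And>i. c \<le> b $ i" "0 < c"
    and \<beta>0: "\<And>i. 0 < \<beta>\<^sub>0 $ i \<and> \<beta>\<^sub>0 $ i \<le> 1"
    and r: "\<And>i. r $ i = b $ i / \<beta>\<^sub>0 $ i - m\<^sub>0 $ i \<or> \<beta>\<^sub>0 $ i = 1 \<and> m\<^sub>0 $ i \<le> b $ i \<and> r $ i = 0"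
    and mono: "0 \<le> (m\<^sub>1 - m\<^sub>0) \<bullet> (\<beta>\<^sub>1 - \<beta>\<^sub>0)"
  shows "norm (\<beta>\<^sub>1 - \<beta>\<^sub>0) \<le> norm r / c"
  using kkt_strongly_monotone[OF k c \<beta>0 r] mono c(2) by (intro norm_le_of_quadratic_bound) auto

lemma kkt_compare:
  fixes b :: "real^'a"
  assumes k: "kkt b \<beta>\<^sub>1 m\<^sub>1" "kkt b \<beta>\<^sub>0 \<mu>" and c: "\<And>i. c \<le> b $ i" "0 < c"
  shows "(m\<^sub>1 - m\<^sub>0) \<bullet> (\<beta>\<^sub>1 - \<beta>\<^sub>0) \<le> (\<mu> - m\<^sub>0) \<bullet> (\<beta>\<^sub>1 - \<beta>\<^sub>0) - c * (norm (\<beta>\<^sub>1 - \<beta>\<^sub>0))\<^sup>2"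
proof -
  have "(m\<^sub>1 - \<mu>) \<bullet> (\<beta>\<^sub>1 - \<beta>\<^sub>0) \<le> 0 \<bullet> (\<beta>\<^sub>1 - \<beta>\<^sub>0) - c * (norm (\<beta>\<^sub>1 - \<beta>\<^sub>0))\<^sup>2"
  proof (rule kkt_strongly_monotone[OF k(1) c])
    fix i
    have "0 < \<beta>\<^sub>0 $ i \<and> \<beta>\<^sub>0 $ i \<le> 1 \<and> \<mu> $ i \<le> b $ i / \<beta>\<^sub>0 $ i \<and> (\<beta>\<^sub>0 $ i < 1 \<longrightarrow> \<mu> $ i = b $ i / \<beta>\<^sub>0 $ i)"
      using k(2) unfolding kkt_def by blast
    then show "0 < \<beta>\<^sub>0 $ i \<and> \<beta>\<^sub>0 $ i \<le> 1"
      and "(0 :: real^'a) $ i = b $ i / \<beta>\<^sub>0 $ i - \<mu> $ i \<or> \<beta>\<^sub>0 $ i = 1 \<and> \<mu> $ i \<le> b $ i \<and> (0 :: real^'a) $ i = 0"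
      by (cases "\<beta>\<^sub>0 $ i < 1"; force)+
  qed
  moreover have "m\<^sub>1 - m\<^sub>0 = (m\<^sub>1 - \<mu>) + (\<mu> - m\<^sub>0)" by simp
  ultimately show ?thesis by (simp only: inner_add_left) simp
qed

lemma kkt_compare_distance:
  assumes k: "kkt b \<beta>\<^sub>1 m\<^sub>1" "kkt b \<beta>\<^sub>0 \<mu>" and c: "\<And>i. c \<le> b $ i" "0 < c"
    and mono: "0 \<le> (m\<^sub>1 - m\<^sub>0) \<bullet> (\<beta>\<^sub>1 - \<beta>\<^sub>0)"
  shows "norm (\<beta>\<^sub>1 - \<beta>\<^sub>0) \<le> norm (\<mu> - m\<^sub>0) / c"
  using kkt_compare[OF k c, of m\<^sub>0] mono c(2) by (intro norm_le_of_quadratic_bound) auto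

text \<open>
  The second derivative of the logarithm is at most \<open>-1\<close> on the unit interval.
\<close>

lemma ln_strongly_concave:
  fixes y z :: real
  assumes "0 < y" "y \<le> 1" "0 < z" "z \<le> 1"
  shows "ln z - ln y \<le> (z - y) / y - (z - y)\<^sup>2 / 2"
proof -
  define \<phi> where "\<phi> u = ln u - u / y + (u - y)\<^sup>2 / 2" for u
  have der: "(\<phi> has_field_derivative ((y - u) * (1 / (u * y) - 1))) (at u)" if "0 < u" for u
    unfolding \<phi>_def using that assms
    by (auto intro!: derivative_eq_intros simp: field_simps)
  have ge1: "0 \<le> 1 / (u * y) - 1" if "0 < u" "u \<le> 1" for u
    using that assms mult_le_one[of u y] by (simp add: field_simps)
  have "\<phi> z \<le> \<phi> y"
  proof (cases "z \<le> y")
    case True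
    show ?thesis
    proof (rule DERIV_nonneg_imp_nondecreasing[OF True])
      fix u assume "z \<le> u" "u \<le> y"
      then show "\<exists>D. DERIV \<phi> u :> D \<and> 0 \<le> D"
        using der[of u] ge1[of u] assms by (intro exI[of _ "(y - u) * (1 / (u * y) - 1)"]) auto
    qed
  next
    case False
    then have "y \<le> z" by simp
    then show ?thesis
    proof (rule DERIV_nonpos_imp_nonincreasing)
      fix u assume "y \<le> u" "u \<le> z"
      then show "\<exists>D. DERIV \<phi> u :> D \<and> D \<le> 0"
        using der[of u] ge1[of u] assms
        by (intro exI[of _ "(y - u) * (1 / (u * y) - 1)"]) (auto intro: mult_nonpos_nonneg)
    qed
  qed
  then show ?thesis using assms by (simp add: \<phi>_def diff_divide_distrib)
qed

text \<open>
  Added to the subgradient inequality of the revenue, this shows that the dual objective grows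
  quadratically around equilibrium multipliers, which are therefore its unique minimiser.
\<close>

lemma dual_gap:
  assumes k: "kkt b \<beta> m" and c: "\<And>i. c \<le> b $ i" "0 < c" and z: "\<And>i. 0 < z $ i \<and> z $ i \<le> 1"
  shows "(c / 2) * (norm (z - \<beta>))\<^sup>2 \<le>
    m \<bullet> (z - \<beta>) - ((\<Sum>i\<in>UNIV. b $ i * ln (z $ i)) - (\<Sum>i\<in>UNIV. b $ i * ln (\<beta> $ i)))"
proof -
  have "(c / 2) * (z $ i - \<beta> $ i)\<^sup>2 \<le>
      m $ i * (z $ i - \<beta> $ i) - (b $ i * ln (z $ i) - b $ i * ln (\<beta> $ i))" for i
  proof -
    have \<beta>: "0 < \<beta> $ i" "\<beta> $ i \<le> 1" "m $ i \<le> b $ i / \<beta> $ i" "\<beta> $ i < 1 \<Longrightarrow> m $ i = b $ i / \<beta> $ i"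
      using k unfolding kkt_def by auto
    have b: "0 < b $ i" using c(1)[of i] c(2) by linarith
    have "(b $ i / \<beta> $ i) * (z $ i - \<beta> $ i) \<le> m $ i * (z $ i - \<beta> $ i)"
    proof (cases "\<beta> $ i < 1")
      case False
      then have "z $ i - \<beta> $ i \<le> 0" using z[of i] by simp
      then show ?thesis using \<beta>(3) by (rule mult_right_mono_neg[rotated])
    qed (use \<beta> in simp)
    moreover have "b $ i * (ln (z $ i) - ln (\<beta> $ i)) \<le> b $ i * ((z $ i - \<beta> $ i) / \<beta> $ i - (z $ i - \<beta> $ i)\<^sup>2 / 2)"
      using \<beta> z[of i] b by (intro mult_left_mono ln_strongly_concave) auto
    moreover have "(c / 2) * (z $ i - \<beta> $ i)\<^sup>2 \<le> (b $ i / 2) * (z $ i - \<beta> $ i)\<^sup>2"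
      using c(1)[of i] by (intro mult_right_mono) auto
    moreover have "b $ i * ((z $ i - \<beta> $ i) / \<beta> $ i - (z $ i - \<beta> $ i)\<^sup>2 / 2)
        = (b $ i / \<beta> $ i) * (z $ i - \<beta> $ i) - (b $ i / 2) * (z $ i - \<beta> $ i)\<^sup>2"
      by (simp add: right_diff_distrib[of "b $ i"])
    moreover have "b $ i * (ln (z $ i) - ln (\<beta> $ i)) = b $ i * ln (z $ i) - b $ i * ln (\<beta> $ i)"
      by (rule right_diff_distrib)
    ultimately show ?thesis by linarith
  qed
  then have "(\<Sum>i\<in>UNIV. (c / 2) * (z $ i - \<beta> $ i)\<^sup>2) \<le>
      (\<Sum>i\<in>UNIV. m $ i * (z $ i - \<beta> $ i) - (b $ i * ln (z $ i) - b $ i * ln (\<beta> $ i)))"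
    by (intro sum_mono)
  then show ?thesis
    unfolding power2_norm_eq_inner
    by (simp add: inner_vec_def sum_subtractf sum_distrib_left power2_eq_square)
qed

text \<open>
  A minimiser with quadratic growth is the limit of approximate minimisers taken from a countable
  dense set, each chosen as the first in an enumeration and hence measurable.
\<close>

lemma measurable_strict_minimiser:
  fixes F :: "'w \<Rightarrow> 'a::{second_countable_topology, metric_space} \<Rightarrow> real" and d :: "nat \<Rightarrow> 'a"
  assumes meas: "\<And>j. (\<lambda>\<omega>. F \<omega> (d j)) \<in> borel_measurable P"
    and gap: "\<And>\<omega> j. \<omega> \<in> space P \<Longrightarrow> \<kappa> * (dist (d j) (\<beta> \<omega>))\<^sup>2 \<le> F \<omega> (d j) - m \<omega>" and "0 < \<kappa>"
    and approx: "\<And>\<omega> \<epsilon>. \<omega> \<in> space P \<Longrightarrow> 0 < \<epsilon> \<Longrightarrow> \<exists>j. F \<omega> (d j) < m \<omega> + \<epsilon>"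
  shows "\<beta> \<in> borel_measurable P"
proof -
  define N where "N k \<omega> = (LEAST j. \<forall>i. F \<omega> (d j) \<le> F \<omega> (d i) + 1 / real (Suc k))" for k \<omega>
  note [measurable] = meas
  have N: "N k \<in> measurable P (count_space UNIV)" for k
    unfolding N_def[abs_def] by measurable
  have "(\<lambda>\<omega>. d (N k \<omega>)) \<in> borel_measurable P" for k
    using measurable_compose[OF N, of d borel] by simp
  moreover have "(\<lambda>k. d (N k \<omega>)) \<longlonglongrightarrow> \<beta> \<omega>" if \<omega>: "\<omega> \<in> space P" for \<omega>
  proof -
    have m: "m \<omega> \<le> F \<omega> (d j)" for j
      using gap[OF \<omega>, of j] \<open>0 < \<kappa>\<close> by (smt (verit) mult_nonneg_nonneg zero_le_power2)
    have bound: "\<kappa> * (dist (d (N k \<omega>)) (\<beta> \<omega>))\<^sup>2 \<le> 1 / real (Suc k)" for k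
    proof -
      obtain j where "F \<omega> (d j) < m \<omega> + 1 / real (Suc k)"
        using approx[OF \<omega>, of "1 / real (Suc k)"] by auto
      then have "\<forall>i. F \<omega> (d j) \<le> F \<omega> (d i) + 1 / real (Suc k)" using m by (smt (verit))
      then have NN: "\<forall>i. F \<omega> (d (N k \<omega>)) \<le> F \<omega> (d i) + 1 / real (Suc k)"
        unfolding N_def by (rule LeastI)
      have "F \<omega> (d (N k \<omega>)) \<le> m \<omega> + 1 / real (Suc k)"
      proof (rule field_le_epsilon)
        fix e :: real assume "0 < e"
        then obtain i where "F \<omega> (d i) < m \<omega> + e" using approx[OF \<omega>] by blast
        then show "F \<omega> (d (N k \<omega>)) \<le> m \<omega> + 1 / real (Suc k) + e" using NN by (smt (verit))
      qed
      then show ?thesis using gap[OF \<omega>, of "N k \<omega>"] by linarith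
    qed
    have "(\<lambda>k. (dist (d (N k \<omega>)) (\<beta> \<omega>))\<^sup>2) \<longlonglongrightarrow> 0"
    proof (rule tendsto_sandwich[OF _ _ tendsto_const])
      show "(\<lambda>k. (1 / \<kappa>) * (1 / real (Suc k))) \<longlonglongrightarrow> 0"
        by (rule tendsto_mult_right_zero, rule LIMSEQ_Suc) (rule lim_1_over_n)
      show "\<forall>\<^sub>F k in sequentially. (dist (d (N k \<omega>)) (\<beta> \<omega>))\<^sup>2 \<le> (1 / \<kappa>) * (1 / real (Suc k))"
      proof (intro always_eventually allI)
        fix k
        have "(1 / \<kappa>) * (\<kappa> * (dist (d (N k \<omega>)) (\<beta> \<omega>))\<^sup>2) \<le> (1 / \<kappa>) * (1 / real (Suc k))"
          using bound[of k] \<open>0 < \<kappa>\<close> by (intro mult_left_mono) auto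
        then show "(dist (d (N k \<omega>)) (\<beta> \<omega>))\<^sup>2 \<le> (1 / \<kappa>) * (1 / real (Suc k))"
          using \<open>0 < \<kappa>\<close> by simp
      qed
    qed simp
    then have "(\<lambda>k. sqrt ((dist (d (N k \<omega>)) (\<beta> \<omega>))\<^sup>2)) \<longlonglongrightarrow> sqrt 0" by (rule tendsto_real_sqrt)
    then show ?thesis by (simp add: tendsto_dist_iff[symmetric])
  qed
  ultimately show ?thesis by (rule borel_measurable_LIMSEQ_metric)
qed

section \<open>The sampled market\<close>

locale fppe_sample =
  fixes M :: "'t measure" and b :: "real^'n" and v :: "'n \<Rightarrow> 't \<Rightarrow> real" and s :: "'t \<Rightarrow> real"
    and \<beta> :: "real^'n" and p :: "'t \<Rightarrow> real" and x :: "'n \<Rightarrow> 't \<Rightarrow> real"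
    and P :: "'w measure" and \<theta> :: "nat \<Rightarrow> 'w \<Rightarrow> 't"
    and \<beta>g :: "nat \<Rightarrow> 'w \<Rightarrow> real^'n"
    and pg :: "nat \<Rightarrow> 'w \<Rightarrow> nat \<Rightarrow> real"
    and xg :: "nat \<Rightarrow> 'w \<Rightarrow> 'n \<Rightarrow> nat \<Rightarrow> real"
  assumes market: "market M b v s"
    and limit: "limit_FPPE M b v s \<beta> p x"
    and prob: "prob_space P"
    and indep_M: "prob_space.indep_vars P (\<lambda>_. M) \<theta> UNIV"
    and law_M: "\<And>\<tau>. distr P M (\<theta> \<tau>) = density M (\<lambda>y. ennreal (s y))"
    and observed: "\<And>t \<omega>. t \<ge> 1 \<Longrightarrow> \<omega> \<in> space P \<Longrightarrow>
      observed_FPPE b v (1 / real t) t (\<lambda>\<tau>. \<theta> \<tau> \<omega>) (\<beta>g t \<omega>) (pg t \<omega>) (xg t \<omega>)"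
begin

abbreviation "Q \<equiv> density M (\<lambda>y. ennreal (s y))"

lemma b_pos: "0 < b $ i"
  and v_measurable [measurable]: "v i \<in> borel_measurable M"
  and v_nonneg: "y \<in> space M \<Longrightarrow> 0 \<le> v i y"
  and s_measurable [measurable]: "s \<in> borel_measurable M"
  and s_nonneg: "AE y in M. 0 \<le> s y"
  and s_integral: "(\<integral>y. s y \<partial>M) = 1"
  using market unfolding market_def Linf_plus_def by (auto dest: borel_measurable_integrable)

lemma prob_space_Q: "prob_space Q"
proof
  have "integrable M s" using s_integral not_integrable_integral_eq by fastforce
  then have "(\<integral>\<^sup>+y. ennreal (s y) \<partial>M) = ennreal 1"
    using nn_integral_eq_integral[OF _ s_nonneg] s_integral by simp
  then show "emeasure Q (space Q) = 1" by (simp add: emeasure_density cong: nn_integral_cong)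
qed

sublocale iid_sample P Q \<theta>
proof -
  interpret P: prob_space P by (rule prob)
  interpret Q: prob_space Q by (rule prob_space_Q)
  show "iid_sample P Q \<theta>"
  proof
    show "P.indep_vars (\<lambda>_. Q) \<theta> UNIV"
      using indep_M by (simp add: P.indep_vars_def2)
    show "distr P Q (\<theta> \<tau>) = Q" for \<tau>
      using law_M[of \<tau>] distr_cong[of P P Q M "\<theta> \<tau>" "\<theta> \<tau>"] by simp
  qed
qed

lemma sample_measurable_M [measurable]: "\<theta> \<tau> \<in> measurable P M"
  using sample_measurable[of \<tau>] by simp

lemma sample_in_space: "\<omega> \<in> space P \<Longrightarrow> \<theta> \<tau> \<omega> \<in> space M"
  by (rule measurable_space[OF sample_measurable_M])

lemma AE_Q: "AE y in M. A y \<Longrightarrow> AE y in Q. A y"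
  by (subst AE_density) auto

lemma Es_eq: "g \<in> borel_measurable M \<Longrightarrow> Es M s g = Q.expectation g"
  using integral_density[OF _ s_measurable s_nonneg, of g] by (simp add: Es_def mult.commute)

definition vmax :: real where
  "vmax = (SOME C. 0 \<le> C \<and> (\<forall>i. \<forall>y\<in>space M. v i y \<le> C))"

lemma vmax: "0 \<le> vmax" "y \<in> space M \<Longrightarrow> v i y \<le> vmax"
proof -
  obtain C where "\<forall>i. \<forall>y\<in>space M. v i y \<le> C" using market by (auto simp: market_def)
  then have "0 \<le> max C 0 \<and> (\<forall>i. \<forall>y\<in>space M. v i y \<le> max C 0)" by (auto simp: le_max_iff_disj)
  from someI[of "\<lambda>C. 0 \<le> C \<and> (\<forall>i. \<forall>y\<in>space M. v i y \<le> C)", OF this]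
  show "0 \<le> vmax" "y \<in> space M \<Longrightarrow> v i y \<le> vmax" unfolding vmax_def by blast+
qed

lemma bounded_integrable_Q:
  fixes g :: "'t \<Rightarrow> real"
  assumes [measurable]: "g \<in> borel_measurable M" and "AE y in M. \<bar>g y\<bar> \<le> B"
  shows "integrable Q g" "integrable Q (\<lambda>y. (g y)\<^sup>2)"
proof -
  have ae: "AE y in Q. \<bar>g y\<bar> \<le> B" by (rule AE_Q[OF assms(2)])
  show "integrable Q g"
    using ae by (intro Q.integrable_const_bound[of _ B]) auto
  have "AE y in Q. \<bar>(g y)\<^sup>2\<bar> \<le> B\<^sup>2"
    using ae by eventually_elim (simp add: abs_le_square_iff[symmetric])
  then show "integrable Q (\<lambda>y. (g y)\<^sup>2)"
    by (intro Q.integrable_const_bound[of _ "B\<^sup>2"]) auto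
qed

lemma top_bid_measurable [measurable]: "top_bid v z \<in> borel_measurable M"
  unfolding top_bid_def[abs_def] by measurable

lemma top_bid_lipschitz_vmax:
  "y \<in> space M \<Longrightarrow> \<bar>top_bid v z y - top_bid v z' y\<bar> \<le> vmax * norm (z - z')"
  by (rule top_bid_lipschitz) (auto simp: v_nonneg vmax)

lemma top_bid_bounded: "y \<in> space M \<Longrightarrow> \<bar>top_bid v z y\<bar> \<le> vmax * norm z"
  using top_bid_lipschitz_vmax[of y z 0] by (simp add: top_bid_def)

lemma top_bid_integrable: "integrable Q (top_bid v z)" "integrable Q (\<lambda>y. (top_bid v z y)\<^sup>2)"
  by (rule bounded_integrable_Q[of _ "vmax * norm z"]; simp add: top_bid_bounded)+

text \<open>The expected revenue as a function of the multipliers.\<close>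

definition rev_at :: "real^'n \<Rightarrow> real" where
  "rev_at z = Q.expectation (top_bid v z)"

lemma rev_at_eq: "Es M s (top_bid v z) = rev_at z"
  by (simp add: Es_eq rev_at_def)

lemma emp_lipschitz:
  assumes "\<omega> \<in> space P" "t \<ge> 1"
  shows "\<bar>emp t (top_bid v z) \<omega> - emp t (top_bid v z') \<omega>\<bar> \<le> vmax * norm (z - z')"
proof -
  have "emp t (top_bid v z) \<omega> - emp t (top_bid v z') \<omega>
      = (1 / real t) * (\<Sum>\<tau><t. top_bid v z (\<theta> \<tau> \<omega>) - top_bid v z' (\<theta> \<tau> \<omega>))"
    by (simp add: emp_def sum_subtractf right_diff_distrib diff_divide_distrib)
  also have "\<bar>\<dots>\<bar> = (1 / real t) * \<bar>\<Sum>\<tau><t. top_bid v z (\<theta> \<tau> \<omega>) - top_bid v z' (\<theta> \<tau> \<omega>)\<bar>"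
    by (simp add: abs_mult)
  also have "\<dots> \<le> (1 / real t) * (\<Sum>\<tau><t. vmax * norm (z - z'))"
    using assms(1)
    by (intro mult_left_mono order_trans[OF sum_abs] sum_mono top_bid_lipschitz_vmax sample_in_space) auto
  finally show ?thesis using assms(2) by simp
qed

subsection \<open>The limit equilibrium\<close>

lemma x_measurable [measurable]: "x i \<in> borel_measurable M"
  using limit by (simp add: limit_FPPE_def Linf_plus_def)

lemma price_AE: "AE y in M. p y = top_bid v \<beta> y"
  using limit by (simp add: limit_FPPE_def)

lemma limit_supports: "AE y in M. supports v \<beta> y (\<lambda>i. x i y)"
proof -
  have "AE y in M. \<forall>i. 0 \<le> x i y"
    using limit by (simp add: limit_FPPE_def Linf_plus_def AE_all_countable)
  moreover have "AE y in M. (\<Sum>i\<in>UNIV. x i y) \<le> 1"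
    and "AE y in M. \<forall>i. x i y > 0 \<longrightarrow> \<beta> $ i * v i y = top_bid v \<beta> y"
    and "AE y in M. p y > 0 \<longrightarrow> (\<Sum>i\<in>UNIV. x i y) = 1"
    using limit by (simp_all add: limit_FPPE_def)
  ultimately show ?thesis using price_AE
    by eventually_elim (simp add: supports_def)
qed

lemma mu_measurable [measurable]: "(\<lambda>y. mu v x y $ i) \<in> borel_measurable M"
  by (simp add: mu_def)

lemma mu_bounds: "AE y in M. \<forall>i. 0 \<le> mu v x y $ i \<and> mu v x y $ i \<le> vmax"
  using limit_supports AE_space
proof eventually_elim
  case (elim y)
  show ?case
  proof
    fix i
    have "0 \<le> x i y" "x i y \<le> 1"
      using elim supports_weight_le[OF elim(1)] by (auto simp: supports_def)
    then show "0 \<le> mu v x y $ i \<and> mu v x y $ i \<le> vmax"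
      using mult_mono[of "x i y" 1 "v i y" vmax] v_nonneg[OF elim(2)] vmax(1) vmax(2)[OF elim(2)]
      by (simp add: mu_def)
  qed
qed

lemma mu_integrable: "integrable Q (\<lambda>y. mu v x y $ i)" "integrable Q (\<lambda>y. (mu v x y $ i)\<^sup>2)"
proof -
  have "AE y in M. \<bar>mu v x y $ i\<bar> \<le> vmax" using mu_bounds by eventually_elim auto
  then show "integrable Q (\<lambda>y. mu v x y $ i)" "integrable Q (\<lambda>y. (mu v x y $ i)\<^sup>2)"
    using bounded_integrable_Q[OF mu_measurable] by blast+
qed

definition expect_vec :: "('t \<Rightarrow> real^'n) \<Rightarrow> real^'n" where
  "expect_vec G = (\<chi> i. Q.expectation (\<lambda>y. G y $ i))"

definition emp_vec :: "nat \<Rightarrow> ('t \<Rightarrow> real^'n) \<Rightarrow> 'w \<Rightarrow> real^'n" where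
  "emp_vec t G \<omega> = (\<chi> i. emp t (\<lambda>y. G y $ i) \<omega>)"

lemma fluct_vec_eq: "t \<ge> 1 \<Longrightarrow> fluct_vec t G \<omega> = sqrt (real t) *\<^sub>R (emp_vec t G \<omega> - expect_vec G)"
  by (simp add: fluct_vec_def emp_vec_def expect_vec_def fluct_eq_emp vec_eq_iff)

lemma mu_bar_eq: "mu_bar M v s x = expect_vec (mu v x)"
proof -
  have "(\<integral>y. v i y * (s y * x i y) \<partial>M) = Es M s (\<lambda>y. mu v x y $ i)" for i
    by (simp add: Es_def mu_def mult_ac)
  then show ?thesis by (simp add: mu_bar_def expect_vec_def vec_eq_iff Es_eq)
qed

lemma spend_eq:
  "(\<integral>y. x i y * p y * s y \<partial>M) = \<beta> $ i * mu_bar M v s x $ i"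
  "(\<integral>y. p y * (s y * x i y) \<partial>M) = \<beta> $ i * mu_bar M v s x $ i"
proof -
  have "p \<in> borel_measurable M" using limit by (auto simp: limit_FPPE_def L1_plus_def)
  then have [measurable]: "p \<in> borel_measurable M" .
  have "AE y in M. x i y * p y * s y = \<beta> $ i * (v i y * (s y * x i y))"
    using limit_supports price_AE
  proof eventually_elim
    case (elim y)
    then have "x i y = 0 \<or> p y = \<beta> $ i * v i y" by (auto simp: supports_def order_le_less)
    then show ?case by auto
  qed
  then have "(\<integral>y. x i y * p y * s y \<partial>M) = (\<integral>y. \<beta> $ i * (v i y * (s y * x i y)) \<partial>M)"
    by (intro integral_cong_AE) auto
  then show 1: "(\<integral>y. x i y * p y * s y \<partial>M) = \<beta> $ i * mu_bar M v s x $ i"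
    by (simp add: mu_bar_def)
  show "(\<integral>y. p y * (s y * x i y) \<partial>M) = \<beta> $ i * mu_bar M v s x $ i"
    unfolding 1[symmetric] by (simp add: mult_ac)
qed

lemma kkt_limit: "kkt b \<beta> (mu_bar M v s x)"
  using limit b_pos by (intro kkt_of_spend) (auto simp: limit_FPPE_def spend_eq)

lemma \<beta>_range: "0 < \<beta> $ i" "\<beta> $ i \<le> 1" "0 \<le> \<beta> $ i"
  using kkt_limit by (auto simp: kkt_def less_imp_le)

lemma expect_vec_inner:
  assumes "\<And>i. integrable Q (\<lambda>y. G y $ i)"
  shows "integrable Q (\<lambda>y. G y \<bullet> h)" "Q.expectation (\<lambda>y. G y \<bullet> h) = expect_vec G \<bullet> h"
  using assms by (simp_all add: inner_vec_def expect_vec_def)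

lemma emp_vec_inner: "emp t (\<lambda>y. G y \<bullet> h) \<omega> = emp_vec t G \<omega> \<bullet> h"
  unfolding emp_def emp_vec_def inner_vec_def
  by (simp add: sum_distrib_right sum_divide_distrib sum_distrib_left) (rule sum.swap)

text \<open>
  The subgradient inequality for one item, integrated over items (here) and averaged over a sample
  (below).
\<close>

lemma rev_at_subgradient:
  assumes G: "\<And>i. integrable Q (\<lambda>y. G y $ i)"
    and sup: "AE y in M. supports v z0 y (w y) \<and> G y = (\<chi> i. w y i * v i y)"
    and nn: "\<And>i. 0 \<le> z0 $ i" "\<And>i. 0 \<le> z $ i"
  shows "rev_at z0 + expect_vec G \<bullet> (z - z0) \<le> rev_at z"
proof -
  have "AE y in M. top_bid v z0 y + G y \<bullet> (z - z0) \<le> top_bid v z y"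
    using sup AE_space
  proof eventually_elim
    case (elim y)
    then show ?case using supports_subgradient[of v z0 y "w y" z] v_nonneg nn by simp
  qed
  from AE_Q[OF this] have "Q.expectation (\<lambda>y. top_bid v z0 y + G y \<bullet> (z - z0)) \<le> Q.expectation (top_bid v z)"
    using expect_vec_inner(1)[OF G] top_bid_integrable by (intro integral_mono_AE) auto
  then show ?thesis
    using expect_vec_inner[OF G] top_bid_integrable by (simp add: rev_at_def)
qed

lemma rev_at_subgradient_mu:
  "(\<And>i. 0 \<le> z $ i) \<Longrightarrow> rev_at \<beta> + mu_bar M v s x \<bullet> (z - \<beta>) \<le> rev_at z"
  unfolding mu_bar_eq
  by (rule rev_at_subgradient[where w="\<lambda>y i. x i y"])
     (use limit_supports mu_integrable \<beta>_range in \<open>auto simp: mu_def\<close>)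

lemma emp_subgradient:
  assumes "\<omega> \<in> space P" "\<And>\<tau>. supports v z0 (\<theta> \<tau> \<omega>) (w \<tau>) \<and> G (\<theta> \<tau> \<omega>) = (\<chi> i. w \<tau> i * v i (\<theta> \<tau> \<omega>))"
    and nn: "\<And>i. 0 \<le> z0 $ i" "\<And>i. 0 \<le> z $ i"
  shows "emp t (top_bid v z0) \<omega> + emp_vec t G \<omega> \<bullet> (z - z0) \<le> emp t (top_bid v z) \<omega>"
proof -
  have "top_bid v z0 (\<theta> \<tau> \<omega>) + G (\<theta> \<tau> \<omega>) \<bullet> (z - z0) \<le> top_bid v z (\<theta> \<tau> \<omega>)" for \<tau>
    using supports_subgradient[of v z0 "\<theta> \<tau> \<omega>" "w \<tau>" z] assms(2)[of \<tau>] v_nonneg[OF sample_in_space[OF assms(1)]] nn by simp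
  then have "(1 / real t) * (\<Sum>\<tau><t. top_bid v z0 (\<theta> \<tau> \<omega>) + G (\<theta> \<tau> \<omega>) \<bullet> (z - z0)) \<le> (1 / real t) * (\<Sum>\<tau><t. top_bid v z (\<theta> \<tau> \<omega>))"
    by (intro mult_left_mono sum_mono) auto
  then show ?thesis
    unfolding emp_vec_inner[symmetric] by (simp add: emp_def sum.distrib add_divide_distrib)
qed

subsection \<open>The observed equilibrium\<close>

text \<open>The empirical counterpart of the item utilities \<open>mu_bar\<close>.\<close>

definition obs_util :: "nat \<Rightarrow> 'w \<Rightarrow> real^'n" where
  "obs_util t \<omega> = (\<chi> i. (1 / real t) * (\<Sum>\<tau><t. xg t \<omega> i \<tau> * v i (\<theta> \<tau> \<omega>)))"

lemma observed_supports:
  assumes "t \<ge> 1" "\<omega> \<in> space P" "\<tau> < t"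
  shows "supports v (\<beta>g t \<omega>) (\<theta> \<tau> \<omega>) (\<lambda>i. xg t \<omega> i \<tau>)"
  using observed[OF assms(1,2)] assms(3) unfolding observed_FPPE_def supports_def by simp

lemma observed_spend:
  assumes "t \<ge> 1" "\<omega> \<in> space P"
  shows "1 / real t * (\<Sum>\<tau><t. xg t \<omega> i \<tau> * pg t \<omega> \<tau>) = \<beta>g t \<omega> $ i * obs_util t \<omega> $ i"
proof -
  have "xg t \<omega> i \<tau> * pg t \<omega> \<tau> = \<beta>g t \<omega> $ i * (xg t \<omega> i \<tau> * v i (\<theta> \<tau> \<omega>))" if "\<tau> < t" for \<tau>
  proof -
    have "pg t \<omega> \<tau> = top_bid v (\<beta>g t \<omega>) (\<theta> \<tau> \<omega>)"
      using observed[OF assms] that by (simp add: observed_FPPE_def)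
    moreover have "xg t \<omega> i \<tau> = 0 \<or> \<beta>g t \<omega> $ i * v i (\<theta> \<tau> \<omega>) = top_bid v (\<beta>g t \<omega>) (\<theta> \<tau> \<omega>)"
      using observed_supports[OF assms that] by (auto simp: supports_def order_le_less)
    ultimately show ?thesis by auto
  qed
  then have "(\<Sum>\<tau><t. xg t \<omega> i \<tau> * pg t \<omega> \<tau>) = \<beta>g t \<omega> $ i * (\<Sum>\<tau><t. xg t \<omega> i \<tau> * v i (\<theta> \<tau> \<omega>))"
    unfolding sum_distrib_left by (intro sum.cong) auto
  then show ?thesis by (simp add: obs_util_def)
qed

lemma kkt_observed:
  assumes "t \<ge> 1" "\<omega> \<in> space P"
  shows "kkt b (\<beta>g t \<omega>) (obs_util t \<omega>)"
  using observed[OF assms, unfolded observed_FPPE_def observed_spend[OF assms]]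
  by (intro kkt_of_spend b_pos) auto

lemma \<beta>g_range:
  assumes "t \<ge> 1" "\<omega> \<in> space P"
  shows "0 < \<beta>g t \<omega> $ i" "\<beta>g t \<omega> $ i \<le> 1" "0 \<le> \<beta>g t \<omega> $ i"
  using kkt_observed[OF assms] by (auto simp: kkt_def less_imp_le)

lemma observed_subgradient:
  assumes "t \<ge> 1" "\<omega> \<in> space P" "\<And>i. 0 \<le> z $ i"
  shows "emp t (top_bid v (\<beta>g t \<omega>)) \<omega> + obs_util t \<omega> \<bullet> (z - \<beta>g t \<omega>) \<le> emp t (top_bid v z) \<omega>"
proof -
  let ?h = "z - \<beta>g t \<omega>"
  have "top_bid v (\<beta>g t \<omega>) (\<theta> \<tau> \<omega>) + (\<chi> i. xg t \<omega> i \<tau> * v i (\<theta> \<tau> \<omega>)) \<bullet> ?h \<le> top_bid v z (\<theta> \<tau> \<omega>)"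
    if "\<tau> < t" for \<tau>
    using supports_subgradient[OF observed_supports[OF assms(1,2) that], of z]
      v_nonneg[OF sample_in_space[OF assms(2)]] \<beta>g_range[OF assms(1,2)] assms(3) by simp
  then have "(1 / real t) * (\<Sum>\<tau><t. top_bid v (\<beta>g t \<omega>) (\<theta> \<tau> \<omega>) + (\<chi> i. xg t \<omega> i \<tau> * v i (\<theta> \<tau> \<omega>)) \<bullet> ?h)
      \<le> (1 / real t) * (\<Sum>\<tau><t. top_bid v z (\<theta> \<tau> \<omega>))"
    by (intro mult_left_mono sum_mono) auto
  moreover have "(1 / real t) * (\<Sum>\<tau><t. (\<chi> i. xg t \<omega> i \<tau> * v i (\<theta> \<tau> \<omega>)) \<bullet> ?h) = obs_util t \<omega> \<bullet> ?h"
    unfolding obs_util_def inner_vec_def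
    by (simp add: sum_distrib_right sum_divide_distrib) (rule sum.swap)
  ultimately show ?thesis by (simp add: emp_def sum.distrib add_divide_distrib)
qed

lemma observed_monotone:
  assumes "t \<ge> 1" "\<omega> \<in> space P"
    and sup: "\<And>\<tau>. supports v z0 (\<theta> \<tau> \<omega>) (w \<tau>) \<and> G (\<theta> \<tau> \<omega>) = (\<chi> i. w \<tau> i * v i (\<theta> \<tau> \<omega>))"
    and nn: "\<And>i. 0 \<le> z0 $ i"
  shows "0 \<le> (obs_util t \<omega> - emp_vec t G \<omega>) \<bullet> (\<beta>g t \<omega> - z0)"
  using observed_subgradient[OF assms(1,2) nn]
    emp_subgradient[OF assms(2) sup nn \<beta>g_range(3)[OF assms(1,2)], of t]
  by (simp add: inner_diff_left inner_diff_right)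

definition bmin :: real where "bmin = Min (range (\<lambda>i. b $ i))"

lemma bmin: "0 < bmin" "bmin \<le> b $ i"
  unfolding bmin_def using b_pos by auto

text \<open>
  Outcomes at which the limit equilibrium conditions, which hold almost everywhere, hold at every
  sampled item.
\<close>

definition regular_point :: "'w \<Rightarrow> bool" where
  "regular_point \<omega> \<longleftrightarrow> (\<forall>\<tau>. supports v \<beta> (\<theta> \<tau> \<omega>) (\<lambda>i. x i (\<theta> \<tau> \<omega>)) \<and> p (\<theta> \<tau> \<omega>) = top_bid v \<beta> (\<theta> \<tau> \<omega>))"

lemma AE_regular_point: "AE \<omega> in P. regular_point \<omega>"
proof -
  have "AE y in M. supports v \<beta> y (\<lambda>i. x i y) \<and> p y = top_bid v \<beta> y"
    using limit_supports price_AE by eventually_elim simp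
  from sample_AE[OF AE_Q[OF this]] show ?thesis by (simp add: regular_point_def)
qed

lemma mu_monotone:
  assumes "t \<ge> 1" "\<omega> \<in> space P" "regular_point \<omega>"
  shows "0 \<le> (obs_util t \<omega> - emp_vec t (mu v x) \<omega>) \<bullet> (\<beta>g t \<omega> - \<beta>)"
  using assms(3) by (intro observed_monotone[OF assms(1,2), where w="\<lambda>\<tau> i. x i (\<theta> \<tau> \<omega>)"])
    (auto simp: regular_point_def mu_def \<beta>_range)

text \<open>
  This gives consistency with the rate \<open>1 / sqrt t\<close> at once.  The sample average of \<open>mu\<close> is a
  subgradient of the sampled objective at \<open>\<beta>\<close>, so its fluctuation is all that prevents \<open>\<beta>\<close>
  from satisfying the observed equilibrium conditions.
\<close>

lemma root_t_distance:
  assumes "t \<ge> 1" "\<omega> \<in> space P" "regular_point \<omega>"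
  shows "sqrt (real t) * norm (\<beta>g t \<omega> - \<beta>) \<le> norm (fluct_vec t (mu v x) \<omega>) / bmin"
proof -
  have "norm (\<beta>g t \<omega> - \<beta>) \<le> norm (mu_bar M v s x - emp_vec t (mu v x) \<omega>) / bmin"
    by (rule kkt_compare_distance[OF kkt_observed[OF assms(1,2)] kkt_limit bmin(2,1) mu_monotone[OF assms]])
  then have "sqrt (real t) * norm (\<beta>g t \<omega> - \<beta>)
      \<le> sqrt (real t) * (norm (mu_bar M v s x - emp_vec t (mu v x) \<omega>) / bmin)"
    by (intro mult_left_mono) auto
  then show ?thesis by (simp add: fluct_vec_eq[OF assms(1)] mu_bar_eq norm_minus_commute)
qed

lemma mu_fluct_tight: "tight P (\<lambda>t. fluct_vec t (mu v x))"
  using mu_integrable by (intro fluct_vec_tight) auto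

lemma \<beta>g_close: "0 < \<epsilon> \<Longrightarrow> whp P (\<lambda>t \<omega>. norm (\<beta>g t \<omega> - \<beta>) \<le> \<epsilon>)"
  unfolding whp_def
proof (intro allI impI)
  fix \<delta> :: real assume \<epsilon>: "0 < \<epsilon>" and \<delta>: "0 < \<delta>"
  obtain K where K: "0 < K" "all_but P (\<delta>/2) (\<lambda>t \<omega>. norm (fluct_vec t (mu v x) \<omega>) \<le> K)"
    using mu_fluct_tight \<delta> unfolding tight_def by (metis half_gt_zero)
  have "(\<lambda>t. (K / bmin) / sqrt (real t)) \<longlonglongrightarrow> 0" by real_asymp
  from order_tendstoD(2)[OF this \<epsilon>] eventually_ge_at_top[of 1]
  have ev: "\<forall>\<^sub>F t in sequentially. (K / bmin) / sqrt (real t) \<le> \<epsilon> \<and> 1 \<le> t"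
    by (rule eventually_elim2) auto
  have "all_but P (\<delta>/2 + \<delta>/2) (\<lambda>t \<omega>. norm (fluct_vec t (mu v x) \<omega>) \<le> K \<and> regular_point \<omega>)"
    (is "all_but P _ ?E")
    using \<delta> by (intro P.all_but_conj K whpD P.whp_AE AE_regular_point) auto
  then have "all_but P \<delta> ?E" by simp
  then show "all_but P \<delta> (\<lambda>t \<omega>. norm (\<beta>g t \<omega> - \<beta>) \<le> \<epsilon>)"
  proof (rule all_but_mono, use ev in \<open>elim eventually_mono\<close>, intro ballI impI)
    fix t \<omega> assume t: "(K / bmin) / sqrt (real t) \<le> \<epsilon> \<and> 1 \<le> t" and \<omega>: "\<omega> \<in> space P"
      and *: "?E t \<omega>"
    have "sqrt (real t) * norm (\<beta>g t \<omega> - \<beta>) \<le> norm (fluct_vec t (mu v x) \<omega>) / bmin"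
      using root_t_distance t \<omega> * by blast
    also have "\<dots> \<le> K / bmin" using * bmin(1) by (intro divide_right_mono) auto
    finally have "norm (\<beta>g t \<omega> - \<beta>) \<le> (K / bmin) / sqrt (real t)"
      using t by (subst pos_le_divide_eq) (auto simp: mult.commute)
    then show "norm (\<beta>g t \<omega> - \<beta>) \<le> \<epsilon>" using t by linarith
  qed
qed

lemma \<beta>g_measurable:
  assumes t: "t \<ge> 1"
  shows "\<beta>g t \<in> borel_measurable P"
proof -
  (* the coordinates are kept positive so that the logarithms are continuous at the limit *)
  define B :: "(real^'n) set" where "B = {z. \<forall>i. 0 < z $ i \<and> z $ i \<le> 1}"
  obtain D where D: "countable D" "D \<subseteq> B" "B \<subseteq> closure D" by (rule separable)
  have "vec 1 \<in> B" by (simp add: B_def)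
  then have "D \<noteq> {}" using D(3) by auto
  define d where "d = from_nat_into D"
  have d: "range d = D" using D(1) \<open>D \<noteq> {}\<close> by (simp add: d_def)
  then have dB: "d j \<in> B" for j using D(2) by auto
  define F where "F \<omega> z = emp t (top_bid v z) \<omega> - (\<Sum>i\<in>UNIV. b $ i * ln (z $ i))" for \<omega> z
  show ?thesis
  proof (rule measurable_strict_minimiser[where F=F and d=d and \<kappa>="bmin / 2" and m="\<lambda>\<omega>. F \<omega> (\<beta>g t \<omega>)"])
    show "(\<lambda>\<omega>. F \<omega> (d j)) \<in> borel_measurable P" for j unfolding F_def by simp
    show "0 < bmin / 2" using bmin by simp
  next
    fix \<omega> j assume \<omega>: "\<omega> \<in> space P"
    have dj: "0 < d j $ i \<and> d j $ i \<le> 1" for i using dB[of j] by (auto simp: B_def)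
    have "emp t (top_bid v (\<beta>g t \<omega>)) \<omega> + obs_util t \<omega> \<bullet> (d j - \<beta>g t \<omega>) \<le> emp t (top_bid v (d j)) \<omega>"
      using dj by (intro observed_subgradient[OF t \<omega>]) (simp add: less_imp_le)
    then show "bmin / 2 * (dist (d j) (\<beta>g t \<omega>))\<^sup>2 \<le> F \<omega> (d j) - F \<omega> (\<beta>g t \<omega>)"
      using dual_gap[OF kkt_observed[OF t \<omega>] bmin(2,1) dj] by (simp add: F_def dist_norm)
  next
    fix \<omega> and \<epsilon> :: real assume \<omega>: "\<omega> \<in> space P" and \<epsilon>: "0 < \<epsilon>"
    have "\<beta>g t \<omega> \<in> closure D" using D(3) \<beta>g_range[OF t \<omega>] by (auto simp: B_def)
    then obtain y where y: "\<And>k. y k \<in> D" "y \<longlonglongrightarrow> \<beta>g t \<omega>" by (auto simp: closure_sequential)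
    have "(\<lambda>k. emp t (top_bid v (y k)) \<omega> - emp t (top_bid v (\<beta>g t \<omega>)) \<omega>) \<longlonglongrightarrow> 0"
    proof (rule tendsto_0_le[where K=vmax])
      show "(\<lambda>k. norm (y k - \<beta>g t \<omega>)) \<longlonglongrightarrow> 0" using y(2) by (simp add: LIM_zero tendsto_norm_zero)
    qed (use emp_lipschitz[OF \<omega> t] in \<open>simp add: mult.commute\<close>)
    then have "(\<lambda>k. emp t (top_bid v (y k)) \<omega>) \<longlonglongrightarrow> emp t (top_bid v (\<beta>g t \<omega>)) \<omega>" by (simp add: LIM_zero_iff)
    then have "(\<lambda>k. F \<omega> (y k)) \<longlonglongrightarrow> F \<omega> (\<beta>g t \<omega>)"
      unfolding F_def using \<beta>g_range(1)[OF t \<omega>]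
      by (intro tendsto_intros y(2)) (auto simp: less_imp_neq[symmetric])
    from order_tendstoD(2)[OF this, of "F \<omega> (\<beta>g t \<omega>) + \<epsilon>"] \<epsilon>
    have "\<forall>\<^sub>F k in sequentially. F \<omega> (y k) < F \<omega> (\<beta>g t \<omega>) + \<epsilon>" by simp
    then obtain k where "F \<omega> (y k) < F \<omega> (\<beta>g t \<omega>) + \<epsilon>"
      by (auto simp: eventually_sequentially)
    moreover obtain j where "d j = y k" using y(1)[of k] d by (metis imageE)
    ultimately show "\<exists>j. F \<omega> (d j) < F \<omega> (\<beta>g t \<omega>) + \<epsilon>" by metis
  qed
qed

theorem \<beta>g_consistent: "tendsto_in_prob P \<beta>g \<beta>"
  unfolding P.tendsto_in_prob_iff_whp using \<beta>g_measurable \<beta>g_close by (simp add: dist_norm)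

lemma observed_REV_eq:
  assumes "t \<ge> 1" "\<omega> \<in> space P"
  shows "observed_REV t (pg t \<omega>) = emp t (top_bid v (\<beta>g t \<omega>)) \<omega>"
  using observed[OF assms] by (simp add: observed_REV_def emp_def observed_FPPE_def)

lemma observed_REV_measurable:
  assumes t: "t \<ge> 1"
  shows "(\<lambda>\<omega>. observed_REV t (pg t \<omega>)) \<in> borel_measurable P"
proof -
  have [measurable]: "(\<lambda>\<omega>. \<beta>g t \<omega> $ i) \<in> borel_measurable P" for i
    by (rule measurable_compose[OF \<beta>g_measurable[OF t]])
       (intro borel_measurable_continuous_onI continuous_intros)
  have "(\<lambda>\<omega>. emp t (top_bid v (\<beta>g t \<omega>)) \<omega>) \<in> borel_measurable P"
    unfolding emp_def top_bid_def by measurable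
  then show ?thesis by (subst measurable_cong[OF observed_REV_eq[OF t]]) auto
qed

lemma REV_eq: "REV M s p = rev_at \<beta>"
proof -
  have [measurable]: "p \<in> borel_measurable M" using limit by (auto simp: limit_FPPE_def L1_plus_def)
  have "REV M s p = Es M s (top_bid v \<beta>)"
    unfolding REV_def Es_def by (rule integral_cong_AE) (use price_AE in auto)
  then show ?thesis by (simp add: rev_at_eq)
qed

theorem REV_consistent: "tendsto_in_prob P (\<lambda>t \<omega>. observed_REV t (pg t \<omega>)) (REV M s p)"
  unfolding P.tendsto_in_prob_iff_whp
proof (intro conjI allI impI observed_REV_measurable)
  fix \<epsilon> :: real assume \<epsilon>: "0 < \<epsilon>"
  define d where "d = \<epsilon> / (2 * (vmax + 1))"
  have d: "0 < d" "vmax * d \<le> \<epsilon> / 2"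
    using \<epsilon> vmax(1) by (auto simp: d_def field_simps)
  have "whp P (\<lambda>t \<omega>. norm (\<beta>g t \<omega> - \<beta>) \<le> d \<and> \<bar>emp t (top_bid v \<beta>) \<omega> - Q.expectation (top_bid v \<beta>)\<bar> \<le> \<epsilon>/2)"
    (is "whp P ?E")
    using \<epsilon> d top_bid_integrable by (intro P.whp_conj \<beta>g_close emp_whp) auto
  then show "whp P (\<lambda>t \<omega>. dist (observed_REV t (pg t \<omega>)) (REV M s p) \<le> \<epsilon>)"
  proof (rule whp_mono, use eventually_ge_at_top[of "1::nat"] in \<open>elim eventually_mono\<close>, intro ballI impI)
    fix t \<omega> assume t: "1 \<le> (t::nat)" and \<omega>: "\<omega> \<in> space P"
      and *: "?E t \<omega>"
    have "\<bar>emp t (top_bid v (\<beta>g t \<omega>)) \<omega> - emp t (top_bid v \<beta>) \<omega>\<bar> \<le> vmax * norm (\<beta>g t \<omega> - \<beta>)"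
      by (rule emp_lipschitz[OF \<omega> t])
    also have "\<dots> \<le> vmax * d" using * vmax(1) by (intro mult_left_mono) auto
    finally show "dist (observed_REV t (pg t \<omega>)) (REV M s p) \<le> \<epsilon>"
      using * d(2) unfolding observed_REV_eq[OF t \<omega>] REV_eq dist_real_def rev_at_def by linarith
  qed
qed

end

section \<open>The dual Hessian at the limit equilibrium\<close>

lemma vec_borel_measurable:
  fixes f :: "'a \<Rightarrow> real^'n"
  assumes "\<And>i. (\<lambda>\<omega>. f \<omega> $ i) \<in> borel_measurable N"
  shows "f \<in> borel_measurable N"
  by (subst borel_measurable_euclidean_space)
     (use assms in \<open>auto simp: Basis_vec_def inner_axis\<close>)

locale smooth_fppe_sample = fppe_sample M b v s \<beta> p x P \<theta> \<beta>g pg xg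
  for M :: "'t measure" and b :: "real^'n" and v s \<beta> p x
    and P :: "'w measure" and \<theta> \<beta>g pg xg +
  fixes U :: "(real^'n) set" and g :: "real^'n \<Rightarrow> real^'n" and A :: "real^'n^'n"
  assumes U_open: "open U" and \<beta>_in_U: "\<beta> \<in> U"
    and gradient_U: "\<And>z. z \<in> U \<Longrightarrow> GDERIV rev_at z :> g z"
    and hessian_\<beta>: "(g has_derivative (\<lambda>h. A *v h)) (at \<beta>)"
    and slack: "\<And>i. \<beta> $ i = 1 \<Longrightarrow> mu_bar M v s x $ i < b $ i"
begin

abbreviation "m \<equiv> mu_bar M v s x"

text \<open>A neighbourhood of \<open>\<beta>\<close> on which the expected top bid is differentiable and the logarithms are smooth.\<close>

definition V :: "(real^'n) set" where "V = U \<inter> {z. \<forall>i. 0 < z $ i}"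

lemma V: "open V" "\<beta> \<in> V" "V \<subseteq> U" "z \<in> V \<Longrightarrow> 0 < z $ i"
proof -
  have "{z :: real^'n. \<forall>i. 0 < z $ i} = (\<Inter>i. {z. 0 < z $ i})" by auto
  moreover have "open (\<Inter>i. {z :: real^'n. 0 < z $ i})"
    by (intro open_INT ballI open_Collect_less continuous_intros) auto
  ultimately show "open V" unfolding V_def using U_open by auto
qed (auto simp: V_def \<beta>_in_U \<beta>_range)

text \<open>
  A subgradient of the top bid at arbitrary multipliers.  Its expectation is the gradient of the
  expected top bid wherever the latter is differentiable.
\<close>

definition xi :: "real^'n \<Rightarrow> 't \<Rightarrow> real^'n" where
  "xi z y = (\<chi> i. argmax_share v z y i * v i y)"

lemma xi_measurable [measurable]: "(\<lambda>y. xi z y $ i) \<in> borel_measurable M"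
  unfolding xi_def argmax_share_def by simp

lemma xi_bounds:
  assumes "y \<in> space M" shows "0 \<le> xi z y $ i" "xi z y $ i \<le> vmax"
proof -
  have "0 \<le> argmax_share v z y i" "argmax_share v z y i \<le> 1"
    using supports_argmax_share[of v z y] supports_weight_le[OF supports_argmax_share[of v z y]]
    by (simp_all add: supports_def)
  then show "0 \<le> xi z y $ i" "xi z y $ i \<le> vmax"
    using mult_mono[of "argmax_share v z y i" 1 "v i y" vmax] v_nonneg[OF assms] vmax(1) vmax(2)[OF assms]
    by (auto simp: xi_def)
qed

lemma xi_integrable: "integrable Q (\<lambda>y. xi z y $ i)"
  by (rule bounded_integrable_Q(1)[of _ vmax]) (use xi_bounds in auto)

lemma g_subgradient:
  assumes z: "z \<in> V" and z': "\<And>i. 0 \<le> z' $ i"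
  shows "expect_vec (xi z) = g z" "rev_at z + g z \<bullet> (z' - z) \<le> rev_at z'"
proof -
  have sub: "rev_at z + expect_vec (xi z) \<bullet> (y - z) \<le> rev_at y" if "\<And>i. 0 \<le> y $ i" for y
    using V(4)[OF z] that xi_integrable
    by (intro rev_at_subgradient[where w="\<lambda>y. argmax_share v z y"])
       (simp_all add: supports_argmax_share less_imp_le, simp add: xi_def)
  have "GDERIV rev_at z :> g z" using z V(3) by (intro gradient_U) auto
  then have "g z = expect_vec (xi z)"
  proof (rule subgradient_eq_gradient[OF _ V(1) z])
    fix y assume "y \<in> V"
    then show "rev_at z + expect_vec (xi z) \<bullet> (y - z) \<le> rev_at y"
      by (intro sub less_imp_le V(4))
  qed
  with sub[OF z'] show "expect_vec (xi z) = g z" "rev_at z + g z \<bullet> (z' - z) \<le> rev_at z'" by auto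
qed

lemma g_\<beta>: "g \<beta> = m"
proof (rule subgradient_eq_gradient[OF _ V(1,2)])
  fix z assume "z \<in> V"
  then show "rev_at \<beta> + m \<bullet> (z - \<beta>) \<le> rev_at z"
    by (intro rev_at_subgradient_mu less_imp_le V(4))
qed (rule gradient_U[OF \<beta>_in_U])

lemma A_symmetric: "transpose A = A"
  by (rule second_derivative_symmetric[OF U_open \<beta>_in_U gradient_U hessian_\<beta>])

text \<open>
  The gradient of the expected top bid is monotone, being made of subgradients, so its derivative
  at \<open>\<beta>\<close> is positive semidefinite; the logarithmic barrier makes \<open>H\<close> positive definite.
\<close>

lemma A_psd: "0 \<le> h \<bullet> (A *v h)"
proof (rule ccontr)
  assume neg: "\<not> 0 \<le> h \<bullet> (A *v h)"
  have "((\<lambda>t. g (\<beta> + t *\<^sub>R h)) has_derivative (\<lambda>t. A *v (t *\<^sub>R h))) (at 0)"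
    by (rule has_derivative_compose[of "\<lambda>t. \<beta> + t *\<^sub>R h" "\<lambda>t. t *\<^sub>R h" 0 UNIV g "\<lambda>h. A *v h"])
       (use hessian_\<beta> in \<open>auto intro!: derivative_eq_intros\<close>)
  then have "((\<lambda>t. h \<bullet> g (\<beta> + t *\<^sub>R h)) has_derivative (\<lambda>t. h \<bullet> (A *v (t *\<^sub>R h)))) (at 0)"
    by (rule has_derivative_inner_right)
  then have "((\<lambda>t. h \<bullet> g (\<beta> + t *\<^sub>R h)) has_field_derivative (h \<bullet> (A *v h))) (at 0)"
    by (simp add: has_field_derivative_def matrix_vector_mult_scaleR mult_commute_abs)
  from DERIV_neg_dec_right[OF this] neg obtain d where
    d: "0 < d" "\<And>t. 0 < t \<Longrightarrow> t < d \<Longrightarrow> h \<bullet> g (\<beta> + t *\<^sub>R h) < h \<bullet> m"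
    by (auto simp: g_\<beta> not_le)
  have "isCont (\<lambda>t. \<beta> + t *\<^sub>R h) 0" by (intro continuous_intros)
  then have "((\<lambda>t. \<beta> + t *\<^sub>R h) \<longlongrightarrow> \<beta>) (at_right 0)"
    by (auto simp: isCont_def intro: tendsto_mono[OF at_le])
  from topological_tendstoD[OF this V(1,2)]
  have "\<forall>\<^sub>F t in at_right 0. \<beta> + t *\<^sub>R h \<in> V" .
  moreover have "\<forall>\<^sub>F t in at_right 0. 0 < t \<and> t < d"
    using d(1) eventually_at_right[of 0 1 "\<lambda>t. 0 < t \<and> t < d"] by auto
  ultimately have "\<forall>\<^sub>F t in at_right 0. \<beta> + t *\<^sub>R h \<in> V \<and> 0 < t \<and> t < d" by (rule eventually_conj)
  then obtain t where t: "\<beta> + t *\<^sub>R h \<in> V" "0 < t" "t < d"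
    using eventually_happens'[of "at_right (0::real)"] by auto
  have "rev_at (\<beta> + t *\<^sub>R h) + g (\<beta> + t *\<^sub>R h) \<bullet> (\<beta> - (\<beta> + t *\<^sub>R h)) \<le> rev_at \<beta>"
    by (rule g_subgradient(2)[OF t(1) \<beta>_range(3)])
  moreover have "rev_at \<beta> + m \<bullet> ((\<beta> + t *\<^sub>R h) - \<beta>) \<le> rev_at (\<beta> + t *\<^sub>R h)"
    using V(4)[OF t(1)] by (intro rev_at_subgradient_mu less_imp_le)
  ultimately have "t * (h \<bullet> m) \<le> t * (h \<bullet> g (\<beta> + t *\<^sub>R h))"
    by (simp add: inner_commute)
  then show False using d(2)[OF t(2,3)] t(2) by simp
qed

text \<open>The second derivative of the logarithmic part of the dual objective.\<close>

definition barrier :: "real^'n^'n" where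
  "barrier = (\<chi> i j. if i = j then b $ i / (\<beta> $ i)\<^sup>2 else 0)"

lemma barrier_vec: "(barrier *v h) $ i = b $ i / (\<beta> $ i)\<^sup>2 * h $ i"
  by (simp add: barrier_def matrix_vector_mult_def if_distrib[of "\<lambda>z. z * _"] sum.delta' cong: if_cong)

abbreviation "H \<equiv> hessian (dual_H M b v s) \<beta>"

lemma gradient_dual:
  assumes z: "z \<in> V"
  shows "gradient (dual_H M b v s) z = g z - (\<chi> i. b $ i / z $ i)"
proof -
  have "(rev_at has_derivative (\<lambda>h. h \<bullet> g z)) (at z)"
    using gradient_U[of z] z V(3) by (auto simp: gderiv_def)
  moreover have "((\<lambda>z. \<Sum>i\<in>UNIV. b $ i * ln (z $ i)) has_derivative (\<lambda>h. \<Sum>i\<in>UNIV. b $ i * (h $ i / z $ i))) (at z)"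
    using V(4)[OF z]
    by (intro has_derivative_sum has_derivative_mult_right)
       (auto intro!: derivative_eq_intros bounded_linear.has_derivative[OF bounded_linear_vec_nth] simp: divide_inverse mult.commute)
  ultimately have "((\<lambda>z. rev_at z - (\<Sum>i\<in>UNIV. b $ i * ln (z $ i))) has_derivative
      (\<lambda>h. h \<bullet> g z - (\<Sum>i\<in>UNIV. b $ i * (h $ i / z $ i)))) (at z)"
    by (rule has_derivative_diff)
  moreover have "dual_H M b v s = (\<lambda>z. rev_at z - (\<Sum>i\<in>UNIV. b $ i * ln (z $ i)))"
    by (simp add: dual_H_def fun_eq_iff rev_at_eq)
  moreover have "(\<lambda>h. h \<bullet> g z - (\<Sum>i\<in>UNIV. b $ i * (h $ i / z $ i))) = (\<lambda>h. h \<bullet> (g z - (\<chi> i. b $ i / z $ i)))"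
    by (simp add: fun_eq_iff inner_vec_def right_diff_distrib sum_subtractf mult_ac)
  ultimately have "GDERIV (dual_H M b v s) z :> (g z - (\<chi> i. b $ i / z $ i))"
    by (simp only: gderiv_def)
  then show ?thesis unfolding gradient_def using GDERIV_unique by blast
qed

lemma H_eq: "H = A + barrier"
proof -
  have "((\<lambda>z. g z - (\<chi> i. b $ i / z $ i)) has_derivative (\<lambda>h. A *v h - (\<chi> i. - (b $ i / (\<beta> $ i)\<^sup>2 * h $ i)))) (at \<beta>)"
  proof (intro has_derivative_diff hessian_\<beta>)
    have "((\<lambda>z. b $ i / z $ i) has_derivative (\<lambda>h. - (b $ i / (\<beta> $ i)\<^sup>2 * h $ i))) (at \<beta>)" for i
      using \<beta>_range(1)[of i]
      by (auto intro!: derivative_eq_intros bounded_linear.has_derivative[OF bounded_linear_vec_nth]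
          simp: divide_inverse power2_eq_square)
    then show "((\<lambda>z. \<chi> i. b $ i / z $ i) has_derivative (\<lambda>h. \<chi> i. - (b $ i / (\<beta> $ i)\<^sup>2 * h $ i))) (at \<beta>)"
      by (subst has_derivative_componentwise_within) (auto simp: Basis_vec_def inner_axis)
  qed
  also have "(\<lambda>h. A *v h - (\<chi> i. - (b $ i / (\<beta> $ i)\<^sup>2 * h $ i))) = (\<lambda>h. (A + barrier) *v h)"
    by (simp add: fun_eq_iff vec_eq_iff matrix_vector_mult_add_rdistrib barrier_vec)
  finally have "(gradient (dual_H M b v s) has_derivative (\<lambda>h. (A + barrier) *v h)) (at \<beta>)"
    by (rule has_derivative_transform_within_open[OF _ V(1,2)]) (simp add: gradient_dual)
  then have "frechet_derivative (gradient (dual_H M b v s)) (at \<beta>) = (\<lambda>h. (A + barrier) *v h)"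
    by (rule frechet_derivative_at[symmetric])
  then show ?thesis
    by (simp add: hessian_def jacobian_def matrix_of_matrix_vector_mul)
qed

lemma H_vec: "(H *v h) $ i = (A *v h) $ i + b $ i / (\<beta> $ i)\<^sup>2 * h $ i"
  by (simp add: H_eq matrix_vector_mult_add_rdistrib barrier_vec)

lemma H_symmetric: "transpose H = H"
  unfolding H_eq transpose_add A_symmetric
  by (auto simp: barrier_def transpose_def vec_eq_iff)

lemma H_pos: "h \<noteq> 0 \<Longrightarrow> 0 < h \<bullet> (H *v h)"
proof -
  assume "h \<noteq> 0"
  then obtain i where i: "h $ i \<noteq> 0" by (auto simp: vec_eq_iff)
  have "h \<bullet> (barrier *v h) = (\<Sum>i\<in>UNIV. b $ i / (\<beta> $ i)\<^sup>2 * (h $ i)\<^sup>2)"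
    by (simp add: inner_vec_def barrier_vec power2_eq_square mult_ac)
  also have "\<dots> > 0"
  proof (rule sum_pos2[of UNIV i])
    show "0 < b $ i / (\<beta> $ i)\<^sup>2 * (h $ i)\<^sup>2"
      using i b_pos[of i] \<beta>_range(1)[of i] by (intro mult_pos_pos divide_pos_pos) auto
    show "0 \<le> b $ j / (\<beta> $ j)\<^sup>2 * (h $ j)\<^sup>2" for j using b_pos[of j] by simp
  qed auto
  finally show "0 < h \<bullet> (H *v h)"
    using A_psd[of h] by (simp add: H_eq matrix_vector_mult_add_rdistrib inner_add_right)
qed

abbreviation "R \<equiv> proj \<beta>"

text \<open>By \<open>X_inverts\<close>, \<open>X\<close> inverts \<open>H\<close> on the coordinates with \<open>\<beta> i < 1\<close>.\<close>

definition X :: "real^'n^'n" where "X = pseudo_inverse (H_B M b v s \<beta>)"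

lemma X_inverts: "R ** H ** X = R" "R ** X = X" "transpose X = X"
  using pseudo_inverse_compression[OF H_pos proj_idem proj_transpose] H_symmetric
  by (auto simp: X_def H_B_def)

abbreviation "D \<equiv> D_beta M b v s \<beta> x"

lemma D_eq: "D y = - (X *v (mu v x y - m))"
  by (simp add: D_beta_def X_def)

lemma D_component: "D y $ i = - (\<Sum>j\<in>UNIV. X $ i $ j * (mu v x y $ j - m $ j))"
  by (simp add: D_eq matrix_vector_mult_def)

lemma D_measurable [measurable]: "(\<lambda>y. D y $ i) \<in> borel_measurable M"
  unfolding D_component by measurable

lemma mu_mean: "Q.expectation (\<lambda>y. mu v x y $ i) = m $ i"
  by (simp add: mu_bar_eq expect_vec_def)

lemma D_mean: "Q.expectation (\<lambda>y. D y $ i) = 0"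
  unfolding D_component using mu_integrable Q.prob_space by (simp add: mu_mean)

lemma D_bounded: "AE y in M. norm (D y) \<le> onorm ((*v) X) * (real CARD('n) * vmax + norm m)"
  using mu_bounds
proof eventually_elim
  case (elim y)
  have "norm (mu v x y) \<le> (\<Sum>i\<in>UNIV. \<bar>mu v x y $ i\<bar>)" by (rule norm_le_l1_cart)
  also have "\<dots> \<le> (\<Sum>i\<in>(UNIV::'n set). vmax)" using elim by (intro sum_mono) auto
  finally have "norm (mu v x y) \<le> real CARD('n) * vmax" by simp
  then have "norm (mu v x y - m) \<le> real CARD('n) * vmax + norm m"
    using norm_triangle_ineq4[of "mu v x y" m] by linarith
  moreover have "norm (D y) \<le> onorm ((*v) X) * norm (mu v x y - m)"
    unfolding D_eq norm_minus_cancel by (rule onorm) (rule matrix_vector_mul_bounded_linear)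
  ultimately show ?case
    by (meson mult_left_mono onorm_pos_le matrix_vector_mul_bounded_linear order_trans)
qed

lemma D_square_integrable: "integrable Q (\<lambda>y. (D y $ i)\<^sup>2)"
proof (rule bounded_integrable_Q(2)[OF D_measurable])
  show "AE y in M. \<bar>D y $ i\<bar> \<le> onorm ((*v) X) * (real CARD('n) * vmax + norm m)"
    using D_bounded by eventually_elim (meson component_le_norm_cart order_trans)
qed

text \<open>
  The leading term of \<open>sqrt t (\<beta>g t - \<beta>)\<close>.  It solves the linearised first-order conditions in
  the coordinates with \<open>\<beta> i < 1\<close> and vanishes in the others (\<open>R_H_lead\<close>, \<open>R_lead\<close>).
\<close>

definition lead :: "nat \<Rightarrow> 'w \<Rightarrow> real^'n" where "lead t \<omega> = fluct_vec t D \<omega>"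

lemma lead_eq_sum: "lead t \<omega> = (1 / sqrt (real t)) *\<^sub>R (\<Sum>\<tau><t. D (\<theta> \<tau> \<omega>))"
  by (simp add: lead_def fluct_vec_def fluct_def D_mean vec_eq_iff)

lemma lead_eq: "lead t \<omega> = - (X *v fluct_vec t (mu v x) \<omega>)"
proof -
  have "lead t \<omega> = - (X *v ((1 / sqrt (real t)) *\<^sub>R (\<Sum>\<tau><t. mu v x (\<theta> \<tau> \<omega>) - m)))"
    unfolding lead_eq_sum D_eq
    by (simp add: sum_negf matrix_vector_mult_scaleR linear_sum[OF matrix_vector_mul_linear])
  moreover have "(1 / sqrt (real t)) *\<^sub>R (\<Sum>\<tau><t. mu v x (\<theta> \<tau> \<omega>) - m) = fluct_vec t (mu v x) \<omega>"
    by (simp add: fluct_vec_def fluct_def mu_mean vec_eq_iff)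
  ultimately show ?thesis by simp
qed

lemma R_lead: "R *v lead t \<omega> = lead t \<omega>"
  by (simp add: lead_eq linear_neg[OF matrix_vector_mul_linear] matrix_vector_mul_assoc X_inverts(2))

lemma R_H_lead: "R *v (H *v lead t \<omega>) = - (R *v fluct_vec t (mu v x) \<omega>)"
proof -
  have "R *v (H *v (X *v w)) = R *v w" for w
    by (simp add: matrix_vector_mul_assoc matrix_mul_assoc X_inverts(1))
  then show ?thesis
    unfolding lead_eq by (simp add: linear_neg[OF matrix_vector_mul_linear])
qed

lemma lead_tight: "tight P lead"
proof -
  have "lead = (\<lambda>t. fluct_vec t D)" by (simp add: lead_def fun_eq_iff)
  then show ?thesis using D_square_integrable by (auto intro!: fluct_vec_tight)
qed

end

section \<open>Localisation at scale \<open>1 / sqrt t\<close>\<close>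

context smooth_fppe_sample begin

text \<open>
  The subgradient \<open>xi\<close> is continuous in mean at \<open>\<beta>\<close>.  The step \<open>\<epsilon>\<close> below
  is chosen first, so that the second difference is small relative to \<open>\<epsilon>\<close>, and then \<open>z\<close> is
  taken close to \<open>\<beta>\<close> on the scale of \<open>\<epsilon>\<close>.
\<close>

lemma xi_deviation:
  assumes \<epsilon>: "0 < \<epsilon>" "\<And>i. \<epsilon> \<le> z $ i" "\<And>i. \<epsilon> \<le> \<beta> $ i"
  shows "Q.expectation (\<lambda>y. \<bar>xi z y $ i - mu v x y $ i\<bar>) * \<epsilon>
    \<le> rev_at (\<beta> + \<epsilon> *\<^sub>R axis i 1) + rev_at (\<beta> - \<epsilon> *\<^sub>R axis i 1) - 2 * rev_at \<beta> + 2 * vmax * norm (z - \<beta>)"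
proof -
  let ?F = "\<lambda>y z. top_bid v z y"
  have z0: "0 \<le> z $ j" for j using \<epsilon>(1,2) by (meson less_imp_le order_trans)
  have "AE y in M. \<bar>xi z y $ i - mu v x y $ i\<bar> * \<epsilon> \<le> ?F y (\<beta> + \<epsilon> *\<^sub>R axis i 1) + ?F y (\<beta> - \<epsilon> *\<^sub>R axis i 1)
      - 2 * ?F y \<beta> + 2 * vmax * norm (z - \<beta>)"
    using limit_supports AE_space
  proof eventually_elim
    case (elim y)
    show ?case
    proof (rule subgradient_deviation[where F="?F y", OF _ _ _ \<epsilon>])
      fix z' assume nn: "\<forall>i. 0 \<le> (z' :: real^'n) $ i"
      show "?F y z + xi z y \<bullet> (z' - z) \<le> ?F y z'"
        unfolding xi_def using z0 nn v_nonneg[OF elim(2)]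
        by (intro supports_subgradient supports_argmax_share) auto
      show "?F y \<beta> + mu v x y \<bullet> (z' - \<beta>) \<le> ?F y z'"
        unfolding mu_def using \<beta>_range nn v_nonneg[OF elim(2)]
        by (intro supports_subgradient elim(1)) auto
    qed (rule top_bid_lipschitz_vmax[OF elim(2)])
  qed
  then have ae: "AE y in Q. \<bar>xi z y $ i - mu v x y $ i\<bar> * \<epsilon> \<le> ?F y (\<beta> + \<epsilon> *\<^sub>R axis i 1) + ?F y (\<beta> - \<epsilon> *\<^sub>R axis i 1)
      - 2 * ?F y \<beta> + 2 * vmax * norm (z - \<beta>)" by (rule AE_Q)
  have "Q.expectation (\<lambda>y. \<bar>xi z y $ i - mu v x y $ i\<bar> * \<epsilon>) \<le>
      Q.expectation (\<lambda>y. ?F y (\<beta> + \<epsilon> *\<^sub>R axis i 1) + ?F y (\<beta> - \<epsilon> *\<^sub>R axis i 1)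
      - 2 * ?F y \<beta> + 2 * vmax * norm (z - \<beta>))"
    by (rule integral_mono_AE[OF _ _ ae]) (use xi_integrable mu_integrable top_bid_integrable in auto)
  then show ?thesis
    using top_bid_integrable Q.prob_space by (simp add: rev_at_def)
qed

lemma xi_L1_convergence:
  assumes z: "z \<longlonglongrightarrow> \<beta>"
  shows "(\<lambda>t. Q.expectation (\<lambda>y. \<bar>xi (z t) y $ i - mu v x y $ i\<bar>)) \<longlonglongrightarrow> 0"
proof (rule tendstoI)
  fix e :: real assume e: "0 < e"
  let ?sd = "\<lambda>\<epsilon>. rev_at (\<beta> + \<epsilon> *\<^sub>R axis i 1) + rev_at (\<beta> - \<epsilon> *\<^sub>R axis i 1) - 2 * rev_at \<beta>"
  define \<beta>min where "\<beta>min = Min (range (\<lambda>i. \<beta> $ i))"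
  have \<beta>min: "0 < \<beta>min" "\<beta>min \<le> \<beta> $ j" for j
    unfolding \<beta>min_def using \<beta>_range(1) by auto
  have "\<forall>\<^sub>F \<epsilon> in at_right 0. dist (?sd \<epsilon> / \<epsilon>) 0 < e / 2"
    using second_difference_vanishes[OF gradient_U[OF \<beta>_in_U], of "axis i 1"] e by (intro tendstoD) auto
  moreover have "\<forall>\<^sub>F \<epsilon> in at_right 0. 0 < \<epsilon> \<and> \<epsilon> < \<beta>min / 2"
    using \<beta>min(1) by (auto simp: eventually_at_right_field intro!: exI[of _ "\<beta>min / 2"])
  ultimately have "\<forall>\<^sub>F \<epsilon> in at_right 0. dist (?sd \<epsilon> / \<epsilon>) 0 < e / 2 \<and> 0 < \<epsilon> \<and> \<epsilon> < \<beta>min / 2"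
    by (rule eventually_conj)
  from eventually_happens'[OF trivial_limit_at_right_real this]
  obtain \<epsilon> where \<epsilon>: "dist (?sd \<epsilon> / \<epsilon>) 0 < e / 2" "0 < \<epsilon>" "\<epsilon> < \<beta>min / 2"
    by blast
  (* the first bound keeps z t away from the boundary of the orthant, the second one makes the
     Lipschitz term at most e \<epsilon> / 2; vmax + 1 is positive even if all valuations vanish *)
  define \<delta> where "\<delta> = min (\<beta>min / 2) (\<epsilon> * e / (4 * (vmax + 1)))"
  have \<delta>: "0 < \<delta>" unfolding \<delta>_def using \<beta>min(1) \<epsilon>(2) e vmax(1) by (auto intro!: divide_pos_pos mult_pos_pos)
  from tendstoD[OF z \<delta>]
  show "\<forall>\<^sub>F t in sequentially. dist (Q.expectation (\<lambda>y. \<bar>xi (z t) y $ i - mu v x y $ i\<bar>)) 0 < e"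
  proof eventually_elim
    case (elim t)
    then have n: "norm (z t - \<beta>) < \<delta>" by (simp add: dist_norm)
    have zt: "\<epsilon> \<le> z t $ j" for j
    proof -
      have "\<bar>z t $ j - \<beta> $ j\<bar> \<le> norm (z t - \<beta>)"
        using component_le_norm_cart[of "z t - \<beta>" j] by simp
      moreover have "\<delta> \<le> \<beta>min / 2" unfolding \<delta>_def by (rule min.cobounded1)
      ultimately show ?thesis using n \<beta>min(2)[of j] \<epsilon>(3) by linarith
    qed
    have \<beta>\<epsilon>: "\<epsilon> \<le> \<beta> $ j" for j using \<epsilon>(3) \<beta>min(1) \<beta>min(2)[of j] by linarith
    have "?sd \<epsilon> < e / 2 * \<epsilon>"
    proof -
      have "?sd \<epsilon> / \<epsilon> < e / 2" using \<epsilon>(1) unfolding dist_real_def by linarith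
      then show ?thesis using \<epsilon>(2) by (simp only: pos_divide_less_eq)
    qed
    moreover have "2 * vmax * norm (z t - \<beta>) \<le> e / 2 * \<epsilon>"
    proof -
      have "2 * vmax * norm (z t - \<beta>) \<le> 2 * (vmax + 1) * \<delta>"
        using n vmax(1) by (intro mult_mono) auto
      also have "\<dots> \<le> 2 * (vmax + 1) * (\<epsilon> * e / (4 * (vmax + 1)))"
        using vmax(1) by (intro mult_left_mono) (auto simp: \<delta>_def)
      also have "\<dots> = e / 2 * \<epsilon>" using vmax(1) by (simp add: field_simps)
      finally show ?thesis .
    qed
    ultimately have "Q.expectation (\<lambda>y. \<bar>xi (z t) y $ i - mu v x y $ i\<bar>) * \<epsilon> < e * \<epsilon>"
      using xi_deviation[OF \<epsilon>(2) zt \<beta>\<epsilon>, of i] by linarith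
    then show ?case using \<epsilon>(2) by (simp add: dist_real_def)
  qed
qed

lemma xi_diff_square_integrable: "integrable Q (\<lambda>y. (xi z y $ i - mu v x y $ i)\<^sup>2)"
proof (rule bounded_integrable_Q(2)[where B=vmax])
  show "AE y in M. \<bar>xi z y $ i - mu v x y $ i\<bar> \<le> vmax"
    using mu_bounds AE_space
  proof eventually_elim
    case (elim y)
    then have "0 \<le> mu v x y $ i \<and> mu v x y $ i \<le> vmax" by blast
    then show ?case using xi_bounds[OF elim(2), of z i] by (simp add: abs_le_iff)
  qed
qed simp

lemma xi_L2_convergence:
  assumes z: "z \<longlonglongrightarrow> \<beta>"
  shows "(\<lambda>t. Q.expectation (\<lambda>y. (xi (z t) y $ i - mu v x y $ i)\<^sup>2)) \<longlonglongrightarrow> 0"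
proof (rule tendsto_sandwich[OF _ _ tendsto_const])
  show "(\<lambda>t. vmax * Q.expectation (\<lambda>y. \<bar>xi (z t) y $ i - mu v x y $ i\<bar>)) \<longlonglongrightarrow> 0"
    by (rule tendsto_mult_right_zero[OF xi_L1_convergence[OF z]])
  show "\<forall>\<^sub>F t in sequentially. Q.expectation (\<lambda>y. (xi (z t) y $ i - mu v x y $ i)\<^sup>2) \<le> vmax * Q.expectation (\<lambda>y. \<bar>xi (z t) y $ i - mu v x y $ i\<bar>)"
  proof (intro always_eventually allI)
    fix t
    have "AE y in M. (xi (z t) y $ i - mu v x y $ i)\<^sup>2 \<le> vmax * \<bar>xi (z t) y $ i - mu v x y $ i\<bar>"
      using mu_bounds AE_space
    proof eventually_elim
      case (elim y)
      then have "0 \<le> mu v x y $ i \<and> mu v x y $ i \<le> vmax" by blast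
      then have "\<bar>xi (z t) y $ i - mu v x y $ i\<bar> \<le> vmax"
        using xi_bounds[OF elim(2), of "z t" i] by (simp add: abs_le_iff)
      then have "\<bar>xi (z t) y $ i - mu v x y $ i\<bar> * \<bar>xi (z t) y $ i - mu v x y $ i\<bar> \<le> vmax * \<bar>xi (z t) y $ i - mu v x y $ i\<bar>"
        by (rule mult_right_mono) simp
      then show ?case by (simp add: power2_eq_square)
    qed
    from AE_Q[OF this]
    have "Q.expectation (\<lambda>y. (xi (z t) y $ i - mu v x y $ i)\<^sup>2) \<le> Q.expectation (\<lambda>y. vmax * \<bar>xi (z t) y $ i - mu v x y $ i\<bar>)"
      by (rule integral_mono_AE[rotated 2]) (use xi_diff_square_integrable xi_integrable mu_integrable in auto)
    then show "Q.expectation (\<lambda>y. (xi (z t) y $ i - mu v x y $ i)\<^sup>2) \<le> vmax * Q.expectation (\<lambda>y. \<bar>xi (z t) y $ i - mu v x y $ i\<bar>)"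
      by simp
  qed
qed simp

definition shifted :: "real^'n \<Rightarrow> nat \<Rightarrow> real^'n" where
  "shifted u t = \<beta> + (1 / sqrt (real t)) *\<^sub>R u"

lemma inverse_sqrt_tendsto: "filterlim (\<lambda>t. 1 / sqrt (real t)) (at_right 0) sequentially"
  by real_asymp

lemma shifted_tendsto: "shifted u \<longlonglongrightarrow> \<beta>"
proof -
  have "(\<lambda>t. 1 / sqrt (real t)) \<longlonglongrightarrow> 0" by real_asymp
  then have "(\<lambda>t. \<beta> + (1 / sqrt (real t)) *\<^sub>R u) \<longlonglongrightarrow> \<beta> + 0 *\<^sub>R u" by (intro tendsto_intros)
  then show ?thesis by (simp add: shifted_def[abs_def])
qed

lemma scaled_increment_tendsto:
  fixes f :: "real^'n \<Rightarrow> real"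
  assumes "(f has_derivative f') (at \<beta>)"
  shows "(\<lambda>t. sqrt (real t) * (f (shifted u t) - f \<beta>)) \<longlonglongrightarrow> f' u"
proof -
  have lin: "linear f'" using assms by (rule has_derivative_linear)
  have "((\<lambda>r. f (\<beta> + r *\<^sub>R u)) has_derivative (\<lambda>r. f' (r *\<^sub>R u))) (at 0)"
    by (rule has_derivative_compose[of "\<lambda>r. \<beta> + r *\<^sub>R u" "\<lambda>r. r *\<^sub>R u" 0 UNIV f f'])
       (use assms in \<open>auto intro!: derivative_eq_intros\<close>)
  then have "((\<lambda>r. f (\<beta> + r *\<^sub>R u)) has_field_derivative f' u) (at 0)"
    by (simp add: has_field_derivative_def linear_scale[OF lin] mult.commute[of _ "f' u"])
  then have "((\<lambda>r. (f (\<beta> + r *\<^sub>R u) - f \<beta>) / r) \<longlongrightarrow> f' u) (at_right 0)"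
    by (auto simp: has_field_derivative_iff intro: tendsto_mono[OF at_le])
  from filterlim_compose[OF this inverse_sqrt_tendsto]
  show ?thesis by (simp add: shifted_def mult.commute)
qed

lemma g_component_derivative: "((\<lambda>z. g z $ i) has_derivative (\<lambda>h. (A *v h) $ i)) (at \<beta>)"
  by (rule bounded_linear.has_derivative[OF bounded_linear_vec_nth hessian_\<beta>])

lemma barrier_derivative: "((\<lambda>z. b $ i / z $ i) has_derivative (\<lambda>h. - (b $ i / (\<beta> $ i)\<^sup>2 * h $ i))) (at \<beta>)"
  using \<beta>_range(1)[of i]
  by (auto intro!: derivative_eq_intros bounded_linear.has_derivative[OF bounded_linear_vec_nth]
      simp: divide_inverse power2_eq_square)

lemma fluct_diff:
  assumes "integrable Q f" "integrable Q h"
  shows "fluct t (\<lambda>y. f y - h y) \<omega> = fluct t f \<omega> - fluct t h \<omega>"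
  using assms
  by (simp add: fluct_def sum_subtractf[symmetric] right_diff_distrib[symmetric] diff_divide_distrib[symmetric])
     (simp add: algebra_simps)

text \<open>
  Compare the observed multipliers with the non-random point \<open>\<beta> + u / sqrt t\<close>.  There the
  residual of the first-order conditions, times \<open>sqrt t\<close>, is \<open>- R (H u + W)\<close> up to \<open>o(1)\<close>, where
  \<open>W\<close> is the fluctuation of the limit item utilities: the fluctuation of \<open>xi\<close> at the shifted
  point may be replaced by \<open>W\<close> because \<open>xi\<close> is continuous in mean square, and the deterministic
  part is differentiable.  By definition of the leading term this is \<open>- R H (u - lead)\<close>.  In the
  coordinates with \<open>\<beta> i = 1\<close> strict slackness makes the conditions hold with no residual.
\<close>

lemma localised_distance:
  assumes u: "R *v u = u" and \<epsilon>: "0 < \<epsilon>"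
  shows "whp P (\<lambda>t \<omega>. norm (sqrt (real t) *\<^sub>R (\<beta>g t \<omega> - \<beta>) - u)
    \<le> (norm (R *v (H *v (u - lead t \<omega>))) + \<epsilon>) / bmin)"
proof -
  let ?z = "shifted u"
  let ?fl = "\<lambda>i t. fluct t (\<lambda>y. xi (?z t) y $ i - mu v x y $ i)"
  let ?W = "\<lambda>t. fluct_vec t (mu v x)"
  have u0: "u $ i = 0" if "\<not> \<beta> $ i < 1" for i
    using arg_cong[OF u, of "\<lambda>y. y $ i"] that by (simp add: proj_vec)
  define n where "n = real CARD('n)"
  have n: "0 < n" by (simp add: n_def)
  have fl: "whp P (\<lambda>t \<omega>. \<bar>?fl i t \<omega>\<bar> \<le> e)" if "0 < e" for i e
    by (rule fluct_vanishing[OF _ xi_diff_square_integrable xi_L2_convergence[OF shifted_tendsto] that]) simp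
  have emp_mu: "whp P (\<lambda>t \<omega>. \<bar>emp t (\<lambda>y. mu v x y $ i) \<omega> - m $ i\<bar> \<le> e)" if "0 < e" for i e
    using emp_whp[OF _ mu_integrable(2) that, of i] by (simp add: mu_mean)
  (* the non-random part of the scaled residual, to which H u is added so that it tends to 0 *)
  define det where "det t i = sqrt (real t) * (b $ i / ?z t $ i - b $ i / \<beta> $ i)
      - sqrt (real t) * (g (?z t) $ i - g \<beta> $ i) + (H *v u) $ i" for t i
  have "(\<lambda>t. det t i) \<longlonglongrightarrow> - (b $ i / (\<beta> $ i)\<^sup>2 * u $ i) - (A *v u) $ i + (H *v u) $ i" for i
    unfolding det_def
    by (intro tendsto_intros scaled_increment_tendsto[OF barrier_derivative] scaled_increment_tendsto[OF g_component_derivative])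
  then have det: "(\<lambda>t. det t i) \<longlonglongrightarrow> 0" for i by (simp add: H_vec)
  have gz: "(\<lambda>t. g (?z t) $ i) \<longlonglongrightarrow> m $ i" for i
  proof -
    have "isCont g \<beta>" using hessian_\<beta> by (rule has_derivative_continuous)
    then have "(\<lambda>t. g (?z t)) \<longlonglongrightarrow> g \<beta>" using shifted_tendsto isCont_tendsto_compose by blast
    then show ?thesis unfolding g_\<beta> by (rule tendsto_vec_nth)
  qed
  have evV: "\<forall>\<^sub>F t in sequentially. ?z t \<in> V"
    by (rule topological_tendstoD[OF shifted_tendsto V(1,2)])
  have ev1: "\<forall>\<^sub>F t in sequentially. \<forall>i. ?z t $ i \<le> 1"
  proof (rule eventually_all_finite)
    fix i
    show "\<forall>\<^sub>F t in sequentially. ?z t $ i \<le> 1"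
    proof (cases "\<beta> $ i < 1")
      case True
      have "(\<lambda>t. ?z t $ i) \<longlonglongrightarrow> \<beta> $ i" by (rule tendsto_vec_nth[OF shifted_tendsto])
      from order_tendstoD(2)[OF this True] show ?thesis by eventually_elim simp
    next
      case False
      then show ?thesis using u0[OF False] \<beta>_range(2)[of i] by (simp add: shifted_def)
    qed
  qed
  have evd: "\<forall>\<^sub>F t in sequentially. \<forall>i. \<bar>det t i\<bar> \<le> \<epsilon> / (2 * n)"
  proof (rule eventually_all_finite)
    fix i
    have "\<forall>\<^sub>F t in sequentially. dist (det t i) 0 < \<epsilon> / (2 * n)" using det \<epsilon> n by (intro tendstoD) auto
    then show "\<forall>\<^sub>F t in sequentially. \<bar>det t i\<bar> \<le> \<epsilon> / (2 * n)" by eventually_elim simp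
  qed
  (* the slack in the coordinates at the bound; 1 stands in for it elsewhere *)
  define sl where "sl i = (if \<beta> $ i < 1 then 1 else b $ i - m $ i)" for i
  have sl: "0 < sl i" for i
    using slack[of i] \<beta>_range(2)[of i] by (auto simp: sl_def)
  have evg: "\<forall>\<^sub>F t in sequentially. \<forall>i. \<bar>g (?z t) $ i - m $ i\<bar> \<le> sl i / 3"
  proof (rule eventually_all_finite)
    fix i
    have "\<forall>\<^sub>F t in sequentially. dist (g (?z t) $ i) (m $ i) < sl i / 3" using gz sl by (intro tendstoD) auto
    then show "\<forall>\<^sub>F t in sequentially. \<bar>g (?z t) $ i - m $ i\<bar> \<le> sl i / 3"
      by eventually_elim (simp add: dist_real_def)
  qed
  have ev: "\<forall>\<^sub>F t in sequentially. (?z t \<in> V \<and> (\<forall>i. ?z t $ i \<le> 1)) \<and>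
      ((\<forall>i. \<bar>det t i\<bar> \<le> \<epsilon> / (2 * n)) \<and> (\<forall>i. \<bar>g (?z t) $ i - m $ i\<bar> \<le> sl i / 3)) \<and> 1 \<le> t"
    (is "eventually ?ev _")
    by (intro eventually_conj evV ev1 evd evg eventually_ge_at_top)
  have "whp P (\<lambda>t \<omega>. (\<forall>i. \<bar>?fl i t \<omega>\<bar> \<le> min (\<epsilon> / (2 * n)) (sl i / 3)) \<and>
      (\<forall>i. \<bar>emp t (\<lambda>y. mu v x y $ i) \<omega> - m $ i\<bar> \<le> sl i / 3))"
    (is "whp P ?wh")
    using \<epsilon> n sl by (intro P.whp_conj P.whp_All fl emp_mu) auto
  then show ?thesis
  proof (rule whp_mono, use ev in \<open>elim eventually_mono\<close>, intro ballI impI)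
    fix t \<omega>
    assume ev: "?ev t"
      and \<omega>: "\<omega> \<in> space P"
      and wh: "?wh t \<omega>"
    define q where "q = sqrt (real t)"
    have t: "t \<ge> 1" and q: "1 \<le> q" using ev by (auto simp: q_def)
    have zV: "?z t \<in> V" using ev by blast
    let ?e = "emp_vec t (xi (?z t)) \<omega>"
    have mean_xi: "Q.expectation (\<lambda>y. xi (?z t) y $ i) = g (?z t) $ i" for i
      using arg_cong[OF g_subgradient(1)[OF zV, of 0], of "\<lambda>y. y $ i"] by (simp add: expect_vec_def)
    have fl_eq: "?fl i t \<omega> = q * (?e $ i - g (?z t) $ i) - ?W t \<omega> $ i" for i
      using fluct_diff[OF xi_integrable mu_integrable(1), of t "?z t" i i \<omega>]
      by (simp add: fluct_vec_def emp_vec_def fluct_eq_emp[OF t] mean_xi q_def)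
    have W_eq: "?W t \<omega> $ i = q * (emp t (\<lambda>y. mu v x y $ i) \<omega> - m $ i)" for i
      by (simp add: fluct_vec_def fluct_eq_emp[OF t] mu_mean q_def)
    define r where "r = (\<chi> i. if \<beta> $ i < 1 then b $ i / ?z t $ i - ?e $ i else 0)"
    have active: "?e $ i \<le> b $ i" if "\<not> \<beta> $ i < 1" for i
    proof -
      define d where "d = ?e $ i - g (?z t) $ i - (emp t (\<lambda>y. mu v x y $ i) \<omega> - m $ i)"
      have "?fl i t \<omega> = q * d"
        unfolding fl_eq W_eq d_def by (simp add: right_diff_distrib)
      then have "\<bar>d\<bar> \<le> \<bar>?fl i t \<omega>\<bar>"
        using q mult_right_mono[of 1 q "\<bar>d\<bar>"] by (simp add: abs_mult)
      moreover have "\<bar>?fl i t \<omega>\<bar> \<le> sl i / 3" "\<bar>emp t (\<lambda>y. mu v x y $ i) \<omega> - m $ i\<bar> \<le> sl i / 3"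
        "\<bar>g (?z t) $ i - m $ i\<bar> \<le> sl i / 3" using wh ev by auto
      moreover have "sl i = b $ i - m $ i" using that by (simp add: sl_def)
      ultimately show ?thesis unfolding d_def by linarith
    qed
    have dist: "norm (\<beta>g t \<omega> - ?z t) \<le> norm r / bmin"
    proof (rule kkt_distance[OF kkt_observed[OF t \<omega>] bmin(2,1), where m\<^sub>0="?e"])
      fix i
      show "0 < ?z t $ i \<and> ?z t $ i \<le> 1" using V(4)[OF zV] ev by auto
      show "r $ i = b $ i / ?z t $ i - ?e $ i \<or> ?z t $ i = 1 \<and> ?e $ i \<le> b $ i \<and> r $ i = 0"
      proof (cases "\<beta> $ i < 1")
        case False
        then have "?z t $ i = 1" using u0[OF False] \<beta>_range(2)[of i] by (simp add: shifted_def)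
        then show ?thesis using active[OF False] False by (simp add: r_def)
      qed (simp add: r_def)
    next
      show "0 \<le> (obs_util t \<omega> - ?e) \<bullet> (\<beta>g t \<omega> - ?z t)"
        by (rule observed_monotone[OF t \<omega>, where w="\<lambda>\<tau>. argmax_share v (?z t) (\<theta> \<tau> \<omega>)"])
           (use V(4)[OF zV] in \<open>auto simp: supports_argmax_share xi_def less_imp_le\<close>)
    qed
    have qr: "(q *\<^sub>R r + R *v (H *v u + ?W t \<omega>)) $ i = (if \<beta> $ i < 1 then det t i - ?fl i t \<omega> else 0)" for i
    proof (cases "\<beta> $ i < 1")
      case True
      then have "m $ i = b $ i / \<beta> $ i" using kkt_limit by (simp add: kkt_def)
      then have "q * (b $ i / ?z t $ i - ?e $ i) + ((H *v u) $ i + ?W t \<omega> $ i) = det t i - ?fl i t \<omega>"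
        unfolding det_def fl_eq g_\<beta> q_def[symmetric] by (simp add: algebra_simps)
      then show ?thesis using True by (simp add: r_def proj_vec)
    qed (simp add: r_def proj_vec)
    have "norm (q *\<^sub>R r + R *v (H *v u + ?W t \<omega>)) \<le> (\<Sum>i\<in>UNIV. \<bar>(q *\<^sub>R r + R *v (H *v u + ?W t \<omega>)) $ i\<bar>)"
      by (rule norm_le_l1_cart)
    also have "\<dots> \<le> (\<Sum>i\<in>(UNIV::'n set). \<epsilon> / n)"
    proof (rule sum_mono)
      fix i
      have "\<bar>det t i\<bar> \<le> \<epsilon> / (2 * n)" "\<bar>?fl i t \<omega>\<bar> \<le> \<epsilon> / (2 * n)" using wh ev by auto
      moreover have "\<epsilon> / (2 * n) + \<epsilon> / (2 * n) = \<epsilon> / n" using n by (simp add: field_simps)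
      ultimately show "\<bar>(q *\<^sub>R r + R *v (H *v u + ?W t \<omega>)) $ i\<bar> \<le> \<epsilon> / n"
        unfolding qr using \<epsilon> n by (auto simp: abs_le_iff)
    qed
    also have "\<dots> = \<epsilon>" using n by (simp add: n_def)
    finally have close: "norm (q *\<^sub>R r + R *v (H *v u + ?W t \<omega>)) \<le> \<epsilon>" .
    have "R *v (H *v u + ?W t \<omega>) = R *v (H *v (u - lead t \<omega>))"
      by (simp add: matrix_vector_right_distrib matrix_vector_mult_diff_distrib R_H_lead)
    then have nr: "norm (q *\<^sub>R r) \<le> norm (R *v (H *v (u - lead t \<omega>))) + \<epsilon>"
      using close norm_triangle_ineq4[of "q *\<^sub>R r + R *v (H *v u + ?W t \<omega>)" "R *v (H *v u + ?W t \<omega>)"] by simp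
    have "sqrt (real t) *\<^sub>R (\<beta>g t \<omega> - \<beta>) - u = q *\<^sub>R (\<beta>g t \<omega> - ?z t)"
      using q by (simp add: shifted_def q_def[symmetric] algebra_simps)
    moreover have "norm (q *\<^sub>R (\<beta>g t \<omega> - ?z t)) \<le> norm (q *\<^sub>R r) / bmin"
      using mult_left_mono[OF dist, of q] q by simp
    ultimately show "norm (sqrt (real t) *\<^sub>R (\<beta>g t \<omega> - \<beta>) - u)
        \<le> (norm (R *v (H *v (u - lead t \<omega>))) + \<epsilon>) / bmin"
      using divide_right_mono[OF nr less_imp_le[OF bmin(1)]] by (simp only:)
  qed
qed

text \<open>
  The comparison point cannot be the random \<open>\<beta> + lead / sqrt t\<close> itself, so it is taken from a
  finite net of a ball in the range of \<open>R\<close>, where the leading term lies with probability close to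
  one; the error is then proportional to the mesh.
\<close>

lemma \<beta>g_expansion:
  assumes \<epsilon>: "0 < \<epsilon>"
  shows "whp P (\<lambda>t \<omega>. norm (sqrt (real t) *\<^sub>R (\<beta>g t \<omega> - \<beta>) - lead t \<omega>) \<le> \<epsilon>)"
  unfolding whp_def
proof (intro allI impI)
  fix \<delta> :: real assume \<delta>: "0 < \<delta>"
  then obtain K where K: "0 < K" "all_but P (\<delta>/2) (\<lambda>t \<omega>. norm (lead t \<omega>) \<le> K)"
    using lead_tight unfolding tight_def by (metis half_gt_zero)
  define L where "L = onorm (\<lambda>h. R *v (H *v h))"
  have bl: "bounded_linear (\<lambda>h. R *v (H *v h))"
    by (rule bounded_linear_compose[OF matrix_vector_mul_bounded_linear matrix_vector_mul_bounded_linear])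
  have L: "0 \<le> L" "\<And>h. norm (R *v (H *v h)) \<le> L * norm h"
    unfolding L_def using onorm_pos_le[OF bl] onorm[OF bl] by auto
  (* a mesh \<eta> and a residual \<eta> cost (L \<eta> + \<eta>) / bmin, and another \<eta> to go from the net to lead *)
  define c where "c = (L + 1) / bmin + 1"
  have c: "0 < c" unfolding c_def using L(1) bmin(1) by (intro add_nonneg_pos divide_nonneg_pos) auto
  define \<eta> where "\<eta> = \<epsilon> / c"
  have \<eta>: "0 < \<eta>" "c * \<eta> = \<epsilon>" using \<epsilon> c by (auto simp: \<eta>_def)
  let ?S = "{u. R *v u = u} \<inter> cball 0 K"
  have "closed {u. R *v u = u}"
    by (intro closed_Collect_eq continuous_intros linear_continuous_on matrix_vector_mul_bounded_linear)
  then have "compact ?S" by (intro closed_Int_compact compact_cball)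
  then have "seq_compact ?S" by (simp only: compact_eq_seq_compact_metric)
  from seq_compact_imp_totally_bounded[OF this, rule_format, OF \<eta>(1)]
  obtain T where T: "finite T" "T \<subseteq> ?S" "?S \<subseteq> (\<Union>u\<in>T. ball u \<eta>)" by blast
  have "whp P (\<lambda>t \<omega>. \<forall>u\<in>T. norm (sqrt (real t) *\<^sub>R (\<beta>g t \<omega> - \<beta>) - u)
      \<le> (norm (R *v (H *v (u - lead t \<omega>))) + \<eta>) / bmin)"
    (is "whp P ?near")
    using T(2) \<eta>(1) by (intro P.whp_Ball T(1) localised_distance) auto
  then have "all_but P (\<delta>/2) ?near" using \<delta> by (intro whpD) auto
  from P.all_but_conj[OF K(2) this]
  have "all_but P \<delta> (\<lambda>t \<omega>. norm (lead t \<omega>) \<le> K \<and> ?near t \<omega>)" by simp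
  then show "all_but P \<delta> (\<lambda>t \<omega>. norm (sqrt (real t) *\<^sub>R (\<beta>g t \<omega> - \<beta>) - lead t \<omega>) \<le> \<epsilon>)"
  proof (rule all_but_mono, intro always_eventually allI ballI impI)
    fix t \<omega>
    assume *: "norm (lead t \<omega>) \<le> K \<and> ?near t \<omega>"
    then have "lead t \<omega> \<in> ?S" using R_lead by simp
    then obtain u where u: "u \<in> T" "norm (u - lead t \<omega>) < \<eta>" using T(3) by (auto simp: dist_norm)
    have "norm (R *v (H *v (u - lead t \<omega>))) \<le> L * \<eta>"
      using L(2)[of "u - lead t \<omega>"] mult_left_mono[OF less_imp_le[OF u(2)] L(1)] by linarith
    then have "(norm (R *v (H *v (u - lead t \<omega>))) + \<eta>) / bmin \<le> (L * \<eta> + \<eta>) / bmin"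
      using bmin(1) by (intro divide_right_mono) auto
    then have "norm (sqrt (real t) *\<^sub>R (\<beta>g t \<omega> - \<beta>) - u) \<le> (L * \<eta> + \<eta>) / bmin"
      using * u(1) by (meson order_trans)
    moreover have "(L * \<eta> + \<eta>) / bmin + \<eta> = c * \<eta>" by (simp add: c_def distrib_right)
    moreover have "norm (sqrt (real t) *\<^sub>R (\<beta>g t \<omega> - \<beta>) - lead t \<omega>)
        \<le> norm (sqrt (real t) *\<^sub>R (\<beta>g t \<omega> - \<beta>) - u) + norm (u - lead t \<omega>)"
      using norm_triangle_ineq[of "sqrt (real t) *\<^sub>R (\<beta>g t \<omega> - \<beta>) - u" "u - lead t \<omega>"] by simp
    ultimately show "norm (sqrt (real t) *\<^sub>R (\<beta>g t \<omega> - \<beta>) - lead t \<omega>) \<le> \<epsilon>"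
      using u(2) \<eta>(2) by linarith
  qed
qed

end

section \<open>Asymptotic linearity and normality\<close>

context smooth_fppe_sample begin

text \<open>
  The subgradients at \<open>\<beta>\<close> and at the observed multipliers bound the increment of the sampled
  revenue from below and from above.  By the budget conditions the upper bound is at most
  \<open>m \<bullet> (\<beta>g - \<beta>)\<close>; the lower bound falls short of it by a product of two quantities of
  order \<open>1 / sqrt t\<close>.
\<close>

lemma REV_increment:
  assumes t: "t \<ge> 1" and \<omega>: "\<omega> \<in> space P" "regular_point \<omega>"
  shows "sqrt (real t) * \<bar>emp t (top_bid v (\<beta>g t \<omega>)) \<omega> - emp t (top_bid v \<beta>) \<omega> - m \<bullet> (\<beta>g t \<omega> - \<beta>)\<bar>
    \<le> norm (fluct_vec t (mu v x) \<omega>) * norm (\<beta>g t \<omega> - \<beta>)"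
proof -
  let ?h = "\<beta>g t \<omega> - \<beta>" and ?e = "emp_vec t (mu v x) \<omega>"
  let ?d = "emp t (top_bid v (\<beta>g t \<omega>)) \<omega> - emp t (top_bid v \<beta>) \<omega>"
  have lower: "?e \<bullet> ?h \<le> ?d"
    using emp_subgradient[OF \<omega>(1), of \<beta> "\<lambda>\<tau> i. x i (\<theta> \<tau> \<omega>)" "mu v x" "\<beta>g t \<omega>" t]
      \<omega>(2) \<beta>_range \<beta>g_range[OF t \<omega>(1)] by (auto simp: regular_point_def mu_def)
  have "emp t (top_bid v (\<beta>g t \<omega>)) \<omega> + obs_util t \<omega> \<bullet> (\<beta> - \<beta>g t \<omega>) \<le> emp t (top_bid v \<beta>) \<omega>"
    by (rule observed_subgradient[OF t \<omega>(1) \<beta>_range(3)])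
  then have "?d \<le> obs_util t \<omega> \<bullet> ?h" by (simp add: inner_diff_right)
  also have "\<dots> = ?e \<bullet> ?h + (obs_util t \<omega> - ?e) \<bullet> ?h" by (simp add: inner_diff_left)
  also have "\<dots> \<le> ?e \<bullet> ?h + (m - ?e) \<bullet> ?h"
  proof -
    have "0 \<le> bmin * (norm ?h)\<^sup>2" using bmin(1) by simp
    then show ?thesis
      using kkt_compare[OF kkt_observed[OF t \<omega>(1)] kkt_limit bmin(2,1), of ?e] by linarith
  qed
  also have "\<dots> = m \<bullet> ?h" by (simp add: inner_diff_left)
  finally have upper: "?d \<le> m \<bullet> ?h" .
  have "m \<bullet> ?h - ?d \<le> (m - ?e) \<bullet> ?h" using lower by (simp add: inner_diff_left)
  also have "\<dots> \<le> norm (m - ?e) * norm ?h" by (rule norm_cauchy_schwarz)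
  finally have "\<bar>?d - m \<bullet> ?h\<bar> \<le> norm (m - ?e) * norm ?h" using upper by linarith
  then have "sqrt (real t) * \<bar>?d - m \<bullet> ?h\<bar> \<le> sqrt (real t) * (norm (m - ?e) * norm ?h)"
    by (intro mult_left_mono) auto
  then show ?thesis by (simp add: fluct_vec_eq[OF t] mu_bar_eq norm_minus_commute mult.assoc)
qed

abbreviation "DR \<equiv> D_REV M b v s \<beta> p x"

lemma p_measurable [measurable]: "p \<in> borel_measurable M"
  using limit by (auto simp: limit_FPPE_def L1_plus_def)

lemma DR_eq: "DR y = p y - rev_at \<beta> + (\<Sum>i\<in>UNIV. m $ i * D y $ i)"
  by (simp add: D_REV_def REV_eq inner_vec_def)

lemma DR_measurable [measurable]: "DR \<in> borel_measurable M"
  unfolding DR_eq[abs_def] by measurable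

lemma p_integrable: "integrable Q p" "Q.expectation p = rev_at \<beta>"
proof -
  have ae: "AE y in Q. p y = top_bid v \<beta> y" by (rule AE_Q[OF price_AE])
  show "integrable Q p" "Q.expectation p = rev_at \<beta>"
    using ae top_bid_integrable(1)[of \<beta>]
    by (auto simp: rev_at_def intro: integrable_cong_AE_imp[where g="top_bid v \<beta>"] integral_cong_AE)
qed

lemma D_integrable: "integrable Q (\<lambda>y. D y $ i)"
  by (rule Q.square_integrable_imp_integrable[OF _ D_square_integrable]) simp

lemma DR_mean: "Q.expectation DR = 0"
  unfolding DR_eq[abs_def] using p_integrable D_integrable Q.prob_space by (simp add: D_mean)

lemma DR_square_integrable: "integrable Q (\<lambda>y. (DR y)\<^sup>2)"
proof -
  obtain B where B: "AE y in M. norm (D y) \<le> B" using D_bounded by blast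
  have "AE y in M. \<bar>DR y\<bar> \<le> vmax * norm \<beta> + \<bar>rev_at \<beta>\<bar> + norm m * B"
    using B price_AE AE_space
  proof eventually_elim
    case (elim y)
    have "\<bar>p y\<bar> \<le> vmax * norm \<beta>" using elim top_bid_bounded by simp
    moreover have "\<bar>m \<bullet> D y\<bar> \<le> norm m * norm (D y)" by (rule Cauchy_Schwarz_ineq2)
    moreover have "norm m * norm (D y) \<le> norm m * B" using elim(1) by (intro mult_left_mono) auto
    ultimately show ?case unfolding D_REV_def REV_eq by linarith
  qed
  then show ?thesis by (rule bounded_integrable_Q(2)[OF DR_measurable])
qed

lemma fluct_DR_eq_sum: "fluct t DR \<omega> = (1 / sqrt (real t)) * (\<Sum>\<tau><t. DR (\<theta> \<tau> \<omega>))"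
  by (simp add: fluct_def DR_mean)

lemma fluct_DR:
  assumes t: "t \<ge> 1" and \<omega>: "regular_point \<omega>"
  shows "fluct t DR \<omega> = sqrt (real t) * (emp t (top_bid v \<beta>) \<omega> - rev_at \<beta>) + m \<bullet> lead t \<omega>"
proof -
  have "fluct t DR \<omega> = (1 / sqrt (real t)) * (\<Sum>\<tau><t. (top_bid v \<beta> (\<theta> \<tau> \<omega>) - rev_at \<beta>) + m \<bullet> D (\<theta> \<tau> \<omega>))"
    unfolding fluct_DR_eq_sum D_REV_def REV_eq using \<omega> by (simp add: regular_point_def)
  also have "\<dots> = fluct t (top_bid v \<beta>) \<omega> + m \<bullet> lead t \<omega>"
    by (simp add: lead_eq_sum fluct_def rev_at_def sum.distrib add_divide_distrib inner_sum_right)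
  finally show ?thesis by (simp add: fluct_eq_emp[OF t] rev_at_def)
qed

lemma REV_expansion:
  assumes \<epsilon>: "0 < \<epsilon>"
  shows "whp P (\<lambda>t \<omega>. \<bar>sqrt (real t) * (observed_REV t (pg t \<omega>) - REV M s p) - fluct t DR \<omega>\<bar> \<le> \<epsilon>)"
  unfolding whp_def
proof (intro allI impI)
  fix \<delta> :: real assume \<delta>: "0 < \<delta>"
  then obtain K where K: "0 < K" "all_but P (\<delta>/2) (\<lambda>t \<omega>. norm (fluct_vec t (mu v x) \<omega>) \<le> K)"
    using mu_fluct_tight unfolding tight_def by (metis half_gt_zero)
  define e1 where "e1 = \<epsilon> / (2 * (norm m + 1))"
  define e2 where "e2 = \<epsilon> / (2 * K)"
  have e: "0 < e1" "0 < e2" unfolding e1_def e2_def using \<epsilon> K(1) by (auto intro!: divide_pos_pos add_nonneg_pos)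
  have e1: "norm m * e1 \<le> \<epsilon> / 2"
  proof -
    have "norm m * e1 \<le> (norm m + 1) * e1" using e(1) by simp
    also have "\<dots> = \<epsilon> / 2"
    proof -
      have "norm m + 1 \<noteq> 0" using norm_ge_zero[of m] by linarith
      then have "k \<noteq> 0 \<Longrightarrow> k * (\<epsilon> / (2 * k)) = \<epsilon> / 2" for k :: real by simp
      from this[OF \<open>norm m + 1 \<noteq> 0\<close>] show ?thesis by (simp only: e1_def)
    qed
    finally show ?thesis .
  qed
  have e2: "K * e2 = \<epsilon> / 2" using K(1) by (simp add: e2_def)
  have "whp P (\<lambda>t \<omega>. norm (sqrt (real t) *\<^sub>R (\<beta>g t \<omega> - \<beta>) - lead t \<omega>) \<le> e1 \<and> norm (\<beta>g t \<omega> - \<beta>) \<le> e2 \<and> regular_point \<omega>)"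
    by (intro P.whp_conj \<beta>g_expansion \<beta>g_close P.whp_AE AE_regular_point e)
  from P.all_but_conj[OF K(2) whpD[OF this half_gt_zero[OF \<delta>]]]
  have "all_but P \<delta> (\<lambda>t \<omega>. norm (fluct_vec t (mu v x) \<omega>) \<le> K \<and> norm (sqrt (real t) *\<^sub>R (\<beta>g t \<omega> - \<beta>) - lead t \<omega>) \<le> e1
      \<and> norm (\<beta>g t \<omega> - \<beta>) \<le> e2 \<and> regular_point \<omega>)"
    (is "all_but P _ ?E") by simp
  then show "all_but P \<delta> (\<lambda>t \<omega>. \<bar>sqrt (real t) * (observed_REV t (pg t \<omega>) - REV M s p) - fluct t DR \<omega>\<bar> \<le> \<epsilon>)"
  proof (rule all_but_mono, use eventually_ge_at_top[of "1::nat"] in \<open>elim eventually_mono\<close>, intro ballI impI)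
    fix t \<omega> assume t: "(1::nat) \<le> t" and \<omega>: "\<omega> \<in> space P"
      and *: "?E t \<omega>"
    define q where "q = sqrt (real t)"
    define d where "d = emp t (top_bid v (\<beta>g t \<omega>)) \<omega> - emp t (top_bid v \<beta>) \<omega> - m \<bullet> (\<beta>g t \<omega> - \<beta>)"
    have "q * \<bar>d\<bar> \<le> norm (fluct_vec t (mu v x) \<omega>) * norm (\<beta>g t \<omega> - \<beta>)"
      unfolding q_def d_def using REV_increment[OF t \<omega>] * by blast
    also have "\<dots> \<le> K * e2" using * K(1) by (intro mult_mono) auto
    finally have A: "q * \<bar>d\<bar> \<le> \<epsilon> / 2" by (simp only: e2)
    have "\<bar>m \<bullet> (q *\<^sub>R (\<beta>g t \<omega> - \<beta>) - lead t \<omega>)\<bar> \<le> norm m * norm (q *\<^sub>R (\<beta>g t \<omega> - \<beta>) - lead t \<omega>)"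
      by (rule Cauchy_Schwarz_ineq2)
    also have "\<dots> \<le> norm m * e1" using * by (intro mult_left_mono) (auto simp: q_def)
    finally have B: "\<bar>m \<bullet> (q *\<^sub>R (\<beta>g t \<omega> - \<beta>) - lead t \<omega>)\<bar> \<le> \<epsilon> / 2" using e1 by linarith
    have "q * (observed_REV t (pg t \<omega>) - REV M s p) - fluct t DR \<omega>
        = q * d + m \<bullet> (q *\<^sub>R (\<beta>g t \<omega> - \<beta>) - lead t \<omega>)"
      using * by (simp add: observed_REV_eq[OF t \<omega>] REV_eq fluct_DR[OF t] d_def q_def[symmetric]
          inner_diff_right right_diff_distrib)
    moreover have "\<bar>q * d\<bar> = q * \<bar>d\<bar>" by (simp add: abs_mult q_def)
    ultimately show "\<bar>sqrt (real t) * (observed_REV t (pg t \<omega>) - REV M s p) - fluct t DR \<omega>\<bar> \<le> \<epsilon>"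
      unfolding q_def[symmetric] using A B by linarith
  qed
qed

lemma scaled_\<beta>g_measurable: "t \<ge> 1 \<Longrightarrow> (\<lambda>\<omega>. sqrt (real t) *\<^sub>R (\<beta>g t \<omega> - \<beta>)) \<in> borel_measurable P"
  using \<beta>g_measurable[of t] by measurable

lemma lead_measurable: "lead t \<in> borel_measurable P"
proof (rule vec_borel_measurable)
  show "(\<lambda>\<omega>. lead t \<omega> $ i) \<in> borel_measurable P" for i
    by (simp add: lead_def fluct_vec_def)
qed

theorem \<beta>g_asymptotically_linear:
  "tendsto_in_prob P (\<lambda>t \<omega>. sqrt (real t) *\<^sub>R (\<beta>g t \<omega> - \<beta>)
     - (1 / sqrt (real t)) *\<^sub>R (\<Sum>\<tau><t. D (\<theta> \<tau> \<omega>))) 0"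
  unfolding P.tendsto_in_prob_iff_whp lead_eq_sum[symmetric]
  using borel_measurable_diff[OF scaled_\<beta>g_measurable lead_measurable] \<beta>g_expansion by simp

lemma scaled_REV_measurable:
  "(\<lambda>\<omega>. sqrt (real t) * (observed_REV t (pg t \<omega>) - REV M s p)) \<in> borel_measurable P"
  (* for t = 0 the factor sqrt t makes the variable constant *)
  using observed_REV_measurable[of t] by (cases "t = 0") auto

theorem REV_asymptotically_linear:
  "tendsto_in_prob P (\<lambda>t \<omega>. sqrt (real t) * (observed_REV t (pg t \<omega>) - REV M s p)
     - (1 / sqrt (real t)) * (\<Sum>\<tau><t. DR (\<theta> \<tau> \<omega>))) 0"
  unfolding P.tendsto_in_prob_iff_whp fluct_DR_eq_sum[symmetric]
  using borel_measurable_diff[OF scaled_REV_measurable fluct_measurable[of DR]] REV_expansion by simp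

theorem \<beta>g_asymptotically_normal:
  "\<exists>N. is_normal_law N 0 (Sigma_beta M b v s \<beta> x) \<and>
     tendsto_in_law P (\<lambda>t \<omega>. sqrt (real t) *\<^sub>R (\<beta>g t \<omega> - \<beta>)) N"
proof (rule asymptotically_normal_vec[of D])
  show "Sigma_beta M b v s \<beta> x = (\<chi> i j. Q.expectation (\<lambda>y. D y $ i * D y $ j))"
    by (simp add: Sigma_beta_def Es_eq)
  fix \<epsilon> :: real assume "0 < \<epsilon>"
  then show "whp P (\<lambda>t \<omega>. norm (sqrt (real t) *\<^sub>R (\<beta>g t \<omega> - \<beta>) - fluct_vec t D \<omega>) \<le> \<epsilon>)"
    using \<beta>g_expansion by (simp add: lead_def)
qed (use D_square_integrable D_mean scaled_\<beta>g_measurable in auto)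

theorem REV_asymptotically_normal:
  "weak_conv_m (\<lambda>t. distr P borel (\<lambda>\<omega>. sqrt (real t) * (observed_REV t (pg t \<omega>) - REV M s p)))
     (normal_law 0 (sigma2_REV M b v s \<beta> p x))"
proof -
  have "sigma2_REV M b v s \<beta> p x = Q.variance DR"
    by (simp add: sigma2_REV_def Es_eq DR_mean)
  then show ?thesis
    using asymptotically_normal_real[of DR, OF _ DR_square_integrable scaled_REV_measurable REV_expansion] by simp
qed

theorem Sigma_beta_sandwich:
  "Sigma_beta M b v s \<beta> x =
     pseudo_inverse (H_B M b v s \<beta>) ** Var_mat M s (mu v x) ** pseudo_inverse (H_B M b v s \<beta>)"
proof -
  define c where "c i y = mu v x y $ i - m $ i" for i y
  have [measurable]: "c i \<in> borel_measurable M" for i unfolding c_def[abs_def] by measurable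
  have cb: "AE y in M. \<bar>c i y\<bar> \<le> vmax + norm m" for i
    using mu_bounds
  proof eventually_elim
    case (elim y)
    have "0 \<le> mu v x y $ i \<and> mu v x y $ i \<le> vmax" using elim by blast
    then show ?case using component_le_norm_cart[of m i] by (simp add: c_def abs_le_iff)
  qed
  have int: "integrable Q (\<lambda>y. c k y * c l y)" for k l
  proof (rule bounded_integrable_Q(1))
    show "AE y in M. \<bar>c k y * c l y\<bar> \<le> (vmax + norm m) * (vmax + norm m)"
      using cb[of k] cb[of l] by eventually_elim (simp add: abs_mult mult_mono')
  qed measurable
  have Var: "Var_mat M s (mu v x) $ k $ l = Q.expectation (\<lambda>y. c k y * c l y)" for k l
    by (simp add: Var_mat_def Es_eq mu_mean c_def)
  have Xs: "X $ i $ j = X $ j $ i" for i j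
    using arg_cong[OF X_inverts(3), of "\<lambda>Y. Y $ j $ i"] by (simp add: transpose_def)
  have DD: "D y $ i * D y $ j = (\<Sum>k\<in>UNIV. \<Sum>l\<in>UNIV. X $ i $ k * X $ l $ j * (c k y * c l y))" for i j y
  proof -
    have "D y $ i * D y $ j = (\<Sum>k\<in>UNIV. X $ i $ k * c k y) * (\<Sum>l\<in>UNIV. X $ j $ l * c l y)"
      unfolding D_component c_def by simp
    then show ?thesis
      unfolding sum_product Xs[of j] by (simp only: mult_ac)
  qed
  have "Sigma_beta M b v s \<beta> x $ i $ j = (X ** Var_mat M s (mu v x) ** X) $ i $ j" for i j
  proof -
    have "Sigma_beta M b v s \<beta> x $ i $ j = Q.expectation (\<lambda>y. D y $ i * D y $ j)"
      by (simp add: Sigma_beta_def Es_eq)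
    also have "\<dots> = (\<Sum>k\<in>UNIV. \<Sum>l\<in>UNIV. X $ i $ k * X $ l $ j * Q.expectation (\<lambda>y. c k y * c l y))"
      unfolding DD using int by simp
    also have "\<dots> = (\<Sum>l\<in>UNIV. \<Sum>k\<in>UNIV. X $ i $ k * X $ l $ j * Q.expectation (\<lambda>y. c k y * c l y))"
      by (rule sum.swap)
    also have "\<dots> = (X ** Var_mat M s (mu v x) ** X) $ i $ j"
      by (simp add: matrix_matrix_mult_def Var sum_distrib_right sum_distrib_left mult_ac)
    finally show ?thesis .
  qed
  then show ?thesis by (simp add: vec_eq_iff X_def)
qed

end

text \<open>
  (SMO) supplies a gradient of the expected top bid near \<open>\<beta>\<close> and the derivative of this gradient
  at \<open>\<beta>\<close>; by (SCS) a buyer with multiplier one has item utility strictly below the budget.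
\<close>

theorem theorem1:
  fixes M :: "'t measure" and b :: "real^'n" and v :: "'n \<Rightarrow> 't \<Rightarrow> real" and s :: "'t \<Rightarrow> real"
    and \<beta> :: "real^'n" and p :: "'t \<Rightarrow> real" and x :: "'n \<Rightarrow> 't \<Rightarrow> real"
    and P :: "'w measure" and \<theta> :: "nat \<Rightarrow> 'w \<Rightarrow> 't"
    and \<beta>g :: "nat \<Rightarrow> 'w \<Rightarrow> real^'n"
    and pg :: "nat \<Rightarrow> 'w \<Rightarrow> nat \<Rightarrow> real"
    and xg :: "nat \<Rightarrow> 'w \<Rightarrow> 'n \<Rightarrow> nat \<Rightarrow> real"
  assumes market: "market M b v s"
    and limit: "limit_FPPE M b v s \<beta> p x"
    and prob: "prob_space P"
    and indep: "prob_space.indep_vars P (\<lambda>_. M) \<theta> UNIV"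
    and law: "\<And>\<tau>. distr P M (\<theta> \<tau>) = density M (\<lambda>y. ennreal (s y))"
    and observed: "\<And>t \<omega>. t \<ge> 1 \<Longrightarrow> \<omega> \<in> space P \<Longrightarrow>
      observed_FPPE b v (1 / real t) t (\<lambda>\<tau>. \<theta> \<tau> \<omega>) (\<beta>g t \<omega>) (pg t \<omega>) (xg t \<omega>)"
  shows "tendsto_in_prob P \<beta>g \<beta> \<and>
    tendsto_in_prob P (\<lambda>t \<omega>. observed_REV t (pg t \<omega>)) (REV M s p) \<and>
    (SMO M v s \<beta> \<and> SCS M b s \<beta> p x \<longrightarrow>
      tendsto_in_prob P
        (\<lambda>t \<omega>. sqrt (real t) *\<^sub>R (\<beta>g t \<omega> - \<beta>)
             - (1 / sqrt (real t)) *\<^sub>R (\<Sum>\<tau><t. D_beta M b v s \<beta> x (\<theta> \<tau> \<omega>))) 0 \<and>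
      tendsto_in_prob P
        (\<lambda>t \<omega>. sqrt (real t) * (observed_REV t (pg t \<omega>) - REV M s p)
             - (1 / sqrt (real t)) * (\<Sum>\<tau><t. D_REV M b v s \<beta> p x (\<theta> \<tau> \<omega>))) 0 \<and>
      (\<exists>N. is_normal_law N 0 (Sigma_beta M b v s \<beta> x) \<and>
           tendsto_in_law P (\<lambda>t \<omega>. sqrt (real t) *\<^sub>R (\<beta>g t \<omega> - \<beta>)) N) \<and>
      Sigma_beta M b v s \<beta> x =
        pseudo_inverse (H_B M b v s \<beta>) ** Var_mat M s (mu v x) ** pseudo_inverse (H_B M b v s \<beta>) \<and>
      weak_conv_m
        (\<lambda>t. distr P borel (\<lambda>\<omega>. sqrt (real t) * (observed_REV t (pg t \<omega>) - REV M s p)))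
        (normal_law 0 (sigma2_REV M b v s \<beta> p x)))"
proof -
  interpret fppe_sample M b v s \<beta> p x P \<theta> \<beta>g pg xg
    by (rule fppe_sample.intro) (fact market limit prob indep law observed)+
  show ?thesis
  proof (intro conjI impI \<beta>g_consistent REV_consistent; elim conjE)
    assume smo: "SMO M v s \<beta>" and scs: "SCS M b s \<beta> p x"
    from smo obtain U g A where U: "open U" "\<beta> \<in> U"
      and g: "\<forall>y\<in>U. GDERIV (\<lambda>\<beta>'. Es M s (top_bid v \<beta>')) y :> g y"
      and A: "\<forall>y\<in>U. (g has_derivative (\<lambda>h. A y *v h)) (at y)"
      unfolding SMO_def C2_on_def by blast
    interpret smooth_fppe_sample M b v s \<beta> p x P \<theta> \<beta>g pg xg U g "A \<beta>"
    proof
      show "mu_bar M v s x $ i < b $ i" if "\<beta> $ i = 1" for i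
        using scs that by (auto simp: SCS_def leftover_def spend_eq)
      show "GDERIV rev_at z :> g z" if "z \<in> U" for z
        using g that by (simp add: rev_at_eq del: gderiv_deriv)
    qed (use U A in auto)
    note \<beta>g_asymptotically_linear REV_asymptotically_linear \<beta>g_asymptotically_normal
      Sigma_beta_sandwich REV_asymptotically_normal
    then show "tendsto_in_prob P
        (\<lambda>t \<omega>. sqrt (real t) *\<^sub>R (\<beta>g t \<omega> - \<beta>)
             - (1 / sqrt (real t)) *\<^sub>R (\<Sum>\<tau><t. D_beta M b v s \<beta> x (\<theta> \<tau> \<omega>))) 0"
      and "tendsto_in_prob P
        (\<lambda>t \<omega>. sqrt (real t) * (observed_REV t (pg t \<omega>) - REV M s p)
             - (1 / sqrt (real t)) * (\<Sum>\<tau><t. D_REV M b v s \<beta> p x (\<theta> \<tau> \<omega>))) 0"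
      and "\<exists>N. is_normal_law N 0 (Sigma_beta M b v s \<beta> x) \<and>
           tendsto_in_law P (\<lambda>t \<omega>. sqrt (real t) *\<^sub>R (\<beta>g t \<omega> - \<beta>)) N"
      and "Sigma_beta M b v s \<beta> x =
        pseudo_inverse (H_B M b v s \<beta>) ** Var_mat M s (mu v x) ** pseudo_inverse (H_B M b v s \<beta>)"
      and "weak_conv_m
        (\<lambda>t. distr P borel (\<lambda>\<omega>. sqrt (real t) * (observed_REV t (pg t \<omega>) - REV M s p)))
        (normal_law 0 (sigma2_REV M b v s \<beta> p x))"
      by this+
  qed
qed

end
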